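(* Let $f$ be a real-valued, nonvanishing, continuously differentiable function of $\xi\ge 0$ with $f(0)=1$, and consider the hyperbolic Vekua equation $$\partial_{\overline{z}}W-\frac{f'(\xi)}{2f(\xi)}\overline{W}=0,\qquad \partial_{\overline{z}}=\tfrac12(\partial_\xi-j\partial_t),$$ for a bicomplex-valued function $W(\xi,t)$. Let $W_0(t)$, $t\in[\alpha,\beta]$, be a given continuously differentiable bicomplex-valued function. Then the unique solution of this equation satisfying $W(0,t)=W_0(t)$ is given (for $\xi>0$ and $t$ with $t\pm\xi\in[\alpha,\beta]$) by $$\begin{aligned} W(\xi,t)&=\tfrac12\bigl(W_0^+(t+\xi)+W_0^-(t-\xi)\bigr)+\tfrac12\sum_{n=0}^\infty\frac{a_n(\xi)}{\xi}\int_{-\xi}^{\xi}P_n\!\left(\frac{\tau}{\xi}\right)\bigl(W_0^+(t+\tau)+W_0^-(t-\tau)\bigr)\,d\tau\\ &\quad+\tfrac{j}{2}\bigl(W_0^+(t+\xi)-W_0^-(t-\xi)\bigr)+\tfrac{j}{2}\sum_{n=0}^\infty\frac{b_n(\xi)}{\xi}\int_{-\xi}^{\xi}P_n\!\left(\frac{\tau}{\xi}\right)\bigl(W_0^+(t+\tau)-W_0^-(t-\tau)\bigr)\,d\tau\\ &=P^+W_0^+(t+\xi)+P^-W_0^-(t-\xi)+\frac{1}{2\xi}\sum_{n=0}^\infty\bigl(a_n(\xi)+jb_n(\xi)\bigr)\int_{-\xi}^{\xi}P_n\!\left(\frac{\tau}{\xi}\right)W_0^+(t+\tau)\,d\tau\\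 &\quad+\frac{1}{2\xi}\sum_{n=0}^\infty\bigl(a_n(\xi)-jb_n(\xi)\bigr)\int_{-\xi}^{\xi}P_n\!\left(\frac{\tau}{\xi}\right)W_0^-(t-\tau)\,d\tau . \end{aligned}$$ Consequently, for the 1+1 Maxwell system $\varepsilon(x)\partial_t\mathcal{E}=i\partial_x\mathcal{H}$, $i\partial_x\mathcal{E}=-\mu\partial_t\mathcal{H}$ with $\mathcal{E}(0,t)=\mathcal{E}_0(t)$, $\mathcal{H}(0,t)=\mathcal{H}_0(t)$ ($t\in[\alpha,\beta]$, $\mathcal{E}_0,\mathcal{H}_0$ continuously differentiable), with $f$, $W_0$ related to $\varepsilon,\mu,\mathcal{E}_0,\mathcal{H}_0$ as in the context, the unique solution is obtained from this $W$ via $\widetilde{\mathcal{E}}(\xi,t)=\frac{1}{\sqrt{\widetilde c(\xi)\widetilde\varepsilon(\xi)}}\mathcal{R}(W(\xi,t))$, $\widetilde{\mathcal{H}}(\xi,t)=-\frac{i}{\sqrt{\widetilde c(\xi)\mu}}\mathcal{I}(W(\xi,t))$ and the inverse change of variable $\xi\mapsto x$.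
   Context: Bicomplex numbers: $w=u+vj$ with $u,v\in\mathbb{C}$ (complex unit $i$), where $j$ is a hyperbolic imaginary unit, $j^2=1$, commuting with $i$. Conjugation with respect to $j$: $\overline{w}=u-vj$. Notation: $\mathcal{R}(w)=u$, $\mathcal{I}(w)=v$, $w^{\pm}=\mathcal{R}(w)\pm\mathcal{I}(w)$ (complex-valued), $P^{\pm}=\tfrac12(1\pm j)$. $P_n$ is the Legendre polynomial of degree $n$, $P_n(x)=\sum_{k=0}^n l_{k,n}x^k$. Recursive integrals: $X^{(0)}\equiv1$, $X^{(n)}(\xi)=n\int_0^\xi X^{(n-1)}(s)\,(f^2(s))^{(-1)^n}ds$; $\widetilde X^{(0)}\equiv1$, $\widetilde X^{(n)}(\xi)=n\int_0^\xi\widetilde X^{(n-1)}(s)\,(f^2(s))^{(-1)^{n-1}}ds$. Define $\varphi_k=fX^{(k)}$ for $k$ odd, $\varphi_k=f\widetilde X^{(k)}$ for $k$ even; $\psi_k=\widetilde X^{(k)}/f$ for $k$ odd, $\psi_k=X^{(k)}/f$ for $k$ even. Then $a_n(\xi)=\frac{2n+1}{2}\Bigl(\sum_{k=0}^n\frac{l_{k,n}\varphi_k(\xi)}{\xi^k}-1\Bigr)$, $b_n(\xi)=\frac{2n+1}{2}\Bigl(\sum_{k=0}^n\frac{l_{k,n}\psi_k(\xi)}{\xi^k}-1\Bigr)$. Maxwell setting: $\varepsilon(x)>0$ real-valued, $\mu>0$ constant, $c(x)=1/\sqrt{\varepsilon(x)\mu}$; $\mathcal{E}=E_2+iE_3$,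 $\mathcal{H}=H_2+iH_3$; new variable $\xi(x)=\sqrt{\mu}\int_0^x\sqrt{\varepsilon(s)}ds$; a tilde denotes a function of $x$ rewritten as a function of $\xi$, e.g. $\widetilde c(\xi(x))=c(x)$; $f(\xi)=\sqrt{\widetilde c(0)}/\sqrt{\widetilde c(\xi)}$; $W(\xi,t)=\sqrt{\widetilde c(\xi)}\bigl(\sqrt{\widetilde\varepsilon(\xi)}\,\widetilde{\mathcal{E}}(\xi,t)+ij\sqrt{\mu}\,\widetilde{\mathcal{H}}(\xi,t)\bigr)$ and $W_0=\sqrt{c(0)\varepsilon(0)}\,\mathcal{E}_0+ij\sqrt{c(0)\mu}\,\mathcal{H}_0$. *)

theory Defs
  imports "HOL-Analysis.Analysis" "HOL-Computational_Algebra.Polynomial"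
begin

text \<open>A bicomplex number w = u + v j (u, v complex, j hyperbolic unit, j^2 = 1,
  commuting with i) is represented by the pair (u, v).  Addition and real scaling
  are the componentwise (product vector space) operations.\<close>

type_synonym bicomplex = "complex \<times> complex"

definition bc_of_complex :: "complex \<Rightarrow> bicomplex" where
  "bc_of_complex u = (u, 0)"

definition bc_j :: bicomplex where
  "bc_j = (0, 1)"

definition bc_mult :: "bicomplex \<Rightarrow> bicomplex \<Rightarrow> bicomplex" where
  "bc_mult w z = (fst w * fst z + snd w * snd z, fst w * snd z + snd w * fst z)"

definition bc_conj :: "bicomplex \<Rightarrow> bicomplex" where
  "bc_conj w = (fst w, - snd w)"

definition bc_R :: "bicomplex \<Rightarrow> complex" where
  "bc_R w = fst w"

definition bc_I :: "bicomplex \<Rightarrow> complex" where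
  "bc_I w = snd w"

definition bc_plus :: "bicomplex \<Rightarrow> complex" where
  "bc_plus w = bc_R w + bc_I w"

definition bc_minus :: "bicomplex \<Rightarrow> complex" where
  "bc_minus w = bc_R w - bc_I w"

definition bc_Pp :: bicomplex where
  "bc_Pp = (1/2) *\<^sub>R (bc_of_complex 1 + bc_j)"

definition bc_Pm :: bicomplex where
  "bc_Pm = (1/2) *\<^sub>R (bc_of_complex 1 - bc_j)"

definition C1_on :: "real set \<Rightarrow> (real \<Rightarrow> 'a::real_normed_vector) \<Rightarrow> bool" where
  "C1_on S g \<longleftrightarrow> (\<exists>g'. continuous_on S g' \<and>
      (\<forall>x\<in>S. (g has_vector_derivative g' x) (at x within S)))"

text \<open>Defined by P_0 = 1, P_1 = x and Bonnet's recursion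
  (n+1) P_(n+1) = (2n+1) x P_n - n P_(n-1).  The coefficient l_(k,n) is
  coeff (legendre n) k.\<close>

fun legendre :: "nat \<Rightarrow> real poly" where
  "legendre 0 = 1"
| "legendre (Suc 0) = [:0, 1:]"
| "legendre (Suc (Suc n)) =
     smult (1 / real (n + 2))
       (smult (real (2 * n + 3)) ([:0, 1:] * legendre (Suc n)) - smult (real (n + 1)) (legendre n))"

primrec Xrec :: "(real \<Rightarrow> real) \<Rightarrow> nat \<Rightarrow> real \<Rightarrow> real" where
  "Xrec f 0 = (\<lambda>\<xi>. 1)"
| "Xrec f (Suc n) = (\<lambda>\<xi>. real (Suc n) *
     integral {0..\<xi>} (\<lambda>s. Xrec f n s * (if even (Suc n) then (f s)\<^sup>2 else 1 / (f s)\<^sup>2)))"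

primrec Xtil :: "(real \<Rightarrow> real) \<Rightarrow> nat \<Rightarrow> real \<Rightarrow> real" where
  "Xtil f 0 = (\<lambda>\<xi>. 1)"
| "Xtil f (Suc n) = (\<lambda>\<xi>. real (Suc n) *
     integral {0..\<xi>} (\<lambda>s. Xtil f n s * (if even n then (f s)\<^sup>2 else 1 / (f s)\<^sup>2)))"

definition phi :: "(real \<Rightarrow> real) \<Rightarrow> nat \<Rightarrow> real \<Rightarrow> real" where
  "phi f k \<xi> = (if odd k then f \<xi> * Xrec f k \<xi> else f \<xi> * Xtil f k \<xi>)"

definition psi :: "(real \<Rightarrow> real) \<Rightarrow> nat \<Rightarrow> real \<Rightarrow> real" where
  "psi f k \<xi> = (if odd k then Xtil f k \<xi> / f \<xi> else Xrec f k \<xi> / f \<xi>)"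

definition acoef :: "(real \<Rightarrow> real) \<Rightarrow> nat \<Rightarrow> real \<Rightarrow> real" where
  "acoef f n \<xi> = (2 * real n + 1) / 2 *
     ((\<Sum>k\<le>n. coeff (legendre n) k * phi f k \<xi> / \<xi> ^ k) - 1)"

definition bcoef :: "(real \<Rightarrow> real) \<Rightarrow> nat \<Rightarrow> real \<Rightarrow> real" where
  "bcoef f n \<xi> = (2 * real n + 1) / 2 *
     ((\<Sum>k\<le>n. coeff (legendre n) k * psi f k \<xi> / \<xi> ^ k) - 1)"

definition termA1 :: "(real \<Rightarrow> real) \<Rightarrow> (real \<Rightarrow> bicomplex) \<Rightarrow> real \<Rightarrow> real \<Rightarrow> nat \<Rightarrow> complex" where
  "termA1 f W0 \<xi> t n = complex_of_real (acoef f n \<xi> / \<xi>) *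
     integral {-\<xi>..\<xi>} (\<lambda>\<tau>. complex_of_real (poly (legendre n) (\<tau> / \<xi>)) *
        (bc_plus (W0 (t + \<tau>)) + bc_minus (W0 (t - \<tau>))))"

definition termB1 :: "(real \<Rightarrow> real) \<Rightarrow> (real \<Rightarrow> bicomplex) \<Rightarrow> real \<Rightarrow> real \<Rightarrow> nat \<Rightarrow> complex" where
  "termB1 f W0 \<xi> t n = complex_of_real (bcoef f n \<xi> / \<xi>) *
     integral {-\<xi>..\<xi>} (\<lambda>\<tau>. complex_of_real (poly (legendre n) (\<tau> / \<xi>)) *
        (bc_plus (W0 (t + \<tau>)) - bc_minus (W0 (t - \<tau>))))"

definition vekua_formula1 :: "(real \<Rightarrow> real) \<Rightarrow> (real \<Rightarrow> bicomplex) \<Rightarrow> real \<Rightarrow> real \<Rightarrow> bicomplex" where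
  "vekua_formula1 f W0 \<xi> t =
     bc_of_complex ((1/2) * (bc_plus (W0 (t + \<xi>)) + bc_minus (W0 (t - \<xi>)))
                    + (1/2) * (\<Sum>n. termA1 f W0 \<xi> t n))
   + bc_mult bc_j (bc_of_complex ((1/2) * (bc_plus (W0 (t + \<xi>)) - bc_minus (W0 (t - \<xi>)))
                    + (1/2) * (\<Sum>n. termB1 f W0 \<xi> t n)))"

definition termA2 :: "(real \<Rightarrow> real) \<Rightarrow> (real \<Rightarrow> bicomplex) \<Rightarrow> real \<Rightarrow> real \<Rightarrow> nat \<Rightarrow> bicomplex" where
  "termA2 f W0 \<xi> t n =
     bc_mult (bc_of_complex (complex_of_real (acoef f n \<xi>))
              + bc_mult bc_j (bc_of_complex (complex_of_real (bcoef f n \<xi>))))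
       (bc_of_complex (integral {-\<xi>..\<xi>}
          (\<lambda>\<tau>. complex_of_real (poly (legendre n) (\<tau> / \<xi>)) * bc_plus (W0 (t + \<tau>)))))"

definition termB2 :: "(real \<Rightarrow> real) \<Rightarrow> (real \<Rightarrow> bicomplex) \<Rightarrow> real \<Rightarrow> real \<Rightarrow> nat \<Rightarrow> bicomplex" where
  "termB2 f W0 \<xi> t n =
     bc_mult (bc_of_complex (complex_of_real (acoef f n \<xi>))
              - bc_mult bc_j (bc_of_complex (complex_of_real (bcoef f n \<xi>))))
       (bc_of_complex (integral {-\<xi>..\<xi>}
          (\<lambda>\<tau>. complex_of_real (poly (legendre n) (\<tau> / \<xi>)) * bc_minus (W0 (t - \<tau>)))))"

definition vekua_formula2 :: "(real \<Rightarrow> real) \<Rightarrow> (real \<Rightarrow> bicomplex) \<Rightarrow> real \<Rightarrow> real \<Rightarrow> bicomplex" where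
  "vekua_formula2 f W0 \<xi> t =
     bc_mult bc_Pp (bc_of_complex (bc_plus (W0 (t + \<xi>))))
   + bc_mult bc_Pm (bc_of_complex (bc_minus (W0 (t - \<xi>))))
   + (1 / (2 * \<xi>)) *\<^sub>R (\<Sum>n. termA2 f W0 \<xi> t n)
   + (1 / (2 * \<xi>)) *\<^sub>R (\<Sum>n. termB2 f W0 \<xi> t n)"

definition char_triangle :: "real \<Rightarrow> real \<Rightarrow> (real \<times> real) set" where
  "char_triangle \<alpha> \<beta> = {(\<xi>, t). 0 \<le> \<xi> \<and> \<alpha> \<le> t - \<xi> \<and> t + \<xi> \<le> \<beta>}"

definition char_triangle_int :: "real \<Rightarrow> real \<Rightarrow> (real \<times> real) set" where
  "char_triangle_int \<alpha> \<beta> = {(\<xi>, t). 0 < \<xi> \<and> \<alpha> < t - \<xi> \<and> t + \<xi> < \<beta>}"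

definition vekua_solution ::
  "(real \<Rightarrow> real) \<Rightarrow> real \<Rightarrow> real \<Rightarrow> (real \<Rightarrow> bicomplex) \<Rightarrow> (real \<Rightarrow> real \<Rightarrow> bicomplex) \<Rightarrow> bool" where
  "vekua_solution f \<alpha> \<beta> W0 W \<longleftrightarrow>
     continuous_on (char_triangle \<alpha> \<beta>) (\<lambda>(\<xi>, t). W \<xi> t) \<and>
     (\<forall>t\<in>{\<alpha>..\<beta>}. W 0 t = W0 t) \<and>
     (\<exists>W\<xi> Wt.
        continuous_on (char_triangle_int \<alpha> \<beta>) (\<lambda>(\<xi>, t). W\<xi> \<xi> t) \<and>
        continuous_on (char_triangle_int \<alpha> \<beta>) (\<lambda>(\<xi>, t). Wt \<xi> t) \<and>
        (\<forall>\<xi> t. (\<xi>, t) \<in> char_triangle_int \<alpha> \<beta> \<longrightarrow>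
           ((\<lambda>s. W s t) has_vector_derivative W\<xi> \<xi> t) (at \<xi>) \<and>
           ((\<lambda>s. W \<xi> s) has_vector_derivative Wt \<xi> t) (at t) \<and>
           (1/2) *\<^sub>R (W\<xi> \<xi> t - bc_mult bc_j (Wt \<xi> t))
             - (deriv f \<xi> / (2 * f \<xi>)) *\<^sub>R bc_conj (W \<xi> t) = 0))"

definition c_of :: "(real \<Rightarrow> real) \<Rightarrow> real \<Rightarrow> real \<Rightarrow> real" where
  "c_of \<epsilon> \<mu> x = 1 / sqrt (\<epsilon> x * \<mu>)"

definition xi_of :: "(real \<Rightarrow> real) \<Rightarrow> real \<Rightarrow> real \<Rightarrow> real" where
  "xi_of \<epsilon> \<mu> x = sqrt \<mu> * integral {0..x} (\<lambda>s. sqrt (\<epsilon> s))"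

definition x_of :: "(real \<Rightarrow> real) \<Rightarrow> real \<Rightarrow> real \<Rightarrow> real" where
  "x_of \<epsilon> \<mu> \<xi> = (THE x. 0 \<le> x \<and> xi_of \<epsilon> \<mu> x = \<xi>)"

definition f_of :: "(real \<Rightarrow> real) \<Rightarrow> real \<Rightarrow> real \<Rightarrow> real" where
  "f_of \<epsilon> \<mu> \<xi> = sqrt (c_of \<epsilon> \<mu> 0) / sqrt (c_of \<epsilon> \<mu> (x_of \<epsilon> \<mu> \<xi>))"

definition W0_of :: "(real \<Rightarrow> real) \<Rightarrow> real \<Rightarrow> (real \<Rightarrow> complex) \<Rightarrow> (real \<Rightarrow> complex) \<Rightarrow> real \<Rightarrow> bicomplex" where
  "W0_of \<epsilon> \<mu> E0 H0 t =
     bc_of_complex (complex_of_real (sqrt (c_of \<epsilon> \<mu> 0 * \<epsilon> 0)) * E0 t)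
   + bc_mult bc_j (bc_of_complex (\<i> * complex_of_real (sqrt (c_of \<epsilon> \<mu> 0 * \<mu>)) * H0 t))"

definition maxwell_domain :: "(real \<Rightarrow> real) \<Rightarrow> real \<Rightarrow> real \<Rightarrow> real \<Rightarrow> (real \<times> real) set" where
  "maxwell_domain \<epsilon> \<mu> \<alpha> \<beta> =
     {(x, t). 0 \<le> x \<and> \<alpha> \<le> t - xi_of \<epsilon> \<mu> x \<and> t + xi_of \<epsilon> \<mu> x \<le> \<beta>}"

definition maxwell_domain_int :: "(real \<Rightarrow> real) \<Rightarrow> real \<Rightarrow> real \<Rightarrow> real \<Rightarrow> (real \<times> real) set" where
  "maxwell_domain_int \<epsilon> \<mu> \<alpha> \<beta> =
     {(x, t). 0 < x \<and> \<alpha> < t - xi_of \<epsilon> \<mu> x \<and> t + xi_of \<epsilon> \<mu> x < \<beta>}"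

definition maxwell_solution ::
  "(real \<Rightarrow> real) \<Rightarrow> real \<Rightarrow> real \<Rightarrow> real \<Rightarrow> (real \<Rightarrow> complex) \<Rightarrow> (real \<Rightarrow> complex)
   \<Rightarrow> (real \<Rightarrow> real \<Rightarrow> complex) \<Rightarrow> (real \<Rightarrow> real \<Rightarrow> complex) \<Rightarrow> bool" where
  "maxwell_solution \<epsilon> \<mu> \<alpha> \<beta> E0 H0 E H \<longleftrightarrow>
     continuous_on (maxwell_domain \<epsilon> \<mu> \<alpha> \<beta>) (\<lambda>(x, t). E x t) \<and>
     continuous_on (maxwell_domain \<epsilon> \<mu> \<alpha> \<beta>) (\<lambda>(x, t). H x t) \<and>
     (\<forall>t\<in>{\<alpha>..\<beta>}. E 0 t = E0 t \<and> H 0 t = H0 t) \<and>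
     (\<exists>Ex Et Hx Ht.
        continuous_on (maxwell_domain_int \<epsilon> \<mu> \<alpha> \<beta>) (\<lambda>(x, t). Ex x t) \<and>
        continuous_on (maxwell_domain_int \<epsilon> \<mu> \<alpha> \<beta>) (\<lambda>(x, t). Et x t) \<and>
        continuous_on (maxwell_domain_int \<epsilon> \<mu> \<alpha> \<beta>) (\<lambda>(x, t). Hx x t) \<and>
        continuous_on (maxwell_domain_int \<epsilon> \<mu> \<alpha> \<beta>) (\<lambda>(x, t). Ht x t) \<and>
        (\<forall>x t. (x, t) \<in> maxwell_domain_int \<epsilon> \<mu> \<alpha> \<beta> \<longrightarrow>
           ((\<lambda>s. E s t) has_vector_derivative Ex x t) (at x) \<and>
           ((\<lambda>s. E x s) has_vector_derivative Et x t) (at t) \<and>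
           ((\<lambda>s. H s t) has_vector_derivative Hx x t) (at x) \<and>
           ((\<lambda>s. H x s) has_vector_derivative Ht x t) (at t) \<and>
           complex_of_real (\<epsilon> x) * Et x t = \<i> * Hx x t \<and>
           \<i> * Ex x t = - complex_of_real \<mu> * Ht x t))"

end

theory Submission
  imports Defs
begin

text \<open>In the characteristic components \<open>p = W\<^sup>+\<close>, \<open>m = W\<^sup>-\<close> the Vekua equation reads
  \<open>p\<^sub>\<xi> - p\<^sub>t = q m\<close>, \<open>m\<^sub>\<xi> + m\<^sub>t = q p\<close> with \<open>q = f'/f\<close>.  Integrating along characteristics bounds
  \<open>p(\<xi>,t) - p\<^sub>0(t+\<xi>)\<close> and \<open>m(\<xi>,t) - m\<^sub>0(t-\<xi>)\<close> by the \<open>L\<^sup>1\<close> norm of the data on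
  \<open>[t-\<xi>, t+\<xi>]\<close>; uniqueness is a special case.  The formal powers \<open>Z\<^sub>j = \<phi>\<^sub>j + j \<psi>\<^sub>j\<close> satisfy
  \<open>Z\<^sub>j' = j k Z\<^sub>j\<^sub>-\<^sub>1 + q conj Z\<^sub>j\<close> (\<open>k\<close> the hyperbolic unit), so for a polynomial \<open>G\<close> the data \<open>p\<^sub>0 = G\<close>, \<open>m\<^sub>0 = 0\<close>
  have the explicit solution \<open>1/2 \<Sum>\<^sub>j Z\<^sub>j(\<xi>) G\<^sup>(\<^sup>j\<^sup>)(t) / j!\<close>.
  Approximating data by polynomials in the C1 norm, the a priori bound yields existence.  Approximating
  by partial sums of the Legendre series, which converge in \<open>L\<^sup>2\<close> and hence in \<open>L\<^sup>1\<close>, it yields the series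
  formula when \<open>m\<^sub>0 = 0\<close>; no transmutation kernel is needed.  The general case follows from the
  symmetry \<open>W(\<xi>,t) \<mapsto> conj W(\<xi>,-t)\<close>, which exchanges \<open>p\<close> and \<open>m\<close>.  The change of variable \<open>x \<mapsto> \<xi>(x)\<close>
  together with the squeeze mapping by \<open>(\<epsilon>/\<mu>)\<^bsup>1/4\<^esup>\<close> turns the Maxwell system into the Vekua equation.\<close>

section \<open>Continuously differentiable functions and polynomial approximation\<close>

lemma C1_on_bounded_linear:
  assumes "bounded_linear L" "C1_on T g"
  shows "C1_on T (\<lambda>x. L (g x))"
proof -
  obtain g' where g': "continuous_on T g'" "\<And>x. x \<in> T \<Longrightarrow> (g has_vector_derivative g' x) (at x within T)"
    using assms(2) unfolding C1_on_def by blast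
  show ?thesis
    unfolding C1_on_def
    by (intro exI[of _ "\<lambda>x. L (g' x)"] conjI ballI bounded_linear.continuous_on[OF assms(1)]
        bounded_linear.has_vector_derivative[OF assms(1)] g')
qed

lemma C1_on_Pair:
  assumes "C1_on T f" "C1_on T g"
  shows "C1_on T (\<lambda>x. (f x, g x))"
proof -
  obtain f' g' where "continuous_on T f'" "\<And>x. x \<in> T \<Longrightarrow> (f has_vector_derivative f' x) (at x within T)"
    "continuous_on T g'" "\<And>x. x \<in> T \<Longrightarrow> (g has_vector_derivative g' x) (at x within T)"
    using assms unfolding C1_on_def by blast
  then show ?thesis
    unfolding C1_on_def
    by (intro exI[of _ "\<lambda>x. (f' x, g' x)"] conjI ballI continuous_on_Pair has_vector_derivative_Pair)
qed

lemma C1_on_affine: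
  assumes g: "C1_on T g" and sub: "\<And>x. x \<in> T' \<Longrightarrow> c + k * x \<in> T"
  shows "C1_on T' (\<lambda>x. g (c + k * x))"
proof -
  obtain g' where g': "continuous_on T g'" "\<And>x. x \<in> T \<Longrightarrow> (g has_vector_derivative g' x) (at x within T)"
    using g unfolding C1_on_def by blast
  have img: "(\<lambda>x. c + k * x) ` T' \<subseteq> T" using sub by auto
  show ?thesis
    unfolding C1_on_def
  proof (intro exI[of _ "\<lambda>x. k *\<^sub>R g' (c + k * x)"] conjI ballI)
    show "continuous_on T' (\<lambda>x. k *\<^sub>R g' (c + k * x))"
      by (intro continuous_intros continuous_on_compose2[OF g'(1) _ img])
    fix x assume x: "x \<in> T'"
    have "((\<lambda>x. c + k * x) has_vector_derivative k) (at x within T')"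
      by (auto intro!: derivative_eq_intros)
    moreover have "(g has_vector_derivative g' (c + k * x)) (at (c + k * x) within (\<lambda>x. c + k * x) ` T')"
      by (rule has_vector_derivative_within_subset[OF g'(2)[OF sub[OF x]] img])
    ultimately show "((\<lambda>x. g (c + k * x)) has_vector_derivative k *\<^sub>R g' (c + k * x)) (at x within T')"
      using vector_diff_chain_within by (fastforce simp: o_def)
  qed
qed

lemma polynomial_function_eq_complex_poly:
  fixes p :: "real \<Rightarrow> complex"
  assumes "polynomial_function p"
  shows "\<exists>H. p = (\<lambda>x. poly H (of_real x))"
proof -
  have real_part: "\<exists>H :: complex poly. \<forall>x. poly H (of_real x) = of_real (L (p x))"
    if "bounded_linear L" for L :: "complex \<Rightarrow> real"
  proof -
    have "real_polynomial_function (\<lambda>x. L (p x))"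
      using assms that by (auto simp: polynomial_function_def o_def)
    then obtain a n where "\<And>x. L (p x) = (\<Sum>i\<le>n. a i * x ^ i)"
      unfolding real_polynomial_function_iff_sum by metis
    then show ?thesis
      by (intro exI[of _ "\<Sum>i\<le>n. monom (of_real (a i)) i"]) (simp add: poly_sum poly_monom)
  qed
  obtain H K :: "complex poly" where
    "\<And>x. poly H (of_real x) = of_real (Re (p x))" "\<And>x. poly K (of_real x) = of_real (Im (p x))"
    using real_part[OF bounded_linear_Re] real_part[OF bounded_linear_Im] by blast
  then have "p = (\<lambda>x. poly (H + smult \<i> K) (of_real x))"
    by (simp add: fun_eq_iff complex_eq)
  then show ?thesis by blast
qed

lemma complex_polynomial_uniform_limit:
  fixes h :: "real \<Rightarrow> complex"
  assumes "compact A" "continuous_on A h"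
  obtains H :: "nat \<Rightarrow> complex poly" where "uniform_limit A (\<lambda>n x. poly (H n) (of_real x)) h sequentially"
proof -
  obtain p where p: "uniform_limit A p h sequentially" "\<And>n. polynomial_function (p n)"
    using Stone_Weierstrass_uniform_limit[OF assms] by blast
  have "\<forall>n. \<exists>H. p n = (\<lambda>x. poly H (of_real x))"
    using polynomial_function_eq_complex_poly p(2) by blast
  then obtain H where "\<And>n. p n = (\<lambda>x. poly (H n) (of_real x))" by metis
  then have "p = (\<lambda>n x. poly (H n) (of_real x))" by (simp add: fun_eq_iff)
  with p(1) show ?thesis using that[of H] by (simp only:)
qed

lemma poly_antiderivative:
  fixes H :: "'a::field_char_0 poly"
  shows "\<exists>G. pderiv G = H \<and> poly G a = b"
proof -
  define G where "G = Abs_poly (\<lambda>n. if n = 0 then 0 else coeff H (n - 1) / of_nat n)"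
  have "coeff G = (\<lambda>n. if n = 0 then 0 else coeff H (n - 1) / of_nat n)"
    unfolding G_def by (rule coeff_Abs_poly[of "Suc (degree H)"]) (auto simp: coeff_eq_0)
  then have "pderiv G = H"
    by (intro poly_eqI) (simp add: coeff_pderiv del: of_nat_Suc)
  then have "pderiv (G + [:b - poly G a:]) = H \<and> poly (G + [:b - poly G a:]) a = b"
    by (simp add: pderiv_add pderiv_pCons)
  then show ?thesis by blast
qed

lemma has_vector_derivative_poly_of_real:
  fixes G :: "'a::real_normed_field poly"
  shows "((\<lambda>x. poly G (of_real x)) has_vector_derivative poly (pderiv G) (of_real x)) (at x within A)"
  by (rule has_vector_derivative_real_field[OF poly_DERIV])

lemma uniform_limit_antiderivative:
  fixes F :: "nat \<Rightarrow> real \<Rightarrow> 'a::real_normed_vector"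
  assumes F': "\<And>n x. x \<in> {a..b} \<Longrightarrow> (F n has_vector_derivative F' n x) (at x within {a..b})"
    and g': "\<And>x. x \<in> {a..b} \<Longrightarrow> (g has_vector_derivative g' x) (at x within {a..b})"
    and initial: "\<And>n. F n a = g a"
    and lim: "uniform_limit {a..b} F' g' sequentially"
  shows "uniform_limit {a..b} F g sequentially"
proof (rule uniform_limitI)
  fix e :: real assume "e > 0"
  define d where "d = e / (\<bar>b - a\<bar> + 1)"
  have "d > 0" "d * \<bar>b - a\<bar> < e" using \<open>e > 0\<close> by (auto simp: d_def field_simps)
  from uniform_limitD[OF lim \<open>d > 0\<close>]
  show "\<forall>\<^sub>F n in sequentially. \<forall>x\<in>{a..b}. dist (F n x) (g x) < e"
  proof (eventually_elim, intro ballI)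
    fix n x assume close: "\<forall>x\<in>{a..b}. dist (F' n x) (g' x) < d" and x: "x \<in> {a..b}"
    have "norm ((F n x - g x) - (F n a - g a)) \<le> d * norm (x - a)"
    proof (rule differentiable_bound)
      show "((\<lambda>x. F n x - g x) has_derivative (\<lambda>h. h *\<^sub>R (F' n y - g' y))) (at y within {a..b})"
        if "y \<in> {a..b}" for y
        using has_vector_derivative_diff[OF F' g'] that by (simp add: has_vector_derivative_def)
      show "onorm (\<lambda>h. h *\<^sub>R (F' n y - g' y)) \<le> d" if "y \<in> {a..b}" for y
      proof (rule onorm_bound)
        have deriv_close: "norm (F' n y - g' y) \<le> d" using close that by (auto simp: dist_norm less_imp_le)
        show "norm (h *\<^sub>R (F' n y - g' y)) \<le> d * norm h" for h
          using mult_right_mono[OF deriv_close norm_ge_zero[of h]] by (simp add: mult.commute)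
      qed (use \<open>d > 0\<close> in simp)
    qed (use x in auto)
    also have "\<dots> \<le> d * \<bar>b - a\<bar>" using x \<open>d > 0\<close> by (intro mult_left_mono) auto
    finally show "dist (F n x) (g x) < e"
      using \<open>d * \<bar>b - a\<bar> < e\<close> by (simp add: dist_norm initial)
  qed
qed

lemma C1_polynomial_uniform_limit:
  fixes g :: "real \<Rightarrow> complex"
  assumes "C1_on {a..b} g"
  obtains G :: "nat \<Rightarrow> complex poly" and g' where
    "uniform_limit {a..b} (\<lambda>n x. poly (G n) (of_real x)) g sequentially"
    "uniform_limit {a..b} (\<lambda>n x. poly (pderiv (G n)) (of_real x)) g' sequentially"
proof -
  obtain g' where g': "continuous_on {a..b} g'"
    "\<And>x. x \<in> {a..b} \<Longrightarrow> (g has_vector_derivative g' x) (at x within {a..b})"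
    using assms unfolding C1_on_def by blast
  obtain H where H: "uniform_limit {a..b} (\<lambda>n x. poly (H n) (of_real x)) g' sequentially"
    using complex_polynomial_uniform_limit[OF compact_Icc g'(1)] .
  have "\<forall>n. \<exists>G. pderiv G = H n \<and> poly G (of_real a) = g a"
    using poly_antiderivative by blast
  then obtain G where G: "\<And>n. pderiv (G n) = H n" "\<And>n. poly (G n) (of_real a) = g a" by metis
  have "uniform_limit {a..b} (\<lambda>n x. poly (G n) (of_real x)) g sequentially"
    by (rule uniform_limit_antiderivative[OF _ g'(2) _ H])
       (auto simp flip: G(1) intro: has_vector_derivative_poly_of_real simp: G(2))
  with H show ?thesis using that[of G g'] by (simp add: G(1))
qed

section \<open>Legendre polynomials\<close>

declare legendre.simps(3) [simp del]

abbreviation Leg :: "nat \<Rightarrow> real \<Rightarrow> real" where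
  "Leg n \<equiv> poly (legendre n)"

abbreviation dLeg :: "nat \<Rightarrow> real \<Rightarrow> real" where
  "dLeg n \<equiv> poly (pderiv (legendre n))"

lemma legendre_bonnet:
  "(real n + 2) * Leg (Suc (Suc n)) x = (2 * real n + 3) * x * Leg (Suc n) x - (real n + 1) * Leg n x"
  by (simp add: legendre.simps(3) field_simps)

lemma pderiv_legendre_bonnet:
  "(real n + 2) * dLeg (Suc (Suc n)) x =
     (2 * real n + 3) * (Leg (Suc n) x + x * dLeg (Suc n) x) - (real n + 1) * dLeg n x"
proof -
  have "dLeg (Suc (Suc n)) x = 1 / (real n + 2) *
     ((2 * real n + 3) * (Leg (Suc n) x + x * dLeg (Suc n) x) - (real n + 1) * dLeg n x)"
    by (simp add: legendre.simps(3) pderiv_smult pderiv_diff pderiv_mult pderiv_pCons) (simp add: field_simps)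
  then show ?thesis by (simp add: field_simps)
qed

lemma legendre_at_one [simp]: "Leg n 1 = 1"
proof (induction n rule: legendre.induct)
  case (3 n)
  then show ?case using legendre_bonnet[of n 1] by simp
qed auto

lemma legendre_derivative_identities:
  "dLeg (Suc n) x - x * dLeg n x = (real n + 1) * Leg n x \<and>
   x * dLeg (Suc n) x - dLeg n x = (real n + 1) * Leg (Suc n) x"
proof (induction n)
  case 0
  then show ?case by (simp add: pderiv_pCons)
next
  case (Suc n)
  have "(real n + 2) * (dLeg (Suc (Suc n)) x - x * dLeg (Suc n) x) =
      (real n + 2) * ((real n + 2) * Leg (Suc n) x)"
    using pderiv_legendre_bonnet[of n x] Suc by algebra
  then have first: "dLeg (Suc (Suc n)) x - x * dLeg (Suc n) x = (real n + 2) * Leg (Suc n) x"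
    by simp
  have "x * dLeg (Suc (Suc n)) x - dLeg (Suc n) x = (real n + 2) * Leg (Suc (Suc n)) x"
    using legendre_bonnet[of n x] Suc first by algebra
  with first show ?case by (simp add: add.commute)
qed

text \<open>Legendre's equation in self-adjoint form; orthogonality follows because \<open>x\<^sup>2 - 1\<close> vanishes at \<open>\<plusminus>1\<close>.\<close>

lemma legendre_ode:
  "((\<lambda>x. (x\<^sup>2 - 1) * dLeg n x) has_real_derivative real n * (real n + 1) * Leg n x) (at x)"
proof (cases n)
  case 0
  then show ?thesis by simp
next
  case (Suc m)
  have flux: "(y\<^sup>2 - 1) * dLeg n y = real n * (y * Leg n y - Leg m y)" for y
    using legendre_derivative_identities[of m y] unfolding Suc of_nat_Suc by algebra
  have "((\<lambda>x. real n * (x * Leg n x - Leg m x)) has_real_derivative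
      real n * (Leg n x + x * dLeg n x - dLeg m x)) (at x)"
    by (auto intro!: derivative_eq_intros poly_DERIV)
  moreover have "Leg n x + x * dLeg n x - dLeg m x = (real n + 1) * Leg n x"
    using legendre_derivative_identities[of m x] unfolding Suc of_nat_Suc by algebra
  ultimately show ?thesis unfolding flux by (simp only: mult.assoc)
qed

lemma legendre_orthogonal:
  assumes "n \<noteq> m"
  shows "integral {-1..1} (\<lambda>x. Leg n x * Leg m x) = 0"
proof -
  define F where "F k x = (x\<^sup>2 - 1) * dLeg k x" for k x
  define \<nu> where "\<nu> = real n * (real n + 1) - real m * (real m + 1)"
  have "((\<lambda>x. F n x * Leg m x - F m x * Leg n x) has_real_derivative \<nu> * (Leg n x * Leg m x)) (at x)" for x
    unfolding F_def \<nu>_def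
    by (rule derivative_eq_intros legendre_ode poly_DERIV refl | simp)+ (simp add: algebra_simps)
  then have "((\<lambda>x. \<nu> * (Leg n x * Leg m x)) has_integral
      (F n 1 * Leg m 1 - F m 1 * Leg n 1) - (F n (-1) * Leg m (-1) - F m (-1) * Leg n (-1))) {-1..1}"
    by (intro fundamental_theorem_of_calculus)
       (auto simp: has_real_derivative_iff_has_vector_derivative[symmetric] has_field_derivative_at_within)
  then have "((\<lambda>x. \<nu> * (Leg n x * Leg m x)) has_integral 0) {-1..1}"
    by (simp add: F_def)
  then have "integral {-1..1} (\<lambda>x. \<nu> * (Leg n x * Leg m x)) = 0"
    by (rule integral_unique)
  moreover have "\<nu> = (real n - real m) * (real n + real m + 1)"
    by (simp add: \<nu>_def algebra_simps)
  with assms have "\<nu> \<noteq> 0" by simp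
  ultimately show ?thesis by simp
qed

lemma integral_legendre_bonnet:
  "(real n + 2) * integral {-1..1} (\<lambda>x. Leg (Suc (Suc n)) x * Leg k x) +
   (real n + 1) * integral {-1..1} (\<lambda>x. Leg n x * Leg k x) =
   (2 * real n + 3) * integral {-1..1} (\<lambda>x. x * Leg (Suc n) x * Leg k x)"
proof -
  have integrable: "(\<lambda>x. c * (Leg i x * Leg k x)) integrable_on {-1..1}" for c i
    by (intro integrable_continuous_real continuous_intros)
  have bonnet: "(2 * real n + 3) * (x * Leg (Suc n) x * Leg k x) =
      (real n + 2) * (Leg (Suc (Suc n)) x * Leg k x) + (real n + 1) * (Leg n x * Leg k x)" for x
    using legendre_bonnet[of n x] by algebra
  have "(2 * real n + 3) * integral {-1..1} (\<lambda>x. x * Leg (Suc n) x * Leg k x) =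
      integral {-1..1} (\<lambda>x. (real n + 2) * (Leg (Suc (Suc n)) x * Leg k x) +
        (real n + 1) * (Leg n x * Leg k x))"
    unfolding bonnet[symmetric] by simp
  then show ?thesis
    by (simp add: Henstock_Kurzweil_Integration.integral_add[OF integrable integrable])
qed

lemma legendre_norm: "integral {-1..1} (\<lambda>x. Leg n x * Leg n x) = 2 / (2 * real n + 1)"
proof -
  define I where "I n = integral {-1..1} (\<lambda>x. Leg n x * Leg n x)" for n
  define J where "J n = integral {-1..1} (\<lambda>x. x * Leg (Suc n) x * Leg n x)" for n
  have lower: "(real n + 1) * I n = (2 * real n + 3) * J n" for n
    using integral_legendre_bonnet[of n n] legendre_orthogonal[of "Suc (Suc n)" n] by (simp add: I_def J_def)
  have upper: "(real n + 2) * I (Suc (Suc n)) = (2 * real n + 3) * J (Suc n)" for n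
  proof -
    have "(\<lambda>x. x * Leg (Suc n) x * Leg (Suc (Suc n)) x) = (\<lambda>x. x * Leg (Suc (Suc n)) x * Leg (Suc n) x)"
      by (simp add: fun_eq_iff)
    then show ?thesis
      using integral_legendre_bonnet[of n "Suc (Suc n)"] legendre_orthogonal[of n "Suc (Suc n)"]
      by (simp add: I_def J_def)
  qed
  have "I n = 2 / (2 * real n + 1)"
  proof (induction n rule: legendre.induct)
    case 1
    then show ?case by (simp add: I_def)
  next
    case 2
    have "I (Suc 0) = J 0" by (simp add: I_def J_def)
    then show ?case using lower[of 0] by (simp add: I_def)
  next
    case (3 n)
    have "(real n + 2) * I (Suc n) = (2 * real n + 5) * J (Suc n)"
      using lower[of "Suc n"] by (simp add: algebra_simps)
    with upper[of n]
    have "(real n + 2) * ((2 * real n + 5) * I (Suc (Suc n))) = (real n + 2) * ((2 * real n + 3) * I (Suc n))"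
      by algebra
    then have "(2 * real n + 5) * I (Suc (Suc n)) = (2 * real n + 3) * I (Suc n)" by simp
    also have "\<dots> = 2" using "3.IH"(1) by (simp add: field_simps)
    finally show ?case by (simp add: field_simps)
  qed
  then show ?thesis by (simp add: I_def)
qed

lemma legendre_degree_le: "degree (legendre n) \<le> n"
  and legendre_lead_coeff_pos: "coeff (legendre n) n > 0"
proof -
  have "degree (legendre n) \<le> n \<and> coeff (legendre n) n > 0"
  proof (induction n rule: legendre.induct)
    case (3 n)
    have "degree (legendre n) < Suc (Suc n)" using 3 by simp
    then have "coeff (legendre n) (Suc (Suc n)) = 0" by (rule coeff_eq_0)
    moreover have "coeff ([:0, 1:] * legendre (Suc n)) (Suc (Suc n)) = coeff (legendre (Suc n)) (Suc n)"
      by (simp add: coeff_pCons)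
    moreover have "degree ([:0, 1:] * legendre (Suc n)) \<le> Suc (Suc n)"
      using 3 degree_mult_le[of "[:0, 1:]" "legendre (Suc n)"] by simp
    ultimately show ?case using 3
      by (auto simp: legendre.simps(3) simp del: mult_pCons_left
          intro!: order.trans[OF degree_smult_le] degree_diff_le)
  qed auto
  then show "degree (legendre n) \<le> n" "coeff (legendre n) n > 0" by auto
qed

lemma poly_map_poly_of_real:
  "poly (map_poly of_real p) (of_real x) = (of_real (poly p x) :: 'a::{comm_ring_1,real_algebra_1})"
  by (induction p) (simp_all add: map_poly_pCons)

lemma poly_legendre_expansion:
  fixes Q :: "'a::real_field poly"
  assumes "degree Q < N"
  shows "\<exists>d. \<forall>x. poly Q (of_real x) = (\<Sum>n<N. Leg n x *\<^sub>R d n)"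
  using assms
proof (induction N arbitrary: Q)
  case 0
  then show ?case by simp
next
  case (Suc N)
  define c where "c = coeff Q N / of_real (coeff (legendre N) N)"
  define R where "R = Q - smult c (map_poly of_real (legendre N))"
  have "degree R \<le> N"
    unfolding R_def using Suc.prems legendre_degree_le[of N]
    by (intro degree_diff_le) (auto simp: degree_map_poly intro: order.trans[OF degree_smult_le])
  moreover have "coeff R N = 0"
    using legendre_lead_coeff_pos[of N] by (simp add: R_def c_def coeff_map_poly)
  ultimately have "R = 0 \<or> degree R < N"
    by (metis le_neq_implies_less leading_coeff_0_iff)
  then have "\<exists>d. \<forall>x. poly R (of_real x) = (\<Sum>n<N. Leg n x *\<^sub>R d n)"
    using Suc.IH[of R] by (elim disjE) (auto intro: exI[of _ "\<lambda>_. 0"])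
  then obtain d where d: "\<And>x. poly R (of_real x) = (\<Sum>n<N. Leg n x *\<^sub>R d n)" by blast
  have "poly Q (of_real x) = (\<Sum>n<Suc N. Leg n x *\<^sub>R (d(N := c)) n)" for x
  proof -
    have "poly Q (of_real x) = poly R (of_real x) + Leg N x *\<^sub>R c"
      by (simp add: R_def poly_map_poly_of_real scaleR_conv_of_real mult.commute)
    then show ?thesis by (simp add: d)
  qed
  then show ?case by blast
qed

definition legendre_coeff :: "(real \<Rightarrow> 'a::real_normed_vector) \<Rightarrow> nat \<Rightarrow> 'a" where
  "legendre_coeff g n = ((2 * real n + 1) / 2) *\<^sub>R integral {-1..1} (\<lambda>x. Leg n x *\<^sub>R g x)"

definition legendre_sum :: "(real \<Rightarrow> 'a::real_normed_vector) \<Rightarrow> nat \<Rightarrow> real \<Rightarrow> 'a" where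
  "legendre_sum g N x = (\<Sum>n<N. Leg n x *\<^sub>R legendre_coeff g n)"

lemma continuous_on_legendre_sum [continuous_intros]: "continuous_on A (legendre_sum g N)"
  unfolding legendre_sum_def[abs_def] by (intro continuous_intros)

lemma integral_legendre_residual:
  fixes g :: "real \<Rightarrow> 'a::banach"
  assumes g: "continuous_on {-1..1} g"
  shows "integral {-1..1} (\<lambda>x. Leg N x *\<^sub>R (g x - (\<Sum>n<N. Leg n x *\<^sub>R d n))) =
    (2 / (2 * real N + 1)) *\<^sub>R legendre_coeff g N"
proof -
  have "integral {-1..1} (\<lambda>x. Leg N x *\<^sub>R (g x - (\<Sum>n<N. Leg n x *\<^sub>R d n))) =
      integral {-1..1} (\<lambda>x. Leg N x *\<^sub>R g x - (\<Sum>n<N. (Leg N x * Leg n x) *\<^sub>R d n))"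
    by (simp add: scaleR_diff_right scaleR_sum_right)
  also have "\<dots> = integral {-1..1} (\<lambda>x. Leg N x *\<^sub>R g x) -
      (\<Sum>n<N. integral {-1..1} (\<lambda>x. (Leg N x * Leg n x) *\<^sub>R d n))"
    by (subst Henstock_Kurzweil_Integration.integral_diff)
       (auto intro!: integrable_continuous_real continuous_intros g integral_sum)
  also have "(\<Sum>n<N. integral {-1..1} (\<lambda>x. (Leg N x * Leg n x) *\<^sub>R d n)) = 0"
  proof (rule sum.neutral, rule ballI)
    fix n assume "n \<in> {..<N}"
    then show "integral {-1..1} (\<lambda>x. (Leg N x * Leg n x) *\<^sub>R d n) = 0"
      using integral_linear[OF integrable_continuous_real bounded_linear_scaleR_left,
          of "-1" 1 "\<lambda>x. Leg N x * Leg n x" "d n"] legendre_orthogonal[of N n]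
      by (simp add: o_def continuous_intros)
  qed
  finally show ?thesis by (simp add: legendre_coeff_def)
qed

text \<open>Completing the square shows that the Legendre coefficients give the best \<open>L\<^sup>2\<close> approximation.\<close>

lemma legendre_L2_error:
  fixes g :: "real \<Rightarrow> 'a::{real_inner, banach}"
  assumes g: "continuous_on {-1..1} g"
  shows "integral {-1..1} (\<lambda>x. (norm (g x - (\<Sum>n<N. Leg n x *\<^sub>R d n)))\<^sup>2) =
     integral {-1..1} (\<lambda>x. (norm (g x))\<^sup>2) +
     (\<Sum>n<N. 2 / (2 * real n + 1) * ((norm (d n - legendre_coeff g n))\<^sup>2 - (norm (legendre_coeff g n))\<^sup>2))"
proof (induction N)
  case 0
  then show ?case by simp
next
  case (Suc N)
  define r where "r x = g x - (\<Sum>n<N. Leg n x *\<^sub>R d n)" for x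
  have r: "continuous_on {-1..1} r"
    unfolding r_def by (intro continuous_intros g)
  have integrable: "h integrable_on {-1..1}" if "continuous_on {-1..1} h" for h :: "real \<Rightarrow> 'b::banach"
    using that by (rule integrable_continuous_real)
  have cross: "integral {-1..1} (\<lambda>x. (Leg N x *\<^sub>R r x) \<bullet> d N) =
      2 / (2 * real N + 1) * (legendre_coeff g N \<bullet> d N)"
    using integral_linear[OF integrable bounded_linear_inner_left, of "\<lambda>x. Leg N x *\<^sub>R r x" "d N"]
      integral_legendre_residual[OF g, of N d]
    by (simp add: o_def r_def[symmetric] r continuous_intros)
  have "(norm (g x - (\<Sum>n<Suc N. Leg n x *\<^sub>R d n)))\<^sup>2 =
      (norm (r x))\<^sup>2 - 2 * ((Leg N x *\<^sub>R r x) \<bullet> d N) + (norm (d N))\<^sup>2 * (Leg N x * Leg N x)" for x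
  proof -
    have "g x - (\<Sum>n<Suc N. Leg n x *\<^sub>R d n) = r x - Leg N x *\<^sub>R d N"
      by (simp add: r_def)
    then show ?thesis by (simp add: power2_norm_eq_inner inner_diff inner_commute algebra_simps)
  qed
  then have "integral {-1..1} (\<lambda>x. (norm (g x - (\<Sum>n<Suc N. Leg n x *\<^sub>R d n)))\<^sup>2) =
     integral {-1..1} (\<lambda>x. (norm (r x))\<^sup>2 - 2 * ((Leg N x *\<^sub>R r x) \<bullet> d N) + (norm (d N))\<^sup>2 * (Leg N x * Leg N x))"
    by (simp only:)
  also have "\<dots> = integral {-1..1} (\<lambda>x. (norm (r x))\<^sup>2) - 2 * integral {-1..1} (\<lambda>x. (Leg N x *\<^sub>R r x) \<bullet> d N)
      + (norm (d N))\<^sup>2 * integral {-1..1} (\<lambda>x. Leg N x * Leg N x)"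
    by (subst Henstock_Kurzweil_Integration.integral_add
        | subst Henstock_Kurzweil_Integration.integral_diff
        | rule integrable continuous_intros r)+ simp
  also have "\<dots> = integral {-1..1} (\<lambda>x. (norm (r x))\<^sup>2) +
      2 / (2 * real N + 1) * ((norm (d N - legendre_coeff g N))\<^sup>2 - (norm (legendre_coeff g N))\<^sup>2)"
    unfolding cross legendre_norm by (simp add: power2_norm_eq_inner inner_diff inner_commute algebra_simps)
  finally show ?case using Suc unfolding r_def by simp
qed

lemma legendre_L2_convergence:
  fixes g :: "real \<Rightarrow> complex"
  assumes g: "continuous_on {-1..1} g"
  shows "(\<lambda>N. integral {-1..1} (\<lambda>x. (norm (g x - legendre_sum g N x))\<^sup>2)) \<longlonglongrightarrow> 0"
proof (rule LIMSEQ_I)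
  fix e :: real assume "e > 0"
  define \<delta> where "\<delta> = sqrt (e / 4)"
  have \<delta>: "\<delta> > 0" "\<delta>\<^sup>2 = e / 4" using \<open>e > 0\<close> by (auto simp: \<delta>_def)
  obtain H :: "nat \<Rightarrow> complex poly" where "uniform_limit {-1..1} (\<lambda>n x. poly (H n) (of_real x)) g sequentially"
    using complex_polynomial_uniform_limit[OF compact_Icc g] .
  from eventually_happens'[OF sequentially_bot uniform_limitD[OF this \<delta>(1)]]
  obtain Q :: "complex poly" where Q: "\<And>x. x \<in> {-1..1} \<Longrightarrow> dist (poly Q (of_real x)) (g x) < \<delta>" by blast
  have "norm (integral {-1..1} (\<lambda>x. (norm (g x - legendre_sum g N x))\<^sup>2) - 0) < e"
    if N: "N \<ge> Suc (degree Q)" for N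
  proof -
    obtain d where d: "\<And>x. poly Q (of_real x) = (\<Sum>n<N. Leg n x *\<^sub>R d n)"
      using poly_legendre_expansion[of Q N] N by auto
    have "integral {-1..1} (\<lambda>x. (norm (g x - legendre_sum g N x))\<^sup>2)
        \<le> integral {-1..1} (\<lambda>x. (norm (g x - (\<Sum>n<N. Leg n x *\<^sub>R d n)))\<^sup>2)"
      unfolding legendre_sum_def legendre_L2_error[OF g]
      by (intro add_left_mono sum_mono mult_left_mono diff_right_mono) auto
    also have "\<dots> \<le> integral {-1..1} (\<lambda>x::real. \<delta>\<^sup>2)"
    proof (rule integral_le)
      show "(norm (g x - (\<Sum>n<N. Leg n x *\<^sub>R d n)))\<^sup>2 \<le> \<delta>\<^sup>2" if "x \<in> {-1..1}" for x
        using Q[OF that] by (intro power_mono) (simp_all add: d[symmetric] dist_norm norm_minus_commute)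
    qed (auto intro!: integrable_continuous_real continuous_intros g)
    also have "\<dots> < e" using \<delta> \<open>e > 0\<close> by simp
    moreover have "0 \<le> integral {-1..1} (\<lambda>x. (norm (g x - legendre_sum g N x))\<^sup>2)"
      by (intro integral_nonneg integrable_continuous_real continuous_intros g) auto
    ultimately show ?thesis by simp
  qed
  then show "\<exists>no. \<forall>N\<ge>no. norm (integral {-1..1} (\<lambda>x. (norm (g x - legendre_sum g N x))\<^sup>2) - 0) < e"
    by blast
qed

lemma integral_norm_power2_le:
  fixes r :: "real \<Rightarrow> 'a::real_normed_vector"
  assumes r: "continuous_on {a..b} r" and "a < b"
  shows "(integral {a..b} (\<lambda>x. norm (r x)))\<^sup>2 \<le> (b - a) * integral {a..b} (\<lambda>x. (norm (r x))\<^sup>2)"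
proof -
  define J where "J = integral {a..b} (\<lambda>x. norm (r x))"
  define m where "m = J / (b - a)"
  have integrable: "h integrable_on {a..b}" if "continuous_on {a..b} h" for h :: "real \<Rightarrow> real"
    using that by (rule integrable_continuous_real)
  have "0 \<le> integral {a..b} (\<lambda>x. (norm (r x) - m)\<^sup>2)"
    by (intro integral_nonneg integrable continuous_intros r) auto
  also have "(\<lambda>x. (norm (r x) - m)\<^sup>2) = (\<lambda>x. (norm (r x))\<^sup>2 - 2 * m * norm (r x) + m\<^sup>2)"
    by (simp add: fun_eq_iff power2_diff)
  also have "integral {a..b} \<dots> = integral {a..b} (\<lambda>x. (norm (r x))\<^sup>2) - 2 * m * J + m\<^sup>2 * (b - a)"
    unfolding J_def
    by (subst Henstock_Kurzweil_Integration.integral_add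
        | subst Henstock_Kurzweil_Integration.integral_diff
        | rule integrable continuous_intros r)+ (use \<open>a < b\<close> in simp)
  also have "\<dots> = integral {a..b} (\<lambda>x. (norm (r x))\<^sup>2) - J\<^sup>2 / (b - a)"
    using \<open>a < b\<close> by (simp add: m_def power2_eq_square)
  finally show ?thesis using \<open>a < b\<close> by (simp add: J_def field_simps)
qed

lemma legendre_L1_convergence:
  fixes g :: "real \<Rightarrow> complex"
  assumes g: "continuous_on {-1..1} g"
  shows "(\<lambda>N. integral {-1..1} (\<lambda>x. norm (g x - legendre_sum g N x))) \<longlonglongrightarrow> 0"
proof (rule Lim_null_comparison)
  have "continuous_on {-1..1} (\<lambda>x. g x - legendre_sum g N x)" for N
    by (intro continuous_intros g)
  from integral_norm_power2_le[OF this]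
  have "norm (integral {-1..1} (\<lambda>x. norm (g x - legendre_sum g N x))) \<le>
      sqrt (2 * integral {-1..1} (\<lambda>x. (norm (g x - legendre_sum g N x))\<^sup>2))" for N
    by (intro real_le_rsqrt) simp
  then show "\<forall>\<^sub>F N in sequentially. norm (integral {-1..1} (\<lambda>x. norm (g x - legendre_sum g N x))) \<le>
      sqrt (2 * integral {-1..1} (\<lambda>x. (norm (g x - legendre_sum g N x))\<^sup>2))"
    by (simp add: always_eventually)
  show "(\<lambda>N. sqrt (2 * integral {-1..1} (\<lambda>x. (norm (g x - legendre_sum g N x))\<^sup>2))) \<longlonglongrightarrow> 0"
    using tendsto_real_sqrt[OF tendsto_mult_right_zero[OF legendre_L2_convergence[OF g], of 2]] by simp
qed

lemma integral_rescale_symmetric: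
  fixes h :: "real \<Rightarrow> 'a::real_normed_vector"
  assumes "\<xi> > 0"
  shows "integral {-\<xi>..\<xi>} (\<lambda>\<tau>. h (\<tau> / \<xi>)) = \<xi> *\<^sub>R integral {-1..1} h"
proof -
  have "(\<lambda>x. x / (1 / \<xi>)) ` {-1..1} = (*) \<xi> ` {-1..1}"
    by (intro image_cong) auto
  also have "\<dots> = {-\<xi>..\<xi>}"
    using image_mult_atLeastAtMost[OF assms, of "-1" 1] by simp
  finally show ?thesis
    using integral_stretch_real[of "1 / \<xi>" "-1" 1 h] assms by simp
qed

definition legendre_moment :: "real \<Rightarrow> (real \<Rightarrow> complex) \<Rightarrow> nat \<Rightarrow> complex" where
  "legendre_moment \<xi> g n = integral {-\<xi>..\<xi>} (\<lambda>\<tau>. complex_of_real (Leg n (\<tau> / \<xi>)) * g \<tau>)"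

lemma legendre_series_L1_convergence:
  assumes \<xi>: "\<xi> > 0" and g: "continuous_on {-\<xi>..\<xi>} g"
  shows "(\<lambda>N. integral {-\<xi>..\<xi>} (\<lambda>\<tau>. norm (g \<tau> -
    (\<Sum>n<N. of_real ((2 * real n + 1) / (2 * \<xi>)) * legendre_moment \<xi> g n * of_real (Leg n (\<tau> / \<xi>)))))) \<longlonglongrightarrow> 0"
proof -
  define G where "G x = g (\<xi> * x)" for x
  have g_eq: "g \<tau> = G (\<tau> / \<xi>)" for \<tau> using \<xi> by (simp add: G_def)
  have G: "continuous_on {-1..1} G"
    unfolding G_def
  proof (rule continuous_on_compose2[OF g])
    show "(*) \<xi> ` {-1..1} \<subseteq> {-\<xi>..\<xi>}"
      using image_mult_atLeastAtMost[OF \<xi>, of "-1" 1] by simp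
  qed (intro continuous_intros)
  have coeff: "of_real ((2 * real n + 1) / (2 * \<xi>)) * legendre_moment \<xi> g n = legendre_coeff G n" for n
    unfolding legendre_moment_def g_eq integral_rescale_symmetric[OF \<xi>, of "\<lambda>x. of_real (Leg n x) * G x"]
    using \<xi> by (simp add: legendre_coeff_def scaleR_conv_of_real)
  have "integral {-\<xi>..\<xi>} (\<lambda>\<tau>. norm (g \<tau> - (\<Sum>n<N. legendre_coeff G n * of_real (Leg n (\<tau> / \<xi>))))) =
      \<xi> * integral {-1..1} (\<lambda>x. norm (G x - legendre_sum G N x))" for N
    unfolding g_eq using integral_rescale_symmetric[OF \<xi>, of "\<lambda>x. norm (G x - legendre_sum G N x)"]
    by (simp add: legendre_sum_def scaleR_conv_of_real mult.commute)
  then show ?thesis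
    unfolding coeff using tendsto_mult_right_zero[OF legendre_L1_convergence[OF G], of \<xi>] by simp
qed

section \<open>Functions of two variables and uniform limits\<close>

lemma continuous_on_compose_Pair:
  assumes "continuous_on D' (\<lambda>(x, y). F x y)" and "continuous_on D h" "continuous_on D k"
    and "\<And>z. z \<in> D \<Longrightarrow> (h z, k z) \<in> D'"
  shows "continuous_on D (\<lambda>z. F (h z) (k z))"
  using continuous_on_compose2[OF assms(1) continuous_on_Pair[OF assms(2,3)]] assms(4) by auto

lemma has_derivative_of_partials:
  fixes W :: "real \<Rightarrow> real \<Rightarrow> 'a::real_normed_vector"
  assumes D: "open D" "(x, y) \<in> D"
    and Wx: "((\<lambda>s. W s y) has_vector_derivative Wx) (at x)"
    and Wy: "\<And>x y. (x, y) \<in> D \<Longrightarrow> ((\<lambda>s. W x s) has_vector_derivative Wy x y) (at y)"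
    and cont: "continuous_on D (\<lambda>(x, y). Wy x y)"
  shows "((\<lambda>(x, y). W x y) has_derivative (\<lambda>(h, k). h *\<^sub>R Wx + k *\<^sub>R Wy x y)) (at (x, y))"
proof -
  obtain X Y' where XY': "open X" "open Y'" "(x, y) \<in> X \<times> Y'" "X \<times> Y' \<subseteq> D"
    using open_prod_elim[OF D] by metis
  then obtain e where e: "e > 0" "ball y e \<subseteq> Y'"
    using open_contains_ball by blast
  define Y where "Y = ball y e"
  have Y: "open Y" "convex Y" "y \<in> Y" "x \<in> X" "X \<times> Y \<subseteq> D"
    using e XY' by (auto simp: Y_def)
  have "((\<lambda>(x, y). W x y) has_derivative
      (\<lambda>(h, k). h *\<^sub>R Wx + blinfun_scaleR_left (Wy x y) k)) (at (x, y) within X \<times> Y)"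
  proof (rule has_derivative_partialsI)
    show "((\<lambda>x. W x y) has_derivative (\<lambda>h. h *\<^sub>R Wx)) (at x within X)"
      using Wx unfolding has_vector_derivative_def by (rule has_derivative_at_withinI)
    show "((\<lambda>y. W x y) has_derivative blinfun_apply (blinfun_scaleR_left (Wy x y))) (at y within Y)"
      if "x \<in> X" "y \<in> Y" for x y
      using Wy[of x y] Y(5) that
      unfolding has_vector_derivative_def by (auto intro: has_derivative_at_withinI)
    have "continuous_on (X \<times> Y) (\<lambda>(x, y). Wy x y)"
      using cont Y(5) by (rule continuous_on_subset)
    then have "continuous_on (X \<times> Y) (\<lambda>(x, y). blinfun_scaleR_left (Wy x y))"
      by (auto simp: case_prod_beta intro!: bounded_linear.continuous_on[OF bounded_linear_blinfun_scaleR_left])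
    then show "continuous (at (x, y) within X \<times> Y) (\<lambda>(x, y). blinfun_scaleR_left (Wy x y))"
      using Y by (auto simp: continuous_on_eq_continuous_within)
  qed (use Y in auto)
  then show ?thesis
    using Y XY'(1) at_within_open[of "(x, y)" "X \<times> Y"] by (auto simp: open_Times)
qed

lemma has_vector_derivative_along_line:
  fixes W :: "real \<Rightarrow> real \<Rightarrow> 'a::real_normed_vector"
  assumes "open D" "(x, c + k * x) \<in> D"
    and "((\<lambda>s. W s (c + k * x)) has_vector_derivative Wx) (at x)"
    and "\<And>x y. (x, y) \<in> D \<Longrightarrow> ((\<lambda>s. W x s) has_vector_derivative Wy x y) (at y)"
    and "continuous_on D (\<lambda>(x, y). Wy x y)"
  shows "((\<lambda>s. W s (c + k * s)) has_vector_derivative (Wx + k *\<^sub>R Wy x (c + k * x))) (at x)"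
proof -
  have "((\<lambda>s. (s, c + k * s)) has_derivative (\<lambda>h. (h, k * h))) (at x)"
    by (auto intro!: derivative_eq_intros)
  from has_derivative_compose[OF this has_derivative_of_partials[OF assms]]
  show ?thesis
    by (simp add: has_vector_derivative_def scaleR_add_right mult.commute)
qed

lemma has_vector_derivative_uniform_limit:
  fixes F :: "nat \<Rightarrow> real \<Rightarrow> 'a::banach"
  assumes I: "open I" "convex I" "x \<in> I"
    and F': "\<And>n x. x \<in> I \<Longrightarrow> (F n has_vector_derivative F' n x) (at x)"
    and F'_lim: "uniform_limit I F' G' sequentially"
    and F_lim: "\<And>x. x \<in> I \<Longrightarrow> (\<lambda>n. F n x) \<longlonglongrightarrow> G x"
  shows "(G has_vector_derivative G' x) (at x)"
proof -
  have "\<exists>g. \<forall>x\<in>I. (\<lambda>n. F n x) \<longlonglongrightarrow> g x \<and> (g has_derivative (\<lambda>h. h *\<^sub>R G' x)) (at x within I)"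
  proof (rule has_derivative_sequence[where f = F and f' = "\<lambda>n x h. h *\<^sub>R F' n x" and ?x0.0 = x and l = "G x"])
    show "(F n has_derivative (\<lambda>h. h *\<^sub>R F' n x)) (at x within I)" if "x \<in> I" for n x
      using F'[OF that] unfolding has_vector_derivative_def by (rule has_derivative_at_withinI)
    show "\<forall>\<^sub>F n in sequentially. \<forall>x\<in>I. \<forall>h. norm (h *\<^sub>R F' n x - h *\<^sub>R G' x) \<le> e * norm h" if "e > 0" for e
      using uniform_limitD[OF F'_lim that]
    proof (eventually_elim, intro ballI allI)
      fix n x and h :: real assume "\<forall>x\<in>I. dist (F' n x) (G' x) < e" "x \<in> I"
      then have "norm (F' n x - G' x) \<le> e" by (auto simp: dist_norm less_imp_le)
      then have "\<bar>h\<bar> * norm (F' n x - G' x) \<le> \<bar>h\<bar> * e" by (rule mult_left_mono) simp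
      then show "norm (h *\<^sub>R F' n x - h *\<^sub>R G' x) \<le> e * norm h"
        by (simp flip: scaleR_diff_right add: mult.commute)
    qed
  qed (use I F_lim in auto)
  then obtain g where g: "\<And>x. x \<in> I \<Longrightarrow> (\<lambda>n. F n x) \<longlonglongrightarrow> g x"
    "(g has_derivative (\<lambda>h. h *\<^sub>R G' x)) (at x within I)"
    using I(3) by blast
  have "g y = G y" if "y \<in> I" for y using LIMSEQ_unique[OF g(1) F_lim] that by blast
  with g(2) have "(G has_derivative (\<lambda>h. h *\<^sub>R G' x)) (at x within I)"
    using I(3) by (metis has_derivative_transform)
  then show ?thesis
    using at_within_open[OF I(3,1)] by (simp add: has_vector_derivative_def)
qed

lemma integral_norm_nonneg: "0 \<le> integral A (\<lambda>x. norm (h x))"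
  by (cases "(\<lambda>x. norm (h x)) integrable_on A") (auto intro: integral_nonneg simp: not_integrable_integral)

lemma le_of_contraction_bound:
  fixes v :: "'a \<Rightarrow> real"
  assumes "bdd_above (v ` X)" "\<theta> < 1" "z \<in> X"
    and improve: "\<And>A z. (\<And>z. z \<in> X \<Longrightarrow> v z \<le> A) \<Longrightarrow> z \<in> X \<Longrightarrow> v z \<le> C + \<theta> * A"
  shows "v z \<le> C / (1 - \<theta>)"
proof -
  define A where "A = Sup (v ` X)"
  have le_A: "v y \<le> A" if "y \<in> X" for y
    unfolding A_def using that assms(1) by (intro cSup_upper) auto
  have "A \<le> C + \<theta> * A"
    unfolding A_def using assms(3) improve[OF le_A, unfolded A_def] by (intro cSup_least) auto
  then have "A \<le> C / (1 - \<theta>)" using \<open>\<theta> < 1\<close> by (simp add: field_simps)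
  with le_A[OF \<open>z \<in> X\<close>] show ?thesis by simp
qed

lemma has_integral_backward_line:
  fixes h :: "real \<Rightarrow> 'a::real_normed_vector"
  assumes "(h has_integral I) {y - 2 * s..y}"
  shows "((\<lambda>\<sigma>. h (y - 2 * \<sigma>)) has_integral (1 / 2) *\<^sub>R I) {0..s}"
proof -
  have "(\<lambda>x. (1 / - 2) *\<^sub>R x + - ((1 / - 2) *\<^sub>R y)) ` {y - 2 * s..y} = {0..s}"
    by (auto simp: image_iff field_simps intro!: bexI[of _ "y - 2 * x" for x])
  then show ?thesis
    using has_integral_affinity[of h I "y - 2 * s" y "- 2" y] assms by simp
qed

section \<open>The bicomplex algebra\<close>

lemmas bc_simps = bc_plus_def bc_minus_def bc_R_def bc_I_def bc_conj_def bc_mult_def bc_j_def bc_of_complex_def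

lemma bounded_bilinear_bc_mult: "bounded_bilinear bc_mult"
proof
  have "norm (bc_mult w z) \<le> norm w * norm z * 4" for w z
  proof -
    have product: "norm (x * y) \<le> norm w * norm z" if "norm x \<le> norm w" "norm y \<le> norm z" for x y :: complex
      using that by (simp add: norm_mult mult_mono)
    have "norm (bc_mult w z) \<le> norm (fst w * fst z + snd w * snd z) + norm (fst w * snd z + snd w * fst z)"
      unfolding bc_mult_def by (rule norm_Pair_le)
    also have "\<dots> \<le> (norm w * norm z + norm w * norm z) + (norm w * norm z + norm w * norm z)"
      using norm_fst_le[of "fst w" "snd w"] norm_snd_le[of "snd w" "fst w"]
        norm_fst_le[of "fst z" "snd z"] norm_snd_le[of "snd z" "fst z"]
      by (intro add_mono norm_triangle_mono product) auto
    finally show ?thesis by simp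
  qed
  then show "\<exists>K. \<forall>w z. norm (bc_mult w z) \<le> norm w * norm z * K" by blast
qed (auto simp: bc_mult_def algebra_simps scaleR_add_right)

lemmas bounded_linear_bc_mult_right = bounded_bilinear.bounded_linear_right[OF bounded_bilinear_bc_mult]
lemmas bounded_linear_bc_mult_left = bounded_bilinear.bounded_linear_left[OF bounded_bilinear_bc_mult]

lemma bounded_linear_bc_conj: "bounded_linear bc_conj"
  unfolding bc_conj_def
  by (intro bounded_linear_Pair bounded_linear_fst bounded_linear_minus bounded_linear_snd)

lemma bounded_linear_bc_plus: "bounded_linear bc_plus"
  and bounded_linear_bc_minus: "bounded_linear bc_minus"
  unfolding bc_plus_def bc_minus_def bc_R_def bc_I_def
  by (intro bounded_linear_add bounded_linear_sub bounded_linear_fst bounded_linear_snd)+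

lemma bounded_linear_bc_of_complex: "bounded_linear bc_of_complex"
  unfolding bc_of_complex_def by (intro bounded_linear_Pair bounded_linear_ident bounded_linear_zero)

lemmas [continuous_intros] =
  bounded_bilinear.continuous_on[OF bounded_bilinear_bc_mult]
  bounded_linear.continuous_on[OF bounded_linear_bc_conj]
  bounded_linear.continuous_on[OF bounded_linear_bc_plus]
  bounded_linear.continuous_on[OF bounded_linear_bc_minus]
  bounded_linear.continuous_on[OF bounded_linear_bc_of_complex]

abbreviation bc_scale :: "bicomplex \<Rightarrow> complex \<Rightarrow> bicomplex" (infixl "\<odot>" 70) where
  "w \<odot> z \<equiv> bc_mult w (bc_of_complex z)"

lemma bc_plus_conj [simp]: "bc_plus (bc_conj w) = bc_minus w"
  and bc_minus_conj [simp]: "bc_minus (bc_conj w) = bc_plus w"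
  and bc_plus_0 [simp]: "bc_plus 0 = 0"
  and bc_minus_0 [simp]: "bc_minus 0 = 0"
  by (simp_all add: bc_simps)

lemma norm_bc_conj [simp]: "norm (bc_conj w) = norm w"
  and norm_bc_j [simp]: "norm (bc_mult bc_j w) = norm w"
  by (simp_all add: bc_simps norm_prod_def add.commute)

lemma norm_bc_plus_le: "norm (bc_plus w) \<le> 2 * norm w"
  and norm_bc_minus_le: "norm (bc_minus w) \<le> 2 * norm w"
  unfolding bc_plus_def bc_minus_def bc_R_def bc_I_def
  using norm_triangle_ineq[of "fst w" "snd w"] norm_triangle_ineq4[of "fst w" "snd w"]
    norm_fst_le[of "fst w" "snd w"] norm_snd_le[of "snd w" "fst w"] by auto

lemma norm_le_bc_plus_minus: "norm w \<le> norm (bc_plus w) + norm (bc_minus w)"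
proof -
  have "2 * norm (fst w) = norm (bc_plus w + bc_minus w)" "2 * norm (snd w) = norm (bc_plus w - bc_minus w)"
    by (simp_all add: bc_simps flip: mult_2 norm_mult)
  moreover have "norm w \<le> norm (fst w) + norm (snd w)"
    using norm_Pair_le[of "fst w" "snd w"] by simp
  ultimately show ?thesis
    using norm_triangle_ineq[of "bc_plus w" "bc_minus w"] norm_triangle_ineq4[of "bc_plus w" "bc_minus w"]
    by simp
qed

definition of_plus :: "complex \<Rightarrow> bicomplex" where
  "of_plus z = bc_Pp \<odot> z"

lemma of_plus_eq: "of_plus z = (1 / 2) *\<^sub>R (z, z)"
  by (simp add: of_plus_def bc_simps bc_Pp_def scaleR_conv_of_real)

lemma bounded_linear_of_plus: "bounded_linear of_plus"
  unfolding of_plus_def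
  by (intro bounded_linear_compose[OF bounded_linear_bc_mult_right] bounded_linear_bc_of_complex)

lemma bc_plus_of_plus [simp]: "bc_plus (of_plus z) = z"
  and bc_minus_of_plus [simp]: "bc_minus (of_plus z) = 0"
  by (simp_all add: of_plus_eq bc_simps scaleR_conv_of_real)

lemma of_plus_decomposition: "of_plus (bc_plus w) + bc_conj (of_plus (bc_minus w)) = w"
  by (simp add: of_plus_eq bc_simps prod_eq_iff scaleR_conv_of_real field_simps)

lemma bc_Pm_mult: "bc_Pm \<odot> z = bc_conj (of_plus z)"
  by (simp add: of_plus_def bc_simps bc_Pp_def bc_Pm_def)

section \<open>Classical solutions of first order evolution systems\<close>

definition classical_solution ::
  "(real \<times> real) set \<Rightarrow> (real \<times> real) set \<Rightarrow> (real \<Rightarrow> 'a \<Rightarrow> 'a \<Rightarrow> 'a)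
   \<Rightarrow> (real \<Rightarrow> real \<Rightarrow> 'a) \<Rightarrow> (real \<Rightarrow> real \<Rightarrow> 'a::real_normed_vector) \<Rightarrow> bool" where
  "classical_solution D D\<^sub>0 R W Wt \<longleftrightarrow>
     continuous_on D (\<lambda>(x, t). W x t) \<and> continuous_on D\<^sub>0 (\<lambda>(x, t). Wt x t) \<and>
     (\<forall>x t. (x, t) \<in> D\<^sub>0 \<longrightarrow>
        ((\<lambda>s. W s t) has_vector_derivative R x (W x t) (Wt x t)) (at x) \<and>
        (W x has_vector_derivative Wt x t) (at t))"

lemma classical_solutionI:
  assumes "continuous_on D (\<lambda>(x, t). W x t)" "continuous_on D\<^sub>0 (\<lambda>(x, t). Wt x t)"
    and "\<And>x t. (x, t) \<in> D\<^sub>0 \<Longrightarrow> ((\<lambda>s. W s t) has_vector_derivative R x (W x t) (Wt x t)) (at x)"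
    and "\<And>x t. (x, t) \<in> D\<^sub>0 \<Longrightarrow> (W x has_vector_derivative Wt x t) (at t)"
  shows "classical_solution D D\<^sub>0 R W Wt"
  using assms by (simp add: classical_solution_def)

lemma classical_solutionD:
  assumes "classical_solution D D\<^sub>0 R W Wt"
  shows classical_solution_continuous: "continuous_on D (\<lambda>(x, t). W x t)"
    and classical_solution_continuous_deriv: "continuous_on D\<^sub>0 (\<lambda>(x, t). Wt x t)"
    and classical_solution_deriv_x:
      "(x, t) \<in> D\<^sub>0 \<Longrightarrow> ((\<lambda>s. W s t) has_vector_derivative R x (W x t) (Wt x t)) (at x)"
    and classical_solution_deriv_t: "(x, t) \<in> D\<^sub>0 \<Longrightarrow> (W x has_vector_derivative Wt x t) (at t)"
  using assms by (auto simp: classical_solution_def)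

lemma classical_solution_subset:
  assumes "classical_solution D D\<^sub>0 R W Wt" "D' \<subseteq> D" "D\<^sub>0' \<subseteq> D\<^sub>0"
  shows "classical_solution D' D\<^sub>0' R W Wt"
  using assms continuous_on_subset unfolding classical_solution_def by blast

lemma classical_solution_add_scaleR:
  assumes W: "classical_solution D D\<^sub>0 R W Wt" and V: "classical_solution D D\<^sub>0 R V Vt"
    and R: "\<And>x w v wt vt. R x (w + a *\<^sub>R v) (wt + a *\<^sub>R vt) = R x w wt + a *\<^sub>R R x v vt"
  shows "classical_solution D D\<^sub>0 R (\<lambda>x t. W x t + a *\<^sub>R V x t) (\<lambda>x t. Wt x t + a *\<^sub>R Vt x t)"
proof (rule classical_solutionI)
  show "continuous_on D (\<lambda>(x, t). W x t + a *\<^sub>R V x t)" "continuous_on D\<^sub>0 (\<lambda>(x, t). Wt x t + a *\<^sub>R Vt x t)"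
    using classical_solutionD(1,2)[OF W] classical_solutionD(1,2)[OF V]
    unfolding case_prod_beta by (auto intro!: continuous_intros)
  show "((\<lambda>s. W s t + a *\<^sub>R V s t) has_vector_derivative
      R x (W x t + a *\<^sub>R V x t) (Wt x t + a *\<^sub>R Vt x t)) (at x)" if "(x, t) \<in> D\<^sub>0" for x t
    unfolding R using that
    by (intro has_vector_derivative_add bounded_linear.has_vector_derivative[OF bounded_linear_scaleR_right]
        classical_solution_deriv_x[OF W] classical_solution_deriv_x[OF V])
  show "((\<lambda>s. W x s + a *\<^sub>R V x s) has_vector_derivative Wt x t + a *\<^sub>R Vt x t) (at t)"
    if "(x, t) \<in> D\<^sub>0" for x t
    using that
    by (intro has_vector_derivative_add bounded_linear.has_vector_derivative[OF bounded_linear_scaleR_right]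
        classical_solution_deriv_t[OF W] classical_solution_deriv_t[OF V])
qed

lemma classical_solution_time_change:
  assumes W: "classical_solution D D\<^sub>0 R W Wt" and L: "bounded_linear L"
    and R: "\<And>x w wt. R x (L w) (k *\<^sub>R L wt) = L (R x w wt)"
    and D: "\<And>x t. (x, t) \<in> D' \<Longrightarrow> (x, c + k * t) \<in> D" "\<And>x t. (x, t) \<in> D\<^sub>0' \<Longrightarrow> (x, c + k * t) \<in> D\<^sub>0"
  shows "classical_solution D' D\<^sub>0' R (\<lambda>x t. L (W x (c + k * t))) (\<lambda>x t. k *\<^sub>R L (Wt x (c + k * t)))"
proof (rule classical_solutionI)
  show "continuous_on D' (\<lambda>(x, t). L (W x (c + k * t)))"
    unfolding case_prod_beta using D(1)
    by (intro bounded_linear.continuous_on[OF L]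
        continuous_on_compose_Pair[OF classical_solution_continuous[OF W]] continuous_intros) auto
  show "continuous_on D\<^sub>0' (\<lambda>(x, t). k *\<^sub>R L (Wt x (c + k * t)))"
    unfolding case_prod_beta using D(2)
    by (intro continuous_intros bounded_linear.continuous_on[OF L]
        continuous_on_compose_Pair[OF classical_solution_continuous_deriv[OF W]]) auto
  fix x t assume "(x, t) \<in> D\<^sub>0'"
  note xt = D(2)[OF this]
  show "((\<lambda>s. L (W s (c + k * t))) has_vector_derivative
      R x (L (W x (c + k * t))) (k *\<^sub>R L (Wt x (c + k * t)))) (at x)"
    unfolding R by (rule bounded_linear.has_vector_derivative[OF L classical_solution_deriv_x[OF W xt]])
  have "((\<lambda>t. c + k * t) has_vector_derivative k) (at t)" by (auto intro!: derivative_eq_intros)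
  from vector_diff_chain_at[OF this classical_solution_deriv_t[OF W xt]]
  have "((\<lambda>s. W x (c + k * s)) has_vector_derivative k *\<^sub>R Wt x (c + k * t)) (at t)"
    by (simp add: o_def)
  from bounded_linear.has_vector_derivative[OF L this]
  show "((\<lambda>s. L (W x (c + k * s))) has_vector_derivative k *\<^sub>R L (Wt x (c + k * t))) (at t)"
    by (simp add: linear_cmul[OF bounded_linear.linear[OF L]])
qed

definition bc_squeeze :: "real \<Rightarrow> bicomplex \<Rightarrow> bicomplex" where
  "bc_squeeze r w = (r *\<^sub>R fst w, (1 / r) *\<^sub>R snd w)"

lemma bounded_linear_bc_squeeze: "bounded_linear (bc_squeeze r)"
  unfolding bc_squeeze_def
  by (intro bounded_linear_Pair bounded_linear_compose[OF bounded_linear_scaleR_right]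
      bounded_linear_fst bounded_linear_snd)

lemma bc_squeeze_conj: "bc_squeeze r (bc_conj w) = bc_conj (bc_squeeze r w)"
  by (simp add: bc_squeeze_def bc_conj_def)

lemma bc_squeeze_inverse: "r \<noteq> 0 \<Longrightarrow> bc_squeeze (1 / r) (bc_squeeze r w) = w"
  by (simp add: bc_squeeze_def)

lemma has_vector_derivative_bc_squeeze:
  assumes r: "(r has_real_derivative r') (at x)" "r x \<noteq> 0" and F: "(F has_vector_derivative F') (at x)"
  shows "((\<lambda>x. bc_squeeze (r x) (F x)) has_vector_derivative
     bc_squeeze (r x) F' + (r' / r x) *\<^sub>R bc_conj (bc_squeeze (r x) (F x))) (at x)"
proof -
  have "((\<lambda>x. 1 / r x) has_real_derivative - r' / (r x)\<^sup>2) (at x)"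
    using r by (auto intro!: derivative_eq_intros simp: power2_eq_square)
  then have "((\<lambda>x. bc_squeeze (r x) (F x)) has_vector_derivative
     (r x *\<^sub>R fst F' + r' *\<^sub>R fst (F x), (1 / r x) *\<^sub>R snd F' + (- r' / (r x)\<^sup>2) *\<^sub>R snd (F x))) (at x)"
    unfolding bc_squeeze_def
    by (intro has_vector_derivative_Pair has_vector_derivative_scaleR r
        bounded_linear.has_vector_derivative[OF bounded_linear_fst F]
        bounded_linear.has_vector_derivative[OF bounded_linear_snd F])
  then show ?thesis
    using r(2) by (simp add: bc_squeeze_def bc_conj_def power2_eq_square)
qed

lemma continuous_on_squeeze_change:
  fixes h r :: "real \<Rightarrow> real"
  assumes V: "continuous_on D (\<lambda>(x, t). V x t)"
    and h: "continuous_on T h" and r: "continuous_on T r" "\<And>x. x \<in> T \<Longrightarrow> r x \<noteq> 0"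
    and D': "D' \<subseteq> T \<times> UNIV" "\<And>x t. (x, t) \<in> D' \<Longrightarrow> (h x, t) \<in> D"
  shows "continuous_on D' (\<lambda>(x, t). bc_squeeze (r x) (V (h x) t))"
proof -
  have fst_map: "continuous_on D' (\<lambda>z. k (fst z))" if "continuous_on T k" for k :: "real \<Rightarrow> real"
    by (rule continuous_on_compose2[OF that continuous_on_fst[OF continuous_on_id]]) (use D'(1) in auto)
  have "r (fst z) \<noteq> 0" if "z \<in> D'" for z using that D'(1) r(2) by auto
  then show ?thesis
    unfolding case_prod_beta bc_squeeze_def using D'(2)
    by (intro continuous_intros fst_map h r(1) continuous_on_compose_Pair[OF V]) auto
qed

lemma classical_solution_squeeze_change:
  assumes W: "classical_solution D D\<^sub>0 R W Wt"
    and h: "continuous_on T h" "D' \<subseteq> T \<times> UNIV" "D\<^sub>0' \<subseteq> D'"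
      "\<And>x t. (x, t) \<in> D' \<Longrightarrow> (h x, t) \<in> D" "\<And>x t. (x, t) \<in> D\<^sub>0' \<Longrightarrow> (h x, t) \<in> D\<^sub>0"
      "\<And>x t. (x, t) \<in> D\<^sub>0' \<Longrightarrow> (h has_real_derivative h' x) (at x)"
    and r: "continuous_on T r" "\<And>x. x \<in> T \<Longrightarrow> r x \<noteq> 0"
      "\<And>x t. (x, t) \<in> D\<^sub>0' \<Longrightarrow> (r has_real_derivative r' x) (at x)"
    and R: "\<And>x t w wt. (x, t) \<in> D\<^sub>0' \<Longrightarrow> R' x (bc_squeeze (r x) w) (bc_squeeze (r x) wt) =
      h' x *\<^sub>R bc_squeeze (r x) (R (h x) w wt) + (r' x / r x) *\<^sub>R bc_conj (bc_squeeze (r x) w)"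
  shows "classical_solution D' D\<^sub>0' R'
    (\<lambda>x t. bc_squeeze (r x) (W (h x) t)) (\<lambda>x t. bc_squeeze (r x) (Wt (h x) t))"
proof (rule classical_solutionI)
  show "continuous_on D' (\<lambda>(x, t). bc_squeeze (r x) (W (h x) t))"
    by (rule continuous_on_squeeze_change[OF classical_solution_continuous[OF W] h(1) r(1,2) h(2,4)])
  show "continuous_on D\<^sub>0' (\<lambda>(x, t). bc_squeeze (r x) (Wt (h x) t))"
    by (rule continuous_on_squeeze_change[OF classical_solution_continuous_deriv[OF W] h(1) r(1,2) _ h(5)])
       (use h(2,3) in auto)
  fix x t assume xt: "(x, t) \<in> D\<^sub>0'"
  then have rx: "r x \<noteq> 0" using r(2) h(2,3) by auto
  have "(h has_vector_derivative h' x) (at x)"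
    using h(6)[OF xt] by (simp add: has_real_derivative_iff_has_vector_derivative)
  from vector_diff_chain_at[OF this classical_solution_deriv_x[OF W h(5)[OF xt]]]
  have "((\<lambda>x. W (h x) t) has_vector_derivative h' x *\<^sub>R R (h x) (W (h x) t) (Wt (h x) t)) (at x)"
    by (simp add: o_def)
  from has_vector_derivative_bc_squeeze[OF r(3)[OF xt] rx this]
  show "((\<lambda>s. bc_squeeze (r s) (W (h s) t)) has_vector_derivative
      R' x (bc_squeeze (r x) (W (h x) t)) (bc_squeeze (r x) (Wt (h x) t))) (at x)"
    by (simp add: R[OF xt] linear_cmul[OF bounded_linear.linear[OF bounded_linear_bc_squeeze]])
  show "((\<lambda>t. bc_squeeze (r x) (W (h x) t)) has_vector_derivative bc_squeeze (r x) (Wt (h x) t)) (at t)"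
    by (rule bounded_linear.has_vector_derivative[OF bounded_linear_bc_squeeze
          classical_solution_deriv_t[OF W h(5)[OF xt]]])
qed

section \<open>The a priori bound\<close>

locale half_open_interval =
  fixes S :: "real set"
  assumes zero_S: "0 \<in> S" and S_nonneg: "\<xi> \<in> S \<Longrightarrow> 0 \<le> \<xi>"
    and S_down: "\<xi> \<in> S \<Longrightarrow> 0 \<le> \<eta> \<Longrightarrow> \<eta> \<le> \<xi> \<Longrightarrow> \<eta> \<in> S"
    and S_open: "\<xi> \<in> S \<Longrightarrow> \<exists>\<eta>\<in>S. \<xi> < \<eta>"
begin

lemma Icc_subset_S: "\<xi> \<in> S \<Longrightarrow> {0..\<xi>} \<subseteq> S"
  using S_down by auto

lemma open_S_pos: "open (S \<inter> {0<..})"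
proof (subst open_subopen, rule ballI)
  fix x assume x: "x \<in> S \<inter> {0<..}"
  then obtain \<eta> where \<eta>: "\<eta> \<in> S" "x < \<eta>" using S_open by blast
  have "open {0<..<\<eta>}" "x \<in> {0<..<\<eta>}" "{0<..<\<eta>} \<subseteq> S \<inter> {0<..}"
    using x \<eta> S_down[OF \<eta>(1)] by auto
  then show "\<exists>T. open T \<and> x \<in> T \<and> T \<subseteq> S \<inter> {0<..}" by blast
qed

lemma at_within_S:
  assumes "\<eta> \<in> S" "x \<in> S" "x < \<eta>"
  shows "at x within S = at x within {0..\<eta>}"
  by (rule at_within_nhd[of x "{..<\<eta>}"]) (use assms S_nonneg S_down[OF assms(1)] in auto)

lemma DERIV_at_of_within_S:
  assumes "(h has_real_derivative D) (at x within S)" "x \<in> S" "0 < x"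
  shows "(h has_real_derivative D) (at x)"
  using has_field_derivative_subset[OF assms(1), of "S \<inter> {0<..}"]
    at_within_open[OF _ open_S_pos, of x] assms(2,3) by simp

lemma DERIV_indefinite_integral_within:
  assumes h: "continuous_on S h" and "\<xi> \<in> S"
  shows "((\<lambda>\<xi>. integral {0..\<xi>} h) has_real_derivative h \<xi>) (at \<xi> within S)"
proof -
  obtain \<eta> where \<eta>: "\<eta> \<in> S" "\<xi> < \<eta>" using S_open \<open>\<xi> \<in> S\<close> by blast
  show ?thesis
    unfolding at_within_S[OF \<eta>(1) \<open>\<xi> \<in> S\<close> \<eta>(2)]
    using \<eta> S_nonneg[OF \<open>\<xi> \<in> S\<close>] continuous_on_subset[OF h Icc_subset_S[OF \<eta>(1)]]
    by (intro integral_has_real_derivative) auto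
qed

lemma continuous_on_indefinite_integral:
  fixes h :: "real \<Rightarrow> real"
  shows "continuous_on S h \<Longrightarrow> continuous_on S (\<lambda>\<xi>. integral {0..\<xi>} h)"
  by (rule DERIV_continuous_on[OF DERIV_indefinite_integral_within])

lemma DERIV_indefinite_integral:
  "continuous_on S h \<Longrightarrow> \<xi> \<in> S \<Longrightarrow> 0 < \<xi> \<Longrightarrow> ((\<lambda>\<xi>. integral {0..\<xi>} h) has_real_derivative h \<xi>) (at \<xi>)"
  by (rule DERIV_at_of_within_S[OF DERIV_indefinite_integral_within])

end

lemma half_open_interval_nonneg: "half_open_interval {0..}"
proof
  show "\<exists>\<eta>\<in>{0..}. \<xi> < \<eta>" if "\<xi> \<in> {0..}" for \<xi> :: real
    by (rule bexI[of _ "\<xi> + 1"]) (use that in auto)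
qed auto

text \<open>Triangles are truncated to \<open>\<xi> \<in> S\<close> because in the Maxwell setting the range of
  \<open>\<xi>(x)\<close>, \<open>x \<ge> 0\<close>, may be bounded, and \<open>f\<close> is meaningless beyond it.\<close>

definition tri :: "real set \<Rightarrow> real \<Rightarrow> real \<Rightarrow> (real \<times> real) set" where
  "tri S \<alpha> \<beta> = char_triangle \<alpha> \<beta> \<inter> S \<times> UNIV"

definition tri_int :: "real set \<Rightarrow> real \<Rightarrow> real \<Rightarrow> (real \<times> real) set" where
  "tri_int S \<alpha> \<beta> = char_triangle_int \<alpha> \<beta> \<inter> S \<times> UNIV"

lemma mem_tri: "(\<xi>, t) \<in> tri S \<alpha> \<beta> \<longleftrightarrow> 0 \<le> \<xi> \<and> \<xi> \<in> S \<and> \<alpha> \<le> t - \<xi> \<and> t + \<xi> \<le> \<beta>"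
  by (auto simp: tri_def char_triangle_def)

lemma mem_tri_int: "(\<xi>, t) \<in> tri_int S \<alpha> \<beta> \<longleftrightarrow> 0 < \<xi> \<and> \<xi> \<in> S \<and> \<alpha> < t - \<xi> \<and> t + \<xi> < \<beta>"
  by (auto simp: tri_int_def char_triangle_int_def)

lemma tri_int_subset: "tri_int S \<alpha> \<beta> \<subseteq> tri S \<alpha> \<beta>"
  by (auto simp: mem_tri mem_tri_int)

definition vekua_rhs :: "(real \<Rightarrow> real) \<Rightarrow> real \<Rightarrow> bicomplex \<Rightarrow> bicomplex \<Rightarrow> bicomplex" where
  "vekua_rhs q \<xi> w wt = bc_mult bc_j wt + q \<xi> *\<^sub>R bc_conj w"

lemma vekua_rhs_add_scaleR:
  "vekua_rhs q \<xi> (w + a *\<^sub>R v) (wt + a *\<^sub>R vt) = vekua_rhs q \<xi> w wt + a *\<^sub>R vekua_rhs q \<xi> v vt"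
  by (simp add: vekua_rhs_def bc_simps algebra_simps)

lemma vekua_rhs_conj: "vekua_rhs q \<xi> (bc_conj w) (- bc_conj wt) = bc_conj (vekua_rhs q \<xi> w wt)"
  by (simp add: vekua_rhs_def bc_simps prod_eq_iff)

lemma norm_vekua_rhs_le: "norm (vekua_rhs q \<xi> w wt) \<le> norm wt + \<bar>q \<xi>\<bar> * norm w"
  unfolding vekua_rhs_def using norm_triangle_ineq[of "bc_mult bc_j wt" "q \<xi> *\<^sub>R bc_conj w"] by simp

definition reflection :: "real \<Rightarrow> (real \<Rightarrow> real \<Rightarrow> bicomplex) \<Rightarrow> real \<Rightarrow> real \<Rightarrow> bicomplex" where
  "reflection c W \<xi> t = bc_conj (W \<xi> (c - t))"

text \<open>A free wave has \<open>p(\<xi>,t) = p(0,t+\<xi>)\<close> and \<open>m(\<xi>,t) = m(0,t-\<xi>)\<close>; the defects measure the deviation.\<close>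

definition plus_defect :: "(real \<Rightarrow> real \<Rightarrow> bicomplex) \<Rightarrow> real \<Rightarrow> real \<Rightarrow> complex" where
  "plus_defect W \<xi> t = bc_plus (W \<xi> t) - bc_plus (W 0 (t + \<xi>))"

definition minus_defect :: "(real \<Rightarrow> real \<Rightarrow> bicomplex) \<Rightarrow> real \<Rightarrow> real \<Rightarrow> complex" where
  "minus_defect W \<xi> t = bc_minus (W \<xi> t) - bc_minus (W 0 (t - \<xi>))"

definition defect :: "(real \<Rightarrow> real \<Rightarrow> bicomplex) \<Rightarrow> real \<Rightarrow> real \<Rightarrow> real" where
  "defect W \<xi> t = max (norm (plus_defect W \<xi> t)) (norm (minus_defect W \<xi> t))"

lemma plus_defect_reflection: "plus_defect (reflection c W) \<xi> t = minus_defect W \<xi> (c - t)"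
  by (simp add: plus_defect_def minus_defect_def reflection_def algebra_simps)

lemma minus_defect_reflection: "minus_defect (reflection c W) \<xi> t = plus_defect W \<xi> (c - t)"
  by (simp add: plus_defect_def minus_defect_def reflection_def algebra_simps)

locale vekua_system = half_open_interval S for S :: "real set" +
  fixes q :: "real \<Rightarrow> real"
  assumes cont_q: "continuous_on S q"
begin

abbreviation solution where
  "solution \<alpha> \<beta> \<equiv> classical_solution (tri S \<alpha> \<beta>) (tri_int S \<alpha> \<beta>) (vekua_rhs q)"

lemma solution_add:
  assumes "solution \<alpha> \<beta> W Wt" "solution \<alpha> \<beta> V Vt"
  shows "solution \<alpha> \<beta> (\<lambda>\<xi> t. W \<xi> t + V \<xi> t) (\<lambda>\<xi> t. Wt \<xi> t + Vt \<xi> t)"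
  using classical_solution_add_scaleR[OF assms vekua_rhs_add_scaleR, of 1] by simp

lemma solution_diff:
  assumes "solution \<alpha> \<beta> W Wt" "solution \<alpha> \<beta> V Vt"
  shows "solution \<alpha> \<beta> (\<lambda>\<xi> t. W \<xi> t - V \<xi> t) (\<lambda>\<xi> t. Wt \<xi> t - Vt \<xi> t)"
  using classical_solution_add_scaleR[OF assms vekua_rhs_add_scaleR, of "-1"] by simp

lemma solution_shift:
  assumes "solution \<alpha> \<beta> W Wt"
  shows "solution (\<alpha> - c) (\<beta> - c) (\<lambda>\<xi> t. W \<xi> (c + t)) (\<lambda>\<xi> t. Wt \<xi> (c + t))"
  using classical_solution_time_change[OF assms bounded_linear_ident,
      of 1 "tri S (\<alpha> - c) (\<beta> - c)" c "tri_int S (\<alpha> - c) (\<beta> - c)"]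
  by (auto simp: mem_tri mem_tri_int)

lemma solution_reflection:
  assumes "solution \<alpha> \<beta> W Wt"
  shows "solution (c - \<beta>) (c - \<alpha>) (reflection c W) (\<lambda>\<xi> t. - reflection c Wt \<xi> t)"
  using classical_solution_time_change[OF assms bounded_linear_bc_conj,
      of "- 1" "tri S (c - \<beta>) (c - \<alpha>)" c "tri_int S (c - \<beta>) (c - \<alpha>)"]
  unfolding reflection_def[abs_def] by (auto simp: mem_tri mem_tri_int vekua_rhs_conj)

lemma solution_subinterval:
  assumes "solution \<alpha> \<beta> W Wt" "\<alpha> \<le> \<alpha>'" "\<beta>' \<le> \<beta>"
  shows "solution \<alpha>' \<beta>' W Wt"
  using assms by (intro classical_solution_subset[OF assms(1)]) (auto simp: mem_tri mem_tri_int)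

lemma open_tri_int: "open (tri_int S \<alpha> \<beta>)"
proof -
  have "tri_int S \<alpha> \<beta> = (S \<inter> {0<..}) \<times> UNIV \<inter> {z. \<alpha> < snd z - fst z} \<inter> {z. snd z + fst z < \<beta>}"
    by (auto simp: mem_tri_int)
  then show ?thesis
    by (auto intro!: open_Int open_Times open_S_pos open_Collect_less continuous_intros)
qed

lemma q_bounded:
  assumes "\<xi> \<in> S"
  obtains Q where "0 \<le> Q" "\<And>s. s \<in> {0..\<xi>} \<Longrightarrow> \<bar>q s\<bar> \<le> Q"
proof -
  have "compact (q ` {0..\<xi>})"
    by (intro compact_continuous_image continuous_on_subset[OF cont_q] Icc_subset_S assms) auto
  then obtain Q where "\<forall>x\<in>q ` {0..\<xi>}. norm x \<le> Q"
    using compact_imp_bounded bounded_iff by blast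
  then show ?thesis by (intro that[of "max Q 0"]) (auto simp: le_max_iff_disj)
qed

lemma solution_continuous_on_line:
  assumes "solution \<alpha> \<beta> W Wt" "\<And>\<sigma>. \<sigma> \<in> {0..s} \<Longrightarrow> (\<sigma>, c + k * \<sigma>) \<in> tri S \<alpha> \<beta>"
  shows "continuous_on {0..s} (\<lambda>\<sigma>. W \<sigma> (c + k * \<sigma>))"
  by (intro continuous_on_compose_Pair[OF classical_solution_continuous[OF assms(1)]]
      continuous_intros assms(2))

lemma solution_continuous_initial:
  assumes "solution \<alpha> \<beta> W Wt"
  shows "continuous_on {\<alpha>..\<beta>} (W 0)"
  by (intro continuous_on_compose_Pair[OF classical_solution_continuous[OF assms]] continuous_intros)
     (auto simp: mem_tri zero_S)

lemma bc_plus_deriv_along_characteristic: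
  assumes sol: "solution \<alpha> \<beta> W Wt" and "(s, c - s) \<in> tri_int S \<alpha> \<beta>"
  shows "((\<lambda>s. bc_plus (W s (c - s))) has_vector_derivative q s *\<^sub>R bc_minus (W s (c - s))) (at s)"
proof -
  have "((\<lambda>s. W s (c + - 1 * s)) has_vector_derivative
      vekua_rhs q s (W s (c + - 1 * s)) (Wt s (c + - 1 * s)) + (- 1) *\<^sub>R Wt s (c + - 1 * s)) (at s)"
    by (rule has_vector_derivative_along_line[OF open_tri_int _ _
          classical_solution_deriv_t[OF sol] classical_solution_continuous_deriv[OF sol]])
       (use assms(2) classical_solution_deriv_x[OF sol] in auto)
  from bounded_linear.has_vector_derivative[OF bounded_linear_bc_plus this]
  show ?thesis by (simp add: vekua_rhs_def bc_simps algebra_simps)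
qed

lemma has_integral_plus_defect:
  assumes sol: "solution \<alpha> \<beta> W Wt" and st: "(s, t) \<in> tri_int S \<alpha> \<beta>"
  shows "((\<lambda>\<sigma>. q \<sigma> *\<^sub>R bc_minus (W \<sigma> (t + s - \<sigma>))) has_integral plus_defect W s t) {0..s}"
proof -
  have s: "0 < s" "s \<in> S" "\<alpha> < t - s" "t + s < \<beta>" using st by (auto simp: mem_tri_int)
  have "((\<lambda>\<sigma>. q \<sigma> *\<^sub>R bc_minus (W \<sigma> (t + s - \<sigma>))) has_integral
      bc_plus (W s (t + s - s)) - bc_plus (W 0 (t + s - 0))) {0..s}"
  proof (rule fundamental_theorem_of_calculus_interior)
    have "continuous_on {0..s} (\<lambda>\<sigma>. W \<sigma> (t + s + - 1 * \<sigma>))"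
      using s S_down[OF s(2)] by (intro solution_continuous_on_line[OF sol]) (auto simp: mem_tri)
    then show "continuous_on {0..s} (\<lambda>\<sigma>. bc_plus (W \<sigma> (t + s - \<sigma>)))"
      by (intro continuous_intros) simp
    show "((\<lambda>\<sigma>. bc_plus (W \<sigma> (t + s - \<sigma>))) has_vector_derivative q \<sigma> *\<^sub>R bc_minus (W \<sigma> (t + s - \<sigma>))) (at \<sigma>)"
      if "\<sigma> \<in> {0<..<s}" for \<sigma>
      using s that S_down[OF s(2), of \<sigma>]
      by (intro bc_plus_deriv_along_characteristic[OF sol]) (auto simp: mem_tri_int)
  qed (use s in simp)
  then show ?thesis by (simp add: plus_defect_def)
qed

lemma integral_norm_backward_line_le:
  fixes h :: "real \<Rightarrow> 'a::banach"
  assumes h: "continuous_on {\<alpha>..\<beta>} h" and "\<alpha> \<le> y - 2 * s" "y \<le> \<beta>"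
  shows "\<exists>I\<le>integral {\<alpha>..\<beta>} (\<lambda>y. norm (h y)) / 2. ((\<lambda>\<sigma>. norm (h (y - 2 * \<sigma>))) has_integral I) {0..s}"
proof -
  have integrable: "(\<lambda>y. norm (h y)) integrable_on {a..b}" if "{a..b} \<subseteq> {\<alpha>..\<beta>}" for a b
    by (intro integrable_continuous_real continuous_intros continuous_on_subset[OF h that])
  have sub: "{y - 2 * s..y} \<subseteq> {\<alpha>..\<beta>}" using assms(2,3) by auto
  have "integral {y - 2 * s..y} (\<lambda>y. norm (h y)) \<le> integral {\<alpha>..\<beta>} (\<lambda>y. norm (h y))"
    by (intro integral_subset_le integrable sub) auto
  then show ?thesis
    using has_integral_backward_line[OF integrable_integral[OF integrable[OF sub]]]
    by (intro exI[of _ "integral {y - 2 * s..y} (\<lambda>y. norm (h y)) / 2"]) auto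
qed

lemma plus_defect_le:
  assumes sol: "solution \<alpha> \<beta> W Wt" and st: "(s, t) \<in> tri_int S \<alpha> \<beta>"
    and Q: "0 \<le> Q" "\<And>\<sigma>. \<sigma> \<in> {0..s} \<Longrightarrow> \<bar>q \<sigma>\<bar> \<le> Q"
    and A: "\<And>\<sigma> \<tau>. (\<sigma>, \<tau>) \<in> tri_int S \<alpha> \<beta> \<Longrightarrow> norm (minus_defect W \<sigma> \<tau>) \<le> A * exp (2 * Q * \<sigma>)" "0 \<le> A"
    and N: "integral {\<alpha>..\<beta>} (\<lambda>y. norm (bc_minus (W 0 y))) \<le> N"
  shows "norm (plus_defect W s t) \<le> Q * N / 2 + A / 2 * exp (2 * Q * s)"
proof -
  have s: "0 < s" "s \<in> S" "\<alpha> < t - s" "t + s < \<beta>" using st by (auto simp: mem_tri_int)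
  obtain I where I: "I \<le> integral {\<alpha>..\<beta>} (\<lambda>y. norm (bc_minus (W 0 y))) / 2"
    "((\<lambda>\<sigma>. norm (bc_minus (W 0 (t + s - 2 * \<sigma>)))) has_integral I) {0..s}"
    using integral_norm_backward_line_le[of \<alpha> \<beta> "\<lambda>y. bc_minus (W 0 y)" "t + s" s] s
    by (auto intro: continuous_intros solution_continuous_initial[OF sol])
  have "((\<lambda>\<sigma>. Q * A * exp (2 * Q * \<sigma>)) has_integral A / 2 * exp (2 * Q * s) - A / 2 * exp (2 * Q * 0)) {0..s}"
    by (rule fundamental_theorem_of_calculus)
       (use s in \<open>auto intro!: derivative_eq_intros
          simp: has_real_derivative_iff_has_vector_derivative[symmetric]\<close>)
  from has_integral_add[OF has_integral_mult_right[OF I(2), of Q] this]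
  have majorant: "((\<lambda>\<sigma>. Q * norm (bc_minus (W 0 (t + s - 2 * \<sigma>))) + Q * A * exp (2 * Q * \<sigma>))
      has_integral Q * I + (A / 2 * exp (2 * Q * s) - A / 2)) {0..s}"
    by simp
  have "norm (q \<sigma> *\<^sub>R bc_minus (W \<sigma> (t + s - \<sigma>))) \<le>
      (Q * norm (bc_minus (W 0 (t + s - 2 * \<sigma>))) + Q * A * exp (2 * Q * \<sigma>)) \<bullet> 1" if \<sigma>: "\<sigma> \<in> {0..s}" for \<sigma>
  proof -
    have "(\<sigma>, t + s - \<sigma>) \<in> tri_int S \<alpha> \<beta> \<or> \<sigma> = 0"
      using s \<sigma> S_down[OF s(2), of \<sigma>] by (auto simp: mem_tri_int)
    then have "norm (minus_defect W \<sigma> (t + s - \<sigma>)) \<le> A * exp (2 * Q * \<sigma>)"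
      using A by (elim disjE) (blast, simp add: minus_defect_def)
    moreover have "bc_minus (W \<sigma> (t + s - \<sigma>)) = bc_minus (W 0 (t + s - 2 * \<sigma>)) + minus_defect W \<sigma> (t + s - \<sigma>)"
      by (simp add: minus_defect_def algebra_simps)
    ultimately have "norm (bc_minus (W \<sigma> (t + s - \<sigma>))) \<le>
        norm (bc_minus (W 0 (t + s - 2 * \<sigma>))) + A * exp (2 * Q * \<sigma>)"
      by (simp add: norm_triangle_mono)
    from mult_mono[OF Q(2)[OF \<sigma>] this Q(1) norm_ge_zero] show ?thesis
      by (simp add: algebra_simps)
  qed
  from has_integral_norm_bound_integral_component[OF has_integral_plus_defect[OF sol st] majorant this]
  have "norm (plus_defect W s t) \<le> Q * I + (A / 2 * exp (2 * Q * s) - A / 2)" by simp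
  also have "\<dots> \<le> Q * N / 2 + A / 2 * exp (2 * Q * s)"
    using mult_left_mono[OF order.trans[OF I(1) divide_right_mono[OF N]] Q(1)] A(2) by simp
  finally show ?thesis .
qed

lemma minus_defect_le:
  assumes sol: "solution \<alpha> \<beta> W Wt" and st: "(s, t) \<in> tri_int S \<alpha> \<beta>"
    and Q: "0 \<le> Q" "\<And>\<sigma>. \<sigma> \<in> {0..s} \<Longrightarrow> \<bar>q \<sigma>\<bar> \<le> Q"
    and A: "\<And>\<sigma> \<tau>. (\<sigma>, \<tau>) \<in> tri_int S \<alpha> \<beta> \<Longrightarrow> norm (plus_defect W \<sigma> \<tau>) \<le> A * exp (2 * Q * \<sigma>)" "0 \<le> A"
    and N: "integral {\<alpha>..\<beta>} (\<lambda>y. norm (bc_plus (W 0 y))) \<le> N"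
  shows "norm (minus_defect W s t) \<le> Q * N / 2 + A / 2 * exp (2 * Q * s)"
proof -
  have "norm (plus_defect (reflection 0 W) s (- t)) \<le> Q * N / 2 + A / 2 * exp (2 * Q * s)"
  proof (rule plus_defect_le[OF solution_reflection[OF sol, of 0] _ Q _ A(2)])
    show "norm (minus_defect (reflection 0 W) \<sigma> \<tau>) \<le> A * exp (2 * Q * \<sigma>)"
      if "(\<sigma>, \<tau>) \<in> tri_int S (0 - \<beta>) (0 - \<alpha>)" for \<sigma> \<tau>
      using A(1)[of \<sigma> "- \<tau>"] that by (simp add: minus_defect_reflection mem_tri_int)
    show "integral {0 - \<beta>..0 - \<alpha>} (\<lambda>y. norm (bc_minus (reflection 0 W 0 y))) \<le> N"
      using N Henstock_Kurzweil_Integration.integral_reflect_real[of \<beta> \<alpha> "\<lambda>y. norm (bc_plus (W 0 y))"]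
      by (simp add: reflection_def)
  qed (use st in \<open>auto simp: mem_tri_int\<close>)
  then show ?thesis by (simp add: plus_defect_reflection)
qed

lemma compact_tri:
  assumes "(\<beta> - \<alpha>) / 2 \<in> S"
  shows "compact (tri S \<alpha> \<beta>)"
proof -
  have tri: "tri S \<alpha> \<beta> = {z. 0 \<le> fst z} \<inter> {z. \<alpha> \<le> snd z - fst z} \<inter> {z. snd z + fst z \<le> \<beta>}"
    using S_down[OF assms] by (auto simp: mem_tri)
  have "closed (tri S \<alpha> \<beta>)"
    unfolding tri by (intro closed_Int closed_Collect_le continuous_intros)
  moreover have "tri S \<alpha> \<beta> \<subseteq> {0..(\<beta> - \<alpha>) / 2} \<times> {\<alpha>..\<beta>}" by (auto simp: tri)
  ultimately show ?thesis
    by (metis compact_Int_closed compact_Times compact_Icc inf.absorb_iff2)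
qed

lemma continuous_on_defect:
  assumes "solution \<alpha> \<beta> W Wt"
  shows "continuous_on (tri S \<alpha> \<beta>) (\<lambda>(\<xi>, t). defect W \<xi> t)"
  unfolding defect_def plus_defect_def minus_defect_def case_prod_beta
  by (intro continuous_intros continuous_on_compose_Pair[OF classical_solution_continuous[OF assms]])
     (auto simp: mem_tri zero_S)

text \<open>With the weight \<open>exp (- 2 Q s)\<close>, integration along characteristics halves the supremum.\<close>

lemma defect_bound_interior:
  assumes sol: "solution \<alpha> \<beta> W Wt" and st: "(s, t) \<in> tri_int S \<alpha> \<beta>" and apex: "(\<beta> - \<alpha>) / 2 \<in> S"
    and Q: "0 \<le> Q" "\<And>\<sigma>. \<sigma> \<in> {0..(\<beta> - \<alpha>) / 2} \<Longrightarrow> \<bar>q \<sigma>\<bar> \<le> Q"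
    and N: "integral {\<alpha>..\<beta>} (\<lambda>y. norm (bc_plus (W 0 y))) \<le> N"
      "integral {\<alpha>..\<beta>} (\<lambda>y. norm (bc_minus (W 0 y))) \<le> N"
  shows "defect W s t \<le> Q * N * exp (2 * Q * s)"
proof -
  define v where "v z = exp (- 2 * Q * fst z) * defect W (fst z) (snd z)" for z
  have v_le_iff: "v (s, t) \<le> B \<longleftrightarrow>
      norm (plus_defect W s t) \<le> B * exp (2 * Q * s) \<and> norm (minus_defect W s t) \<le> B * exp (2 * Q * s)"
    for s t B
    by (auto simp: v_def defect_def exp_minus field_simps)
  have "continuous_on (tri S \<alpha> \<beta>) v"
    unfolding v_def using continuous_on_defect[OF sol] by (intro continuous_intros) (simp add: case_prod_beta)
  then have "bounded (v ` tri S \<alpha> \<beta>)"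
    using compact_tri[OF apex] compact_continuous_image compact_imp_bounded by blast
  then have bdd: "bdd_above (v ` tri_int S \<alpha> \<beta>)"
    using tri_int_subset by (meson bdd_above_mono bounded_imp_bdd_above image_mono)
  have N_nonneg: "0 \<le> N" by (rule order.trans[OF integral_norm_nonneg N(1)])
  have "v (s, t) \<le> (Q * N / 2) / (1 - 1 / 2)"
  proof (rule le_of_contraction_bound[OF bdd _ st])
    fix A z assume A: "\<And>z. z \<in> tri_int S \<alpha> \<beta> \<Longrightarrow> v z \<le> A" and z: "z \<in> tri_int S \<alpha> \<beta>"
    obtain r \<tau> where z_eq: "z = (r, \<tau>)" by (cases z)
    have r: "0 < r" "r \<le> (\<beta> - \<alpha>) / 2" using z by (auto simp: z_eq mem_tri_int)
    have "0 \<le> v z" by (simp add: v_def defect_def le_max_iff_disj)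
    with A[OF z] have "0 \<le> A" by simp
    have "Q * N / 2 * 1 \<le> Q * N / 2 * exp (2 * Q * r)"
      using Q(1) N_nonneg r by (intro mult_left_mono) auto
    moreover have "norm (plus_defect W r \<tau>) \<le> Q * N / 2 + A / 2 * exp (2 * Q * r)"
      by (rule plus_defect_le[OF sol z[unfolded z_eq] Q(1) _ _ \<open>0 \<le> A\<close> N(2)]) (use r Q A v_le_iff in auto)
    moreover have "norm (minus_defect W r \<tau>) \<le> Q * N / 2 + A / 2 * exp (2 * Q * r)"
      by (rule minus_defect_le[OF sol z[unfolded z_eq] Q(1) _ _ \<open>0 \<le> A\<close> N(1)]) (use r Q A v_le_iff in auto)
    ultimately show "v z \<le> Q * N / 2 + 1 / 2 * A"
      unfolding z_eq v_le_iff by (auto simp: algebra_simps)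
  qed simp
  then show ?thesis by (simp add: v_def exp_minus field_simps)
qed

theorem a_priori_bound:
  assumes sol: "solution \<alpha> \<beta> W Wt" and pt: "(\<xi>, t) \<in> tri S \<alpha> \<beta>"
    and Q: "0 \<le> Q" "\<And>s. s \<in> {0..\<xi>} \<Longrightarrow> \<bar>q s\<bar> \<le> Q"
    and N: "integral {t - \<xi>..t + \<xi>} (\<lambda>s. norm (bc_plus (W 0 s))) \<le> N"
      "integral {t - \<xi>..t + \<xi>} (\<lambda>s. norm (bc_minus (W 0 s))) \<le> N"
  shows "defect W \<xi> t \<le> Q * N * exp (2 * Q * \<xi>)"
proof (cases "\<xi> = 0")
  case True
  have "0 \<le> N" using N by (simp add: True)
  then show ?thesis using Q(1) by (simp add: True defect_def plus_defect_def minus_defect_def)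
next
  case False
  have \<xi>: "0 < \<xi>" "\<xi> \<in> S" using pt False by (auto simp: mem_tri)
  have sol_sub: "solution (t - \<xi>) (t + \<xi>) W Wt"
    by (rule solution_subinterval[OF sol]) (use pt in \<open>auto simp: mem_tri\<close>)
  have N_nonneg: "0 \<le> N" by (rule order.trans[OF integral_norm_nonneg N(1)])
  have below: "norm (defect W s t) \<le> Q * N * exp (2 * Q * \<xi>)" if s: "s \<in> {0<..<\<xi>}" for s
  proof -
    have "defect W s t \<le> Q * N * exp (2 * Q * s)"
      by (rule defect_bound_interior[OF sol_sub _ _ Q(1) _ N])
         (use s \<xi> S_down[OF \<xi>(2), of s] Q(2) in \<open>auto simp: mem_tri_int\<close>)
    also have "\<dots> \<le> Q * N * exp (2 * Q * \<xi>)"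
      using Q(1) N_nonneg s by (intro mult_left_mono) (auto intro: mult_left_mono)
    finally show ?thesis by (simp add: defect_def le_max_iff_disj)
  qed
  have closure: "closure {0<..<\<xi>} = {0..\<xi>}" using \<xi> by simp
  have "continuous_on {0..\<xi>} (\<lambda>s. defect W s t)"
    by (intro continuous_on_compose_Pair[OF continuous_on_defect[OF sol_sub]] continuous_intros)
       (use S_down[OF \<xi>(2)] in \<open>auto simp: mem_tri\<close>)
  then have "norm (defect W \<xi> t) \<le> Q * N * exp (2 * Q * \<xi>)"
    using continuous_on_closure_norm_le[of "{0<..<\<xi>}" "\<lambda>s. defect W s t" _ \<xi>] below \<xi> unfolding closure by auto
  then show ?thesis by simp
qed

corollary solution_unique:
  assumes sol: "solution \<alpha> \<beta> W Wt" "solution \<alpha> \<beta> V Vt" and initial: "\<And>t. t \<in> {\<alpha>..\<beta>} \<Longrightarrow> W 0 t = V 0 t"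
    and pt: "(\<xi>, t) \<in> tri S \<alpha> \<beta>"
  shows "W \<xi> t = V \<xi> t"
proof -
  define D where "D \<xi> t = W \<xi> t - V \<xi> t" for \<xi> t
  have sol_D: "solution \<alpha> \<beta> D (\<lambda>\<xi> t. Wt \<xi> t - Vt \<xi> t)"
    unfolding D_def[abs_def] by (rule solution_diff[OF sol])
  have "\<xi> \<in> S" using pt by (simp add: mem_tri)
  then obtain Q where Q: "0 \<le> Q" "\<And>s. s \<in> {0..\<xi>} \<Longrightarrow> \<bar>q s\<bar> \<le> Q" using q_bounded by metis
  have D_initial: "D 0 s = 0" if "s \<in> {t - \<xi>..t + \<xi>}" for s
    using initial[of s] pt that by (auto simp: D_def mem_tri)
  have "integral {t - \<xi>..t + \<xi>} (\<lambda>s. norm (bc_plus (D 0 s))) = 0"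
    "integral {t - \<xi>..t + \<xi>} (\<lambda>s. norm (bc_minus (D 0 s))) = 0"
    by (auto simp: D_initial intro!: integral_unique has_integral_is_0)
  then have "defect D \<xi> t \<le> 0"
    using a_priori_bound[OF sol_D pt Q, of 0] by simp
  then have "norm (bc_plus (D \<xi> t)) + norm (bc_minus (D \<xi> t)) = 0"
    using D_initial[of "t + \<xi>"] D_initial[of "t - \<xi>"] pt
    by (simp add: defect_def plus_defect_def minus_defect_def mem_tri)
  then have "D \<xi> t = 0" using norm_le_bc_plus_minus[of "D \<xi> t"] by simp
  then show ?thesis by (simp add: D_def)
qed

end

section \<open>Limits of solutions\<close>

context vekua_system
begin

lemma defect_sup_bound:
  assumes sol: "solution \<alpha> \<beta> W Wt" and pt: "(\<xi>, t) \<in> tri S \<alpha> \<beta>"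
    and Q: "0 \<le> Q" "\<And>s. s \<in> {0..\<xi>} \<Longrightarrow> \<bar>q s\<bar> \<le> Q"
    and small: "\<And>s. s \<in> {t - \<xi>..t + \<xi>} \<Longrightarrow> norm (W 0 s) \<le> \<epsilon>"
  shows "defect W \<xi> t \<le> Q * (4 * \<epsilon> * \<xi>) * exp (2 * Q * \<xi>)"
proof -
  have cont: "continuous_on {t - \<xi>..t + \<xi>} (W 0)" and "0 \<le> \<xi>"
    using pt by (auto simp: mem_tri intro!: continuous_on_subset[OF solution_continuous_initial[OF sol]])
  have bound: "norm (bc_plus (W 0 s)) \<le> 2 * \<epsilon>" "norm (bc_minus (W 0 s)) \<le> 2 * \<epsilon>"
    if "s \<in> {t - \<xi>..t + \<xi>}" for s
    using norm_bc_plus_le[of "W 0 s"] norm_bc_minus_le[of "W 0 s"] small[OF that] by auto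
  have "norm (integral {t - \<xi>..t + \<xi>} (\<lambda>s. norm (bc_plus (W 0 s)))) \<le> 2 * \<epsilon> * ((t + \<xi>) - (t - \<xi>))"
    "norm (integral {t - \<xi>..t + \<xi>} (\<lambda>s. norm (bc_minus (W 0 s)))) \<le> 2 * \<epsilon> * ((t + \<xi>) - (t - \<xi>))"
    using \<open>0 \<le> \<xi>\<close> bound by (intro integral_bound continuous_intros cont; simp)+
  then show ?thesis by (intro a_priori_bound[OF sol pt Q]) auto
qed

lemma solution_sup_bound:
  assumes "\<eta> \<in> S"
  obtains K where "0 < K" "\<And>\<alpha> \<beta> W Wt \<xi> t \<epsilon>. solution \<alpha> \<beta> W Wt \<Longrightarrow> (\<xi>, t) \<in> tri S \<alpha> \<beta> \<Longrightarrow> \<xi> \<le> \<eta> \<Longrightarrow>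
    (\<And>s. s \<in> {\<alpha>..\<beta>} \<Longrightarrow> norm (W 0 s) \<le> \<epsilon>) \<Longrightarrow> norm (W \<xi> t) \<le> K * \<epsilon>"
proof -
  obtain Q where Q: "0 \<le> Q" "\<And>s. s \<in> {0..\<eta>} \<Longrightarrow> \<bar>q s\<bar> \<le> Q" using q_bounded[OF assms] by metis
  define K where "K = 4 + 8 * Q * \<eta> * exp (2 * Q * \<eta>)"
  show thesis
  proof (rule that[of K])
    show "0 < K" using Q(1) S_nonneg[OF assms] by (simp add: K_def add_pos_nonneg)
    fix \<alpha> \<beta> W Wt \<xi> t and \<epsilon> :: real
    assume sol: "solution \<alpha> \<beta> W Wt" and pt: "(\<xi>, t) \<in> tri S \<alpha> \<beta>" and "\<xi> \<le> \<eta>"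
      and small: "\<And>s. s \<in> {\<alpha>..\<beta>} \<Longrightarrow> norm (W 0 s) \<le> \<epsilon>"
    have \<xi>: "0 \<le> \<xi>" "\<alpha> \<le> t - \<xi>" "t + \<xi> \<le> \<beta>" using pt by (auto simp: mem_tri)
    have "0 \<le> \<epsilon>" using order.trans[OF norm_ge_zero small[of t]] \<xi> by simp
    have "defect W \<xi> t \<le> Q * (4 * \<epsilon> * \<xi>) * exp (2 * Q * \<xi>)"
      by (rule defect_sup_bound[OF sol pt Q(1)]) (use Q(2) \<open>\<xi> \<le> \<eta>\<close> small \<xi> in auto)
    also have "\<dots> \<le> Q * (4 * \<epsilon> * \<eta>) * exp (2 * Q * \<eta>)"
      using Q(1) \<open>0 \<le> \<epsilon>\<close> \<open>\<xi> \<le> \<eta>\<close> \<xi>(1) by (intro mult_mono mult_left_mono) (auto intro: mult_left_mono)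
    finally have "norm (plus_defect W \<xi> t) \<le> (K - 4) / 2 * \<epsilon>" "norm (minus_defect W \<xi> t) \<le> (K - 4) / 2 * \<epsilon>"
      by (simp_all add: defect_def K_def algebra_simps)
    moreover have "norm (bc_plus (W \<xi> t)) \<le> norm (plus_defect W \<xi> t) + norm (bc_plus (W 0 (t + \<xi>)))"
      "norm (bc_minus (W \<xi> t)) \<le> norm (minus_defect W \<xi> t) + norm (bc_minus (W 0 (t - \<xi>)))"
      unfolding plus_defect_def minus_defect_def by (simp_all add: norm_triangle_sub add.commute)
    moreover have "norm (bc_plus (W 0 (t + \<xi>))) \<le> 2 * \<epsilon>" "norm (bc_minus (W 0 (t - \<xi>))) \<le> 2 * \<epsilon>"
      using norm_bc_plus_le[of "W 0 (t + \<xi>)"] norm_bc_minus_le[of "W 0 (t - \<xi>)"]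
        small[of "t + \<xi>"] small[of "t - \<xi>"] \<xi> by auto
    ultimately show "norm (W \<xi> t) \<le> K * \<epsilon>"
      using norm_le_bc_plus_minus[of "W \<xi> t"] by (simp add: field_simps)
  qed
qed

lemma solutions_uniformly_convergent:
  assumes sol: "\<And>n. solution \<alpha> \<beta> (W n) (Wt n)"
    and initial: "uniformly_convergent_on {\<alpha>..\<beta>} (\<lambda>n. W n 0)" and \<eta>: "\<eta> \<in> S"
  shows "uniformly_convergent_on (tri S \<alpha> \<beta> \<inter> {..\<eta>} \<times> UNIV) (\<lambda>n (\<xi>, t). W n \<xi> t)"
  unfolding uniformly_convergent_eq_Cauchy
proof (rule uniformly_Cauchy_onI)
  fix e :: real assume "0 < e"
  obtain K where K: "0 < K" "\<And>\<alpha> \<beta> W Wt \<xi> t \<epsilon>. solution \<alpha> \<beta> W Wt \<Longrightarrow> (\<xi>, t) \<in> tri S \<alpha> \<beta> \<Longrightarrow> \<xi> \<le> \<eta> \<Longrightarrow>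
    (\<And>s. s \<in> {\<alpha>..\<beta>} \<Longrightarrow> norm (W 0 s) \<le> \<epsilon>) \<Longrightarrow> norm (W \<xi> t) \<le> K * \<epsilon>"
    using solution_sup_bound[OF \<eta>] by metis
  define d where "d = e / (2 * K)"
  have d: "0 < d" "K * d < e" using K(1) \<open>0 < e\<close> by (auto simp: d_def)
  then obtain M where M: "\<And>s m n. s \<in> {\<alpha>..\<beta>} \<Longrightarrow> m \<ge> M \<Longrightarrow> n \<ge> M \<Longrightarrow> dist (W m 0 s) (W n 0 s) < d"
    using initial unfolding uniformly_convergent_eq_Cauchy uniformly_Cauchy_on_def by meson
  have "dist (W m \<xi> t) (W n \<xi> t) < e"
    if "(\<xi>, t) \<in> tri S \<alpha> \<beta>" "\<xi> \<le> \<eta>" "m \<ge> M" "n \<ge> M" for \<xi> t m n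
  proof -
    have "norm (W m \<xi> t - W n \<xi> t) \<le> K * d"
      using M[OF _ that(3,4)]
      by (intro K(2)[OF solution_diff[OF sol sol] that(1,2)]) (simp add: dist_norm less_imp_le)
    then show ?thesis using d(2) by (simp add: dist_norm)
  qed
  then show "\<exists>M. \<forall>z\<in>tri S \<alpha> \<beta> \<inter> {..\<eta>} \<times> UNIV. \<forall>m\<ge>M. \<forall>n\<ge>M.
      dist (case z of (\<xi>, t) \<Rightarrow> W m \<xi> t) (case z of (\<xi>, t) \<Rightarrow> W n \<xi> t) < e"
    by fastforce
qed

text \<open>Uniform convergence on the truncations \<open>\<xi> \<le> \<eta>\<close>, the natural one since \<open>q\<close> need not be bounded on \<open>S\<close>.\<close>

definition truncated_uniform_limit ::
  "real \<Rightarrow> real \<Rightarrow> (nat \<Rightarrow> real \<Rightarrow> real \<Rightarrow> bicomplex) \<Rightarrow> (real \<Rightarrow> real \<Rightarrow> bicomplex) \<Rightarrow> bool" where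
  "truncated_uniform_limit \<alpha> \<beta> V W \<longleftrightarrow>
     (\<forall>\<eta>\<in>S. uniform_limit (tri S \<alpha> \<beta> \<inter> {..\<eta>} \<times> UNIV) (\<lambda>n (\<xi>, t). V n \<xi> t) (\<lambda>(\<xi>, t). W \<xi> t) sequentially)"

lemma solutions_truncated_uniform_limit:
  assumes "\<And>n. solution \<alpha> \<beta> (V n) (Vt n)" "uniformly_convergent_on {\<alpha>..\<beta>} (\<lambda>n. V n 0)"
  obtains W where "truncated_uniform_limit \<alpha> \<beta> V W"
proof
  show "truncated_uniform_limit \<alpha> \<beta> V (\<lambda>\<xi> t. lim (\<lambda>n. V n \<xi> t))"
    using solutions_uniformly_convergent[OF assms]
    unfolding truncated_uniform_limit_def uniformly_convergent_uniform_limit_iff case_prod_beta by blast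
qed

lemma truncated_uniform_limit_iff:
  "truncated_uniform_limit \<alpha> \<beta> V W \<longleftrightarrow> (\<forall>\<eta>\<in>S. \<forall>e>0. \<forall>\<^sub>F n in sequentially.
     \<forall>\<xi> t. (\<xi>, t) \<in> tri S \<alpha> \<beta> \<longrightarrow> \<xi> \<le> \<eta> \<longrightarrow> dist (V n \<xi> t) (W \<xi> t) < e)"
proof -
  have "(\<forall>z\<in>tri S \<alpha> \<beta> \<inter> {..\<eta>} \<times> UNIV. dist (case z of (\<xi>, t) \<Rightarrow> V n \<xi> t) (case z of (\<xi>, t) \<Rightarrow> W \<xi> t) < e) \<longleftrightarrow>
      (\<forall>\<xi> t. (\<xi>, t) \<in> tri S \<alpha> \<beta> \<longrightarrow> \<xi> \<le> \<eta> \<longrightarrow> dist (V n \<xi> t) (W \<xi> t) < e)" for \<eta> e n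
    by force
  then show ?thesis by (simp add: truncated_uniform_limit_def uniform_limit_iff)
qed

lemma truncated_uniform_limit_slice:
  assumes "truncated_uniform_limit \<alpha> \<beta> V W" "\<eta> \<in> S"
    and "\<And>x. x \<in> A \<Longrightarrow> (h x, k x) \<in> tri S \<alpha> \<beta> \<and> h x \<le> \<eta>"
  shows "uniform_limit A (\<lambda>n x. V n (h x) (k x)) (\<lambda>x. W (h x) (k x)) sequentially"
proof (rule uniform_limitI)
  fix e :: real assume "0 < e"
  with assms(1,2) have "\<forall>\<^sub>F n in sequentially.
      \<forall>\<xi> t. (\<xi>, t) \<in> tri S \<alpha> \<beta> \<longrightarrow> \<xi> \<le> \<eta> \<longrightarrow> dist (V n \<xi> t) (W \<xi> t) < e"
    by (simp add: truncated_uniform_limit_iff)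
  then show "\<forall>\<^sub>F n in sequentially. \<forall>x\<in>A. dist (V n (h x) (k x)) (W (h x) (k x)) < e"
    by eventually_elim (use assms(3) in blast)
qed

lemma truncated_uniform_limit_tendsto:
  assumes lim: "truncated_uniform_limit \<alpha> \<beta> V W" and pt: "(\<xi>, t) \<in> tri S \<alpha> \<beta>"
  shows "(\<lambda>n. V n \<xi> t) \<longlonglongrightarrow> W \<xi> t"
proof -
  have "\<xi> \<in> S" using pt by (simp add: mem_tri)
  from truncated_uniform_limit_slice[OF lim this, of "{()}" "\<lambda>_. \<xi>" "\<lambda>_. t"] pt
  show ?thesis by (simp add: uniform_limit_singleton)
qed

lemma truncated_uniform_limit_continuous:
  assumes lim: "truncated_uniform_limit \<alpha> \<beta> V W" and V: "\<And>n. continuous_on (tri S \<alpha> \<beta>) (\<lambda>(\<xi>, t). V n \<xi> t)"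
  shows "continuous_on (tri S \<alpha> \<beta>) (\<lambda>(\<xi>, t). W \<xi> t)"
  unfolding continuous_on_eq_continuous_within
proof
  fix z assume z: "z \<in> tri S \<alpha> \<beta>"
  then obtain \<eta> where \<eta>: "\<eta> \<in> S" "fst z < \<eta>" using S_open[of "fst z"] by (cases z) (auto simp: mem_tri)
  have "\<forall>\<^sub>F n in sequentially. continuous_on (tri S \<alpha> \<beta> \<inter> {..\<eta>} \<times> UNIV) (\<lambda>(\<xi>, t). V n \<xi> t)"
    by (intro always_eventually allI continuous_on_subset[OF V]) auto
  from uniform_limit_theorem[OF this] lim \<eta>(1)
  have "continuous_on (tri S \<alpha> \<beta> \<inter> {..\<eta>} \<times> UNIV) (\<lambda>(\<xi>, t). W \<xi> t)"
    unfolding truncated_uniform_limit_def by auto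
  then have "continuous (at z within (tri S \<alpha> \<beta> \<inter> {..\<eta>} \<times> UNIV)) (\<lambda>(\<xi>, t). W \<xi> t)"
    using z \<eta> unfolding continuous_on_eq_continuous_within by (auto simp: mem_Times_iff)
  moreover have "at z within tri S \<alpha> \<beta> = at z within (tri S \<alpha> \<beta> \<inter> {..\<eta>} \<times> UNIV)"
    by (rule at_within_nhd[of z "{..<\<eta>} \<times> UNIV"]) (use \<eta> in \<open>auto intro: open_Times simp: mem_Times_iff\<close>)
  ultimately show "continuous (at z within tri S \<alpha> \<beta>) (\<lambda>(\<xi>, t). W \<xi> t)" by simp
qed

lemma truncated_uniform_limit_deriv_t:
  assumes V: "\<And>n. solution \<alpha> \<beta> (V n) (Vt n)"
    and lim: "truncated_uniform_limit \<alpha> \<beta> V W" "truncated_uniform_limit \<alpha> \<beta> Vt Wt"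
    and pt: "(\<xi>, t) \<in> tri_int S \<alpha> \<beta>"
  shows "(W \<xi> has_vector_derivative Wt \<xi> t) (at t)"
proof (rule has_vector_derivative_uniform_limit)
  let ?I = "{\<alpha> + \<xi><..<\<beta> - \<xi>}"
  have \<xi>: "\<xi> \<in> S" "0 < \<xi>" "\<alpha> < t - \<xi>" "t + \<xi> < \<beta>" using pt by (auto simp: mem_tri_int)
  then show "open ?I" "convex ?I" "t \<in> ?I" by auto
  have interior: "(\<xi>, x) \<in> tri_int S \<alpha> \<beta>" if "x \<in> ?I" for x using that \<xi> by (auto simp: mem_tri_int)
  then show "(V n \<xi> has_vector_derivative Vt n \<xi> x) (at x)" if "x \<in> ?I" for n x
    using classical_solution_deriv_t[OF V] that by blast
  show "(\<lambda>n. V n \<xi> x) \<longlonglongrightarrow> W \<xi> x" if "x \<in> ?I" for x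
    using truncated_uniform_limit_tendsto[OF lim(1)] interior[OF that] tri_int_subset by blast
  show "uniform_limit ?I (\<lambda>n. Vt n \<xi>) (Wt \<xi>) sequentially"
    by (rule truncated_uniform_limit_slice[OF lim(2) \<xi>(1)]) (use interior tri_int_subset in blast)
qed

lemma truncated_uniform_limit_rhs:
  assumes V: "truncated_uniform_limit \<alpha> \<beta> V W" and Vt: "truncated_uniform_limit \<alpha> \<beta> Vt Wt"
  shows "truncated_uniform_limit \<alpha> \<beta> (\<lambda>n \<xi> t. vekua_rhs q \<xi> (V n \<xi> t) (Vt n \<xi> t))
    (\<lambda>\<xi> t. vekua_rhs q \<xi> (W \<xi> t) (Wt \<xi> t))"
  unfolding truncated_uniform_limit_iff
proof (intro ballI allI impI)
  fix \<eta> e :: real assume \<eta>: "\<eta> \<in> S" and "0 < e"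
  obtain Q where Q: "0 \<le> Q" "\<And>s. s \<in> {0..\<eta>} \<Longrightarrow> \<bar>q s\<bar> \<le> Q" using q_bounded[OF \<eta>] by metis
  define d where "d = e / (Q + 2)"
  have "d > 0" "d * (Q + 2) = e" using \<open>0 < e\<close> Q(1) by (auto simp: d_def)
  then have d: "d > 0" "d + Q * d < e" by (auto simp: algebra_simps)
  have "\<forall>\<^sub>F n in sequentially. \<forall>\<xi> t. (\<xi>, t) \<in> tri S \<alpha> \<beta> \<longrightarrow> \<xi> \<le> \<eta> \<longrightarrow> dist (V n \<xi> t) (W \<xi> t) < d"
    "\<forall>\<^sub>F n in sequentially. \<forall>\<xi> t. (\<xi>, t) \<in> tri S \<alpha> \<beta> \<longrightarrow> \<xi> \<le> \<eta> \<longrightarrow> dist (Vt n \<xi> t) (Wt \<xi> t) < d"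
    using V Vt \<eta> d(1) by (simp_all add: truncated_uniform_limit_iff)
  then show "\<forall>\<^sub>F n in sequentially. \<forall>\<xi> t. (\<xi>, t) \<in> tri S \<alpha> \<beta> \<longrightarrow> \<xi> \<le> \<eta> \<longrightarrow>
      dist (vekua_rhs q \<xi> (V n \<xi> t) (Vt n \<xi> t)) (vekua_rhs q \<xi> (W \<xi> t) (Wt \<xi> t)) < e"
  proof (eventually_elim, intro allI impI)
    fix n \<xi> t
    assume close: "\<forall>\<xi> t. (\<xi>, t) \<in> tri S \<alpha> \<beta> \<longrightarrow> \<xi> \<le> \<eta> \<longrightarrow> dist (V n \<xi> t) (W \<xi> t) < d"
      "\<forall>\<xi> t. (\<xi>, t) \<in> tri S \<alpha> \<beta> \<longrightarrow> \<xi> \<le> \<eta> \<longrightarrow> dist (Vt n \<xi> t) (Wt \<xi> t) < d"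
      and pt: "(\<xi>, t) \<in> tri S \<alpha> \<beta>" "\<xi> \<le> \<eta>"
    have "dist (vekua_rhs q \<xi> (V n \<xi> t) (Vt n \<xi> t)) (vekua_rhs q \<xi> (W \<xi> t) (Wt \<xi> t)) =
        norm (vekua_rhs q \<xi> (V n \<xi> t - W \<xi> t) (Vt n \<xi> t - Wt \<xi> t))"
      using vekua_rhs_add_scaleR[of q \<xi> "V n \<xi> t" "- 1" "W \<xi> t" "Vt n \<xi> t" "Wt \<xi> t"] by (simp add: dist_norm)
    also have "\<dots> \<le> norm (Vt n \<xi> t - Wt \<xi> t) + \<bar>q \<xi>\<bar> * norm (V n \<xi> t - W \<xi> t)"
      by (rule norm_vekua_rhs_le)
    also have "\<dots> \<le> d + Q * d"
      using close pt Q by (intro add_mono mult_mono) (auto simp: dist_norm less_imp_le mem_tri)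
    finally show "dist (vekua_rhs q \<xi> (V n \<xi> t) (Vt n \<xi> t)) (vekua_rhs q \<xi> (W \<xi> t) (Wt \<xi> t)) < e"
      using d(2) by simp
  qed
qed

lemma truncated_uniform_limit_deriv_\<xi>:
  assumes V: "\<And>n. solution \<alpha> \<beta> (V n) (Vt n)"
    and lim: "truncated_uniform_limit \<alpha> \<beta> V W" "truncated_uniform_limit \<alpha> \<beta> Vt Wt"
    and pt: "(\<xi>, t) \<in> tri_int S \<alpha> \<beta>"
  shows "((\<lambda>s. W s t) has_vector_derivative vekua_rhs q \<xi> (W \<xi> t) (Wt \<xi> t)) (at \<xi>)"
proof -
  have \<xi>: "\<xi> \<in> S" "0 < \<xi>" "\<alpha> < t - \<xi>" "t + \<xi> < \<beta>" using pt by (auto simp: mem_tri_int)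
  obtain \<eta> where \<eta>: "\<eta> \<in> S" "\<xi> < \<eta>" using S_open \<xi>(1) by blast
  let ?I = "{0<..<min \<eta> (min (t - \<alpha>) (\<beta> - t))}"
  have interior: "(s, t) \<in> tri_int S \<alpha> \<beta>" "s \<le> \<eta>" if "s \<in> ?I" for s
    using that S_down[OF \<eta>(1), of s] by (auto simp: mem_tri_int)
  have rhs_limit: "uniform_limit ?I (\<lambda>n s. vekua_rhs q s (V n s t) (Vt n s t))
      (\<lambda>s. vekua_rhs q s (W s t) (Wt s t)) sequentially"
    by (rule truncated_uniform_limit_slice[OF truncated_uniform_limit_rhs[OF lim] \<eta>(1)])
       (use interior tri_int_subset in blast)
  show ?thesis
  proof (rule has_vector_derivative_uniform_limit[OF _ _ _ _ rhs_limit])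
    show "open ?I" "convex ?I" "\<xi> \<in> ?I" using \<xi> \<eta> by auto
    show "((\<lambda>s. V n s t) has_vector_derivative vekua_rhs q s (V n s t) (Vt n s t)) (at s)" if "s \<in> ?I" for n s
      by (rule classical_solution_deriv_x[OF V interior(1)[OF that]])
    show "(\<lambda>n. V n s t) \<longlonglongrightarrow> W s t" if "s \<in> ?I" for s
      using truncated_uniform_limit_tendsto[OF lim(1)] interior(1)[OF that] tri_int_subset by blast
  qed
qed

theorem solution_limit:
  assumes V: "\<And>n. solution \<alpha> \<beta> (V n) (Vt n)" and Vt: "\<And>n. solution \<alpha> \<beta> (Vt n) (Vtt n)"
    and initial: "uniform_limit {\<alpha>..\<beta>} (\<lambda>n. V n 0) W\<^sub>0 sequentially"
      "uniformly_convergent_on {\<alpha>..\<beta>} (\<lambda>n. Vt n 0)"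
  shows "\<exists>W Wt. solution \<alpha> \<beta> W Wt \<and> (\<forall>t\<in>{\<alpha>..\<beta>}. W 0 t = W\<^sub>0 t)"
proof -
  obtain W where W: "truncated_uniform_limit \<alpha> \<beta> V W"
    using solutions_truncated_uniform_limit[OF V uniformly_convergentI[OF initial(1)]] .
  obtain Wt where Wt: "truncated_uniform_limit \<alpha> \<beta> Vt Wt"
    using solutions_truncated_uniform_limit[OF Vt initial(2)] .
  have "solution \<alpha> \<beta> W Wt"
  proof (rule classical_solutionI)
    show "continuous_on (tri S \<alpha> \<beta>) (\<lambda>(\<xi>, t). W \<xi> t)"
      by (rule truncated_uniform_limit_continuous[OF W classical_solution_continuous[OF V]])
    show "continuous_on (tri_int S \<alpha> \<beta>) (\<lambda>(\<xi>, t). Wt \<xi> t)"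
      using truncated_uniform_limit_continuous[OF Wt classical_solution_continuous[OF Vt]] tri_int_subset
      by (rule continuous_on_subset)
  qed (fact truncated_uniform_limit_deriv_\<xi>[OF V W Wt] truncated_uniform_limit_deriv_t[OF V W Wt])+
  moreover have "W 0 t = W\<^sub>0 t" if t: "t \<in> {\<alpha>..\<beta>}" for t
  proof (rule LIMSEQ_unique)
    show "(\<lambda>n. V n 0 t) \<longlonglongrightarrow> W 0 t"
      by (rule truncated_uniform_limit_tendsto[OF W]) (use t zero_S in \<open>simp add: mem_tri\<close>)
    show "(\<lambda>n. V n 0 t) \<longlonglongrightarrow> W\<^sub>0 t" by (rule tendsto_uniform_limitI[OF initial(1) t])
  qed
  ultimately show ?thesis by blast
qed

end

section \<open>Formal powers and existence\<close>

lemma phi_0: "phi f 0 \<xi> = f \<xi>" and psi_0: "psi f 0 \<xi> = 1 / f \<xi>"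
  by (simp_all add: phi_def psi_def)

lemma phi_Suc: "phi f (Suc j) \<xi> = f \<xi> * (real (Suc j) * integral {0..\<xi>} (\<lambda>s. psi f j s / f s))"
  by (simp add: phi_def psi_def power2_eq_square)

lemma psi_Suc: "psi f (Suc j) \<xi> = real (Suc j) * integral {0..\<xi>} (\<lambda>s. phi f j s * f s) / f \<xi>"
  by (simp add: phi_def psi_def power2_eq_square mult_ac)

definition formal_power :: "(real \<Rightarrow> real) \<Rightarrow> nat \<Rightarrow> real \<Rightarrow> bicomplex" where
  "formal_power f j \<xi> = (of_real (phi f j \<xi>), of_real (psi f j \<xi>))"

definition taylor_coeff :: "complex poly \<Rightarrow> nat \<Rightarrow> real \<Rightarrow> complex" where
  "taylor_coeff G j t = poly ((pderiv ^^ j) G) (of_real t) / fact j"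

lemma taylor_coeff_eq_0: "degree G < j \<Longrightarrow> taylor_coeff G j t = 0"
proof -
  assume "degree G < j"
  then have "(pderiv ^^ j) G = 0" by (intro poly_eqI) (simp add: coeff_higher_pderiv coeff_eq_0)
  then show ?thesis by (simp add: taylor_coeff_def)
qed

lemma taylor_coeff_add: "taylor_coeff (G + H) j t = taylor_coeff G j t + taylor_coeff H j t"
  and taylor_coeff_smult: "taylor_coeff (smult c G) j t = taylor_coeff G j t * c"
  by (simp_all add: taylor_coeff_def higher_pderiv_add higher_pderiv_smult add_divide_distrib)

lemma taylor_coeff_at_0: "taylor_coeff G j 0 = coeff G j"
  by (simp add: taylor_coeff_def poly_0_coeff_0 coeff_higher_pderiv pochhammer_fact[symmetric])

lemma taylor_coeff_pderiv: "taylor_coeff (pderiv G) j t = of_nat (Suc j) * taylor_coeff G (Suc j) t"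
  by (simp add: taylor_coeff_def funpow_swap1 field_simps del: of_nat_Suc)

lemma taylor_coeff_deriv: "(taylor_coeff G j has_vector_derivative taylor_coeff (pderiv G) j t) (at t)"
  using has_vector_derivative_divide[OF has_vector_derivative_poly_of_real[of "(pderiv ^^ j) G" t UNIV],
      of "fact j"]
  by (simp add: taylor_coeff_def[abs_def] funpow_swap1)

definition poly_solution :: "(real \<Rightarrow> real) \<Rightarrow> complex poly \<Rightarrow> real \<Rightarrow> real \<Rightarrow> bicomplex" where
  "poly_solution f G \<xi> t = (1 / 2) *\<^sub>R (\<Sum>j\<le>degree G. formal_power f j \<xi> \<odot> taylor_coeff G j t)"

lemma bc_scale_zero [simp]: "w \<odot> 0 = 0"
  by (simp add: bc_simps zero_prod_def)

lemma bc_scale_add: "w \<odot> (y + z) = w \<odot> y + w \<odot> z"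
  and bc_scale_mult: "w \<odot> (y * z) = (w \<odot> y) \<odot> z"
  by (simp_all add: bc_simps algebra_simps)

lemma poly_solution_eq_sum:
  assumes "degree G \<le> n"
  shows "poly_solution f G \<xi> t = (1 / 2) *\<^sub>R (\<Sum>j\<le>n. formal_power f j \<xi> \<odot> taylor_coeff G j t)"
proof -
  have "(\<Sum>j\<le>degree G. formal_power f j \<xi> \<odot> taylor_coeff G j t) =
      (\<Sum>j\<le>n. formal_power f j \<xi> \<odot> taylor_coeff G j t)"
    using assms by (intro sum.mono_neutral_left) (auto simp: taylor_coeff_eq_0)
  then show ?thesis by (simp add: poly_solution_def)
qed

lemma poly_solution_add: "poly_solution f (G + H) \<xi> t = poly_solution f G \<xi> t + poly_solution f H \<xi> t"
proof -
  have "degree (G + H) \<le> max (degree G) (degree H)" by (rule degree_add_le_max)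
  then show ?thesis
    by (subst (1 2 3) poly_solution_eq_sum[where n = "max (degree G) (degree H)"])
       (auto simp: taylor_coeff_add bc_scale_add sum.distrib scaleR_add_right)
qed

lemma poly_solution_smult: "poly_solution f (smult c G) \<xi> t = poly_solution f G \<xi> t \<odot> c"
  by (subst poly_solution_eq_sum[OF degree_smult_le])
     (simp add: poly_solution_def taylor_coeff_smult bc_scale_mult
        bounded_bilinear.sum_left[OF bounded_bilinear_bc_mult]
        bounded_bilinear.scaleR_left[OF bounded_bilinear_bc_mult])

lemma poly_solution_sum_smult:
  fixes N :: nat
  shows "poly_solution f (\<Sum>n<N. smult (c n) (G n)) \<xi> t = (\<Sum>n<N. poly_solution f (G n) \<xi> t \<odot> c n)"
proof (induction N)
  case 0
  then show ?case by (simp add: poly_solution_def taylor_coeff_def)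
next
  case (Suc N)
  then show ?case by (simp add: poly_solution_add poly_solution_smult)
qed

lemma poly_solution_at_center:
  assumes "degree G \<le> n"
  shows "poly_solution f G \<xi> 0 = (1 / 2) *\<^sub>R (\<Sum>j\<le>n. formal_power f j \<xi> \<odot> coeff G j)"
  by (simp add: poly_solution_eq_sum[OF assms] taylor_coeff_at_0)

lemma poly_solution_deriv_t:
  "(poly_solution f G \<xi> has_vector_derivative poly_solution f (pderiv G) \<xi> t) (at t)"
proof -
  have "degree (pderiv G) \<le> degree G" by (simp add: degree_pderiv)
  note poly_solution_eq_sum[OF this]
  then show ?thesis
    unfolding poly_solution_def[of f G, abs_def]
    by (simp only:) (intro bounded_linear.has_vector_derivative[OF bounded_linear_scaleR_right]
        has_vector_derivative_sum bounded_linear.has_vector_derivative[OF bounded_linear_bc_mult_right]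
        bounded_linear.has_vector_derivative[OF bounded_linear_bc_of_complex] taylor_coeff_deriv)
qed

lemma vekua_rhs_bc_scale: "vekua_rhs q \<xi> (w \<odot> z) (wt \<odot> z) = vekua_rhs q \<xi> w wt \<odot> z"
  by (simp add: vekua_rhs_def bc_simps algebra_simps)

lemma vekua_rhs_scaleR: "vekua_rhs q \<xi> (a *\<^sub>R w) (a *\<^sub>R wt) = a *\<^sub>R vekua_rhs q \<xi> w wt"
  using vekua_rhs_add_scaleR[of q \<xi> 0 a w 0 wt] by (simp add: vekua_rhs_def bc_simps)

lemma vekua_rhs_sum: "vekua_rhs q \<xi> (sum w A) (sum wt A) = (\<Sum>j\<in>A. vekua_rhs q \<xi> (w j) (wt j))"
proof (induction A rule: infinite_finite_induct)
  case (insert j A)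
  then show ?case using vekua_rhs_add_scaleR[of q \<xi> "w j" 1 "sum w A" "wt j" "sum wt A"] by simp
qed (simp_all add: vekua_rhs_def bc_simps zero_prod_def)

lemma sum_lowered_formal_powers:
  "(1 / 2) *\<^sub>R (\<Sum>j\<le>degree G. (real j *\<^sub>R formal_power f (j - 1) \<xi>) \<odot> taylor_coeff G j t) =
   poly_solution f (pderiv G) \<xi> t"
proof (cases "degree G")
  case 0
  then show ?thesis
    by (simp add: poly_solution_def pderiv_eq_0_iff[THEN iffD2] taylor_coeff_def bc_simps zero_prod_def)
next
  case (Suc m)
  have "(real (Suc j) *\<^sub>R formal_power f j \<xi>) \<odot> taylor_coeff G (Suc j) t =
      formal_power f j \<xi> \<odot> taylor_coeff (pderiv G) j t" for j
    by (simp add: taylor_coeff_pderiv bc_simps scaleR_conv_of_real mult_ac del: of_nat_Suc)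
  moreover have "(real 0 *\<^sub>R w) \<odot> z = 0" for w z by (simp add: bc_simps zero_prod_def)
  ultimately show ?thesis
    unfolding Suc sum.atMost_Suc_shift using Suc
    by (simp add: poly_solution_eq_sum[where n = m] degree_pderiv del: of_nat_Suc)
qed

locale vekua_coefficient = half_open_interval S for S :: "real set" +
  fixes f f' :: "real \<Rightarrow> real"
  assumes cont_f: "continuous_on S f" and cont_f': "continuous_on S f'"
    and deriv_f: "\<xi> \<in> S \<Longrightarrow> 0 < \<xi> \<Longrightarrow> (f has_real_derivative f' \<xi>) (at \<xi>)"
    and f_nonzero: "\<xi> \<in> S \<Longrightarrow> f \<xi> \<noteq> 0"
    and f_zero: "f 0 = 1"
begin

sublocale vekua_system S "\<lambda>\<xi>. f' \<xi> / f \<xi>"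
  by unfold_locales (intro continuous_intros cont_f cont_f', simp add: f_nonzero)

lemma phi_psi_continuous: "continuous_on S (phi f j) \<and> continuous_on S (psi f j)"
proof (induction j)
  case 0
  then show ?case
    unfolding phi_0[abs_def] psi_0[abs_def] by (auto intro!: continuous_intros cont_f simp: f_nonzero)
next
  case (Suc j)
  then show ?case
    unfolding phi_Suc[abs_def] psi_Suc[abs_def]
    by (auto intro!: continuous_intros continuous_on_indefinite_integral cont_f simp: f_nonzero)
qed

lemma formal_power_continuous: "continuous_on S (formal_power f j)"
  unfolding formal_power_def[abs_def] using phi_psi_continuous[of j]
  by (auto intro!: continuous_on_Pair continuous_on_of_real)

lemma formal_power_at_0: "formal_power f j 0 = (if j = 0 then (1, 1) else 0)"
  by (cases j) (simp_all add: formal_power_def phi_0 psi_0 phi_Suc psi_Suc f_zero zero_prod_def)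

lemma phi_deriv:
  assumes "\<xi> \<in> S" "0 < \<xi>"
  shows "(phi f j has_real_derivative real j * psi f (j - 1) \<xi> + f' \<xi> / f \<xi> * phi f j \<xi>) (at \<xi>)"
proof (cases j)
  case 0
  then show ?thesis using deriv_f[OF assms] f_nonzero[OF assms(1)] by (simp add: phi_0[abs_def])
next
  case (Suc i)
  have "continuous_on S (\<lambda>s. psi f i s / f s)"
    using phi_psi_continuous[of i] by (auto intro!: continuous_intros cont_f simp: f_nonzero)
  from DERIV_mult[OF deriv_f[OF assms]
      DERIV_cmult[OF DERIV_indefinite_integral[OF this assms], of "real (Suc i)"]]
  show ?thesis
    unfolding Suc phi_Suc[abs_def] by (rule DERIV_cong) (use f_nonzero[OF assms(1)] in \<open>simp add: field_simps\<close>)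
qed

lemma psi_deriv:
  assumes "\<xi> \<in> S" "0 < \<xi>"
  shows "(psi f j has_real_derivative real j * phi f (j - 1) \<xi> - f' \<xi> / f \<xi> * psi f j \<xi>) (at \<xi>)"
proof (cases j)
  case 0
  have "((\<lambda>\<xi>. 1 / f \<xi>) has_real_derivative - (f' \<xi> / f \<xi> * (1 / f \<xi>))) (at \<xi>)"
    using deriv_f[OF assms] f_nonzero[OF assms(1)] by (auto intro!: derivative_eq_intros)
  then show ?thesis by (simp add: 0 psi_0[abs_def])
next
  case (Suc i)
  have "continuous_on S (\<lambda>s. phi f i s * f s)"
    using phi_psi_continuous[of i] by (auto intro!: continuous_intros cont_f)
  from DERIV_divide[OF DERIV_cmult[OF DERIV_indefinite_integral[OF this assms], of "real (Suc i)"]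
      deriv_f[OF assms] f_nonzero[OF assms(1)]]
  show ?thesis
    unfolding Suc psi_Suc[abs_def] by (rule DERIV_cong) (use f_nonzero[OF assms(1)] in \<open>simp add: field_simps\<close>)
qed

lemma formal_power_deriv:
  assumes "\<xi> \<in> S" "0 < \<xi>"
  shows "(formal_power f j has_vector_derivative
     vekua_rhs (\<lambda>\<xi>. f' \<xi> / f \<xi>) \<xi> (formal_power f j \<xi>) (real j *\<^sub>R formal_power f (j - 1) \<xi>)) (at \<xi>)"
proof -
  have "(formal_power f j has_vector_derivative
      (of_real (real j * psi f (j - 1) \<xi> + f' \<xi> / f \<xi> * phi f j \<xi>),
       of_real (real j * phi f (j - 1) \<xi> - f' \<xi> / f \<xi> * psi f j \<xi>))) (at \<xi>)"
    unfolding formal_power_def[abs_def] using phi_deriv[OF assms] psi_deriv[OF assms]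
    by (intro has_vector_derivative_Pair has_vector_derivative_of_real)
       (simp_all add: has_real_derivative_iff_has_vector_derivative)
  then show ?thesis
    by (simp add: vekua_rhs_def formal_power_def bc_simps scaleR_conv_of_real)
qed

lemma poly_solution_deriv_\<xi>:
  assumes "\<xi> \<in> S" "0 < \<xi>"
  shows "((\<lambda>s. poly_solution f G s t) has_vector_derivative
     vekua_rhs (\<lambda>\<xi>. f' \<xi> / f \<xi>) \<xi> (poly_solution f G \<xi> t) (poly_solution f (pderiv G) \<xi> t)) (at \<xi>)"
proof -
  have "((\<lambda>s. poly_solution f G s t) has_vector_derivative (1 / 2) *\<^sub>R (\<Sum>j\<le>degree G.
      vekua_rhs (\<lambda>\<xi>. f' \<xi> / f \<xi>) \<xi> (formal_power f j \<xi>) (real j *\<^sub>R formal_power f (j - 1) \<xi>)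
        \<odot> taylor_coeff G j t)) (at \<xi>)"
    unfolding poly_solution_def
    by (intro bounded_linear.has_vector_derivative[OF bounded_linear_scaleR_right] has_vector_derivative_sum
        bounded_linear.has_vector_derivative[OF bounded_linear_bc_mult_left] formal_power_deriv assms)
  then show ?thesis
    unfolding sum_lowered_formal_powers[symmetric]
    by (simp add: poly_solution_def vekua_rhs_sum vekua_rhs_scaleR vekua_rhs_bc_scale)
qed

lemma poly_solution_continuous:
  assumes "D \<subseteq> S \<times> UNIV"
  shows "continuous_on D (\<lambda>(\<xi>, t). poly_solution f G \<xi> t)"
proof -
  have "continuous_on D (\<lambda>z. formal_power f j (fst z))" for j
    by (rule continuous_on_compose2[OF formal_power_continuous]) (use assms in \<open>auto intro!: continuous_intros\<close>)
  then show ?thesis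
    unfolding poly_solution_def taylor_coeff_def case_prod_beta by (intro continuous_intros) auto
qed

lemma solution_poly_solution: "solution \<alpha> \<beta> (poly_solution f G) (poly_solution f (pderiv G))"
proof (rule classical_solutionI)
  fix \<xi> t assume "(\<xi>, t) \<in> tri_int S \<alpha> \<beta>"
  then show "((\<lambda>s. poly_solution f G s t) has_vector_derivative
      vekua_rhs (\<lambda>\<xi>. f' \<xi> / f \<xi>) \<xi> (poly_solution f G \<xi> t) (poly_solution f (pderiv G) \<xi> t)) (at \<xi>)"
    by (intro poly_solution_deriv_\<xi>) (auto simp: mem_tri_int)
qed (auto simp: tri_def tri_int_def intro!: poly_solution_continuous poly_solution_deriv_t)

lemma poly_solution_initial: "poly_solution f G 0 t = of_plus (poly G (of_real t))"
proof -
  have "(\<Sum>j\<le>degree G. formal_power f j 0 \<odot> taylor_coeff G j t) =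
      (\<Sum>j\<in>{0}. formal_power f j 0 \<odot> taylor_coeff G j t)"
    by (rule sum.mono_neutral_right) (auto simp: formal_power_at_0 bc_simps zero_prod_def)
  then show ?thesis by (simp add: poly_solution_def of_plus_eq formal_power_at_0 taylor_coeff_def bc_simps)
qed

lemma solution_exists_plus_data:
  assumes "C1_on {\<alpha>..\<beta>} g"
  shows "\<exists>W Wt. solution \<alpha> \<beta> W Wt \<and> (\<forall>t\<in>{\<alpha>..\<beta>}. W 0 t = of_plus (g t))"
proof -
  obtain G :: "nat \<Rightarrow> complex poly" and g' where G:
    "uniform_limit {\<alpha>..\<beta>} (\<lambda>n x. poly (G n) (of_real x)) g sequentially"
    "uniform_limit {\<alpha>..\<beta>} (\<lambda>n x. poly (pderiv (G n)) (of_real x)) g' sequentially"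
    using C1_polynomial_uniform_limit[OF assms] .
  show ?thesis
  proof (rule solution_limit[OF solution_poly_solution solution_poly_solution])
    show "uniform_limit {\<alpha>..\<beta>} (\<lambda>n. poly_solution f (G n) 0) (\<lambda>t. of_plus (g t)) sequentially"
      unfolding poly_solution_initial[abs_def]
      by (rule bounded_linear.uniform_limit[OF bounded_linear_of_plus G(1)])
    have "uniform_limit {\<alpha>..\<beta>} (\<lambda>n. poly_solution f (pderiv (G n)) 0) (\<lambda>t. of_plus (g' t)) sequentially"
      unfolding poly_solution_initial[abs_def]
      by (rule bounded_linear.uniform_limit[OF bounded_linear_of_plus G(2)])
    then show "uniformly_convergent_on {\<alpha>..\<beta>} (\<lambda>n. poly_solution f (pderiv (G n)) 0)"
      by (rule uniformly_convergentI)
  qed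
qed

theorem solution_exists:
  assumes W0: "C1_on {\<alpha>..\<beta>} W0"
  shows "\<exists>W Wt. solution \<alpha> \<beta> W Wt \<and> (\<forall>t\<in>{\<alpha>..\<beta>}. W 0 t = W0 t)"
proof -
  define c where "c = \<alpha> + \<beta>"
  obtain V Vt where V: "solution \<alpha> \<beta> V Vt" "\<And>t. t \<in> {\<alpha>..\<beta>} \<Longrightarrow> V 0 t = of_plus (bc_plus (W0 t))"
    using solution_exists_plus_data[OF C1_on_bounded_linear[OF bounded_linear_bc_plus W0]] by blast
  have "C1_on {\<alpha>..\<beta>} (\<lambda>t. bc_minus (W0 (c + - 1 * t)))"
    by (rule C1_on_affine[OF C1_on_bounded_linear[OF bounded_linear_bc_minus W0]]) (auto simp: c_def)
  then obtain U Ut where U: "solution \<alpha> \<beta> U Ut" "\<And>t. t \<in> {\<alpha>..\<beta>} \<Longrightarrow> U 0 t = of_plus (bc_minus (W0 (c - t)))"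
    using solution_exists_plus_data by fastforce
  have "solution \<alpha> \<beta> (reflection c U) (\<lambda>\<xi> t. - reflection c Ut \<xi> t)"
    using solution_reflection[OF U(1), of c] by (simp add: c_def)
  from solution_add[OF V(1) this]
  have "solution \<alpha> \<beta> (\<lambda>\<xi> t. V \<xi> t + reflection c U \<xi> t) (\<lambda>\<xi> t. Vt \<xi> t + - reflection c Ut \<xi> t)" .
  moreover have "V 0 t + reflection c U 0 t = W0 t" if "t \<in> {\<alpha>..\<beta>}" for t
    using V(2)[OF that] U(2)[of "c - t"] that by (simp add: reflection_def c_def of_plus_decomposition)
  ultimately show ?thesis by blast
qed

end

section \<open>The series representation\<close>

definition legendre_scaled :: "real \<Rightarrow> nat \<Rightarrow> complex poly" where
  "legendre_scaled \<xi> n = pcompose (map_poly of_real (legendre n)) [:0, of_real (1 / \<xi>):]"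

lemma poly_legendre_scaled: "poly (legendre_scaled \<xi> n) (of_real \<tau>) = of_real (Leg n (\<tau> / \<xi>))"
  by (simp add: legendre_scaled_def poly_pcompose flip: of_real_mult of_real_divide poly_map_poly_of_real)

lemma coeff_legendre_scaled: "coeff (legendre_scaled \<xi> n) k = of_real (coeff (legendre n) k / \<xi> ^ k)"
  by (simp add: legendre_scaled_def coeff_pcompose_linear coeff_map_poly power_divide)

lemma degree_legendre_scaled: "degree (legendre_scaled \<xi> n) \<le> n"
proof -
  have "degree (legendre_scaled \<xi> n) \<le> degree (map_poly (of_real :: real \<Rightarrow> complex) (legendre n)) * 1"
    unfolding legendre_scaled_def
    by (intro order.trans[OF degree_pcompose_le] mult_left_mono) auto
  then show ?thesis using legendre_degree_le[of n] by (simp add: degree_map_poly)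
qed

definition ab_coef :: "(real \<Rightarrow> real) \<Rightarrow> nat \<Rightarrow> real \<Rightarrow> bicomplex" where
  "ab_coef f n \<xi> = (of_real (acoef f n \<xi>), of_real (bcoef f n \<xi>))"

text \<open>The coefficients \<open>a\<^sub>n\<close>, \<open>b\<^sub>n\<close> measure by how much the solution with Legendre data
  differs from the free wave.\<close>

lemma poly_solution_legendre_scaled:
  assumes "0 < \<xi>"
  shows "poly_solution f (legendre_scaled \<xi> n) \<xi> 0 - of_plus (poly (legendre_scaled \<xi> n) (of_real \<xi>)) =
    (1 / (2 * real n + 1)) *\<^sub>R ab_coef f n \<xi>"
proof -
  define s where "s Y = (\<Sum>k\<le>n. coeff (legendre n) k * Y k \<xi> / \<xi> ^ k)" for Y :: "nat \<Rightarrow> real \<Rightarrow> real"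
  have "ab_coef f n \<xi> = (2 * real n + 1) *\<^sub>R (of_real ((s (phi f) - 1) / 2), of_real ((s (psi f) - 1) / 2))"
    by (simp add: ab_coef_def acoef_def bcoef_def s_def scaleR_conv_of_real)
  then have "(1 / (2 * real n + 1)) *\<^sub>R ab_coef f n \<xi> =
      (of_real ((s (phi f) - 1) / 2), of_real ((s (psi f) - 1) / 2))"
    by (simp only: scaleR_scaleR) (simp add: add_eq_0_iff_both_eq_0)
  moreover have "poly_solution f (legendre_scaled \<xi> n) \<xi> 0 =
      (1 / 2) *\<^sub>R (of_real (s (phi f)), of_real (s (psi f)))"
    by (simp add: poly_solution_at_center[OF degree_legendre_scaled] coeff_legendre_scaled formal_power_def
        s_def bc_simps sum_prod mult.commute)
  moreover have "poly (legendre_scaled \<xi> n) (of_real \<xi>) = 1"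
    using assms by (simp add: poly_legendre_scaled)
  ultimately show ?thesis by (simp add: of_plus_eq scaleR_conv_of_real diff_divide_distrib)
qed

definition legendre_partial_sum :: "real \<Rightarrow> (real \<Rightarrow> complex) \<Rightarrow> nat \<Rightarrow> complex poly" where
  "legendre_partial_sum \<xi> g N =
     (\<Sum>n<N. smult (of_real ((2 * real n + 1) / (2 * \<xi>)) * legendre_moment \<xi> g n) (legendre_scaled \<xi> n))"

lemma poly_solution_legendre_partial_sum:
  assumes "0 < \<xi>"
  shows "poly_solution f (legendre_partial_sum \<xi> g N) \<xi> 0 -
      of_plus (poly (legendre_partial_sum \<xi> g N) (of_real \<xi>)) =
    (1 / (2 * \<xi>)) *\<^sub>R (\<Sum>n<N. ab_coef f n \<xi> \<odot> legendre_moment \<xi> g n)"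
proof -
  define c where "c n = of_real ((2 * real n + 1) / (2 * \<xi>)) * legendre_moment \<xi> g n" for n
  define L where "L = legendre_scaled \<xi>"
  have "of_plus (poly (\<Sum>n<N. smult (c n) (L n)) (of_real \<xi>)) =
      (\<Sum>n<N. of_plus (poly (L n) (of_real \<xi>)) \<odot> c n)"
    by (simp add: poly_sum of_plus_eq bc_simps sum_prod scaleR_sum_right mult.commute)
  then have "poly_solution f (legendre_partial_sum \<xi> g N) \<xi> 0 -
        of_plus (poly (legendre_partial_sum \<xi> g N) (of_real \<xi>)) =
      (\<Sum>n<N. (poly_solution f (L n) \<xi> 0 - of_plus (poly (L n) (of_real \<xi>))) \<odot> c n)"
    unfolding legendre_partial_sum_def c_def[symmetric] L_def[symmetric] poly_solution_sum_smult
    by (simp add: bounded_bilinear.diff_left[OF bounded_bilinear_bc_mult] sum_subtractf)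
  also have "\<dots> = (\<Sum>n<N. (1 / (2 * \<xi>)) *\<^sub>R (ab_coef f n \<xi> \<odot> legendre_moment \<xi> g n))"
  proof (rule sum.cong[OF refl])
    fix n
    have "(a *\<^sub>R w) \<odot> (of_real b * z) = (a * b) *\<^sub>R (w \<odot> z)" for a b w z
      by (simp add: bc_simps scaleR_conv_of_real)
    moreover have "1 / (2 * real n + 1) * ((2 * real n + 1) / (2 * \<xi>)) = 1 / (2 * \<xi>)"
      using assms by (simp add: add_eq_0_iff_both_eq_0)
    ultimately show "(poly_solution f (L n) \<xi> 0 - of_plus (poly (L n) (of_real \<xi>))) \<odot> c n =
        (1 / (2 * \<xi>)) *\<^sub>R (ab_coef f n \<xi> \<odot> legendre_moment \<xi> g n)"
      unfolding L_def poly_solution_legendre_scaled[OF assms] c_def by (simp only:)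
  qed
  finally show ?thesis by (simp add: scaleR_sum_right)
qed

lemma legendre_partial_sum_L1_convergence:
  assumes "0 < \<xi>" "continuous_on {-\<xi>..\<xi>} g"
  shows "(\<lambda>N. integral {-\<xi>..\<xi>} (\<lambda>\<tau>. norm (g \<tau> - poly (legendre_partial_sum \<xi> g N) (of_real \<tau>)))) \<longlonglongrightarrow> 0"
  using legendre_series_L1_convergence[OF assms]
  by (simp add: legendre_partial_sum_def poly_sum poly_legendre_scaled mult.assoc)

lemma norm_le_defect_plus_data:
  assumes "W 0 (t + \<xi>) = of_plus z" "W 0 (t - \<xi>) = of_plus z'"
  shows "norm (W \<xi> t - of_plus z) \<le> 2 * defect W \<xi> t"
proof -
  have "bc_plus (W \<xi> t - of_plus z) = plus_defect W \<xi> t" "bc_minus (W \<xi> t - of_plus z) = minus_defect W \<xi> t"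
    by (simp_all add: plus_defect_def minus_defect_def assms
        linear_diff[OF bounded_linear.linear[OF bounded_linear_bc_plus]]
        linear_diff[OF bounded_linear.linear[OF bounded_linear_bc_minus]])
  then show ?thesis
    using norm_le_bc_plus_minus[of "W \<xi> t - of_plus z"] by (simp add: defect_def)
qed

lemma termA2_eq:
  "termA2 f W0 \<xi> t n = ab_coef f n \<xi> \<odot> legendre_moment \<xi> (\<lambda>\<tau>. bc_plus (W0 (t + \<tau>))) n"
  by (simp add: termA2_def ab_coef_def legendre_moment_def bc_simps)

lemma termB2_eq:
  "termB2 f W0 \<xi> t n = bc_conj (ab_coef f n \<xi> \<odot> legendre_moment \<xi> (\<lambda>\<tau>. bc_minus (W0 (t - \<tau>))) n)"
  by (simp add: termB2_def ab_coef_def legendre_moment_def bc_simps)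

lemma terms1_eq_terms2:
  assumes \<xi>: "0 < \<xi>" and W0: "continuous_on {t - \<xi>..t + \<xi>} W0"
  shows "termA1 f W0 \<xi> t n = fst ((1 / \<xi>) *\<^sub>R (termA2 f W0 \<xi> t n + termB2 f W0 \<xi> t n))"
    and "termB1 f W0 \<xi> t n = snd ((1 / \<xi>) *\<^sub>R (termA2 f W0 \<xi> t n + termB2 f W0 \<xi> t n))"
proof -
  have "continuous_on {-\<xi>..\<xi>} (\<lambda>\<tau>. W0 (t + \<tau>))" "continuous_on {-\<xi>..\<xi>} (\<lambda>\<tau>. W0 (t - \<tau>))"
    by (auto intro!: continuous_on_compose2[OF W0] continuous_intros)
  then have plus: "(\<lambda>\<tau>. complex_of_real (Leg n (\<tau> / \<xi>)) * bc_plus (W0 (t + \<tau>))) integrable_on {-\<xi>..\<xi>}"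
    and minus: "(\<lambda>\<tau>. complex_of_real (Leg n (\<tau> / \<xi>)) * bc_minus (W0 (t - \<tau>))) integrable_on {-\<xi>..\<xi>}"
    using \<xi> by (auto intro!: integrable_continuous_real continuous_intros)
  show "termA1 f W0 \<xi> t n = fst ((1 / \<xi>) *\<^sub>R (termA2 f W0 \<xi> t n + termB2 f W0 \<xi> t n))"
    by (simp add: termA1_def termA2_eq termB2_eq ab_coef_def legendre_moment_def distrib_left
        bc_mult_def bc_of_complex_def bc_conj_def scaleR_conv_of_real
        Henstock_Kurzweil_Integration.integral_add[OF plus minus])
  show "termB1 f W0 \<xi> t n = snd ((1 / \<xi>) *\<^sub>R (termA2 f W0 \<xi> t n + termB2 f W0 \<xi> t n))"
    by (simp add: termB1_def termA2_eq termB2_eq ab_coef_def legendre_moment_def right_diff_distrib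
        bc_mult_def bc_of_complex_def bc_conj_def scaleR_conv_of_real
        Henstock_Kurzweil_Integration.integral_diff[OF plus minus])
qed

lemma vekua_formulas_agree:
  assumes \<xi>: "0 < \<xi>" and W0: "continuous_on {t - \<xi>..t + \<xi>} W0"
    and summable: "summable (termA2 f W0 \<xi> t)" "summable (termB2 f W0 \<xi> t)"
  shows "summable (termA1 f W0 \<xi> t)" "summable (termB1 f W0 \<xi> t)"
    and "vekua_formula1 f W0 \<xi> t = vekua_formula2 f W0 \<xi> t"
proof -
  define s where "s = (\<Sum>n. termA2 f W0 \<xi> t n) + (\<Sum>n. termB2 f W0 \<xi> t n)"
  have "(\<lambda>n. (1 / \<xi>) *\<^sub>R (termA2 f W0 \<xi> t n + termB2 f W0 \<xi> t n)) sums ((1 / \<xi>) *\<^sub>R s)"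
    unfolding s_def by (intro sums_scaleR_right sums_add summable_sums summable)
  from bounded_linear.sums[OF bounded_linear_fst this] bounded_linear.sums[OF bounded_linear_snd this]
  have sums1: "termA1 f W0 \<xi> t sums fst ((1 / \<xi>) *\<^sub>R s)" "termB1 f W0 \<xi> t sums snd ((1 / \<xi>) *\<^sub>R s)"
    by (simp_all only: terms1_eq_terms2[OF \<xi> W0, symmetric])
  then show "summable (termA1 f W0 \<xi> t)" "summable (termB1 f W0 \<xi> t)"
    by (auto simp: sums_iff)
  have "vekua_formula2 f W0 \<xi> t =
      of_plus (bc_plus (W0 (t + \<xi>))) + bc_conj (of_plus (bc_minus (W0 (t - \<xi>)))) + (1 / (2 * \<xi>)) *\<^sub>R s"
    by (simp add: vekua_formula2_def bc_Pm_mult s_def scaleR_add_right add.assoc flip: of_plus_def)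
  then show "vekua_formula1 f W0 \<xi> t = vekua_formula2 f W0 \<xi> t"
    unfolding vekua_formula1_def sums_unique[OF sums1(1), symmetric] sums_unique[OF sums1(2), symmetric]
    by (simp add: of_plus_eq bc_mult_def bc_of_complex_def bc_j_def bc_conj_def prod_eq_iff
        scaleR_conv_of_real field_simps)
qed

context vekua_system
begin

lemma plus_data_L1_bound:
  assumes sol: "solution \<alpha> \<beta> W Wt" and pt: "(\<xi>, t) \<in> tri S \<alpha> \<beta>"
    and Q: "0 \<le> Q" "\<And>s. s \<in> {0..\<xi>} \<Longrightarrow> \<bar>q s\<bar> \<le> Q"
    and initial: "\<And>s. s \<in> {t - \<xi>..t + \<xi>} \<Longrightarrow> W 0 s = of_plus (h s)"
  shows "norm (W \<xi> t - of_plus (h (t + \<xi>))) \<le>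
    2 * Q * exp (2 * Q * \<xi>) * integral {t - \<xi>..t + \<xi>} (\<lambda>s. norm (h s))"
proof -
  have plus: "integral {t - \<xi>..t + \<xi>} (\<lambda>s. norm (bc_plus (W 0 s))) = integral {t - \<xi>..t + \<xi>} (\<lambda>s. norm (h s))"
    by (rule Henstock_Kurzweil_Integration.integral_cong) (simp add: initial)
  have "integral {t - \<xi>..t + \<xi>} (\<lambda>s. norm (bc_minus (W 0 s))) = 0"
    by (intro integral_unique has_integral_is_0) (simp add: initial)
  moreover have "0 \<le> integral {t - \<xi>..t + \<xi>} (\<lambda>s. norm (bc_plus (W 0 s)))"
    by (rule integral_norm_nonneg)
  ultimately have "defect W \<xi> t \<le> Q * integral {t - \<xi>..t + \<xi>} (\<lambda>s. norm (h s)) * exp (2 * Q * \<xi>)"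
    using plus by (intro a_priori_bound[OF sol pt Q]) auto
  moreover have "norm (W \<xi> t - of_plus (h (t + \<xi>))) \<le> 2 * defect W \<xi> t"
    by (rule norm_le_defect_plus_data) (use pt in \<open>auto simp: mem_tri intro!: initial\<close>)
  ultimately show ?thesis by (simp add: mult_ac)
qed

end

context vekua_coefficient
begin

theorem plus_data_expansion:
  assumes \<xi>: "\<xi> \<in> S" "0 < \<xi>"
    and sol: "solution (-\<xi>) \<xi> W Wt" and initial: "\<And>t. t \<in> {-\<xi>..\<xi>} \<Longrightarrow> W 0 t = of_plus (g t)"
  shows "(\<lambda>n. ab_coef f n \<xi> \<odot> legendre_moment \<xi> g n) sums
    ((2 * \<xi>) *\<^sub>R (W \<xi> 0 - of_plus (g \<xi>)))"
proof -
  note of_plus_diff = linear_diff[OF bounded_linear.linear[OF bounded_linear_of_plus]]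
  define G where "G = legendre_partial_sum \<xi> g"
  define r where "r N = integral {-\<xi>..\<xi>} (\<lambda>\<tau>. norm (g \<tau> - poly (G N) (of_real \<tau>)))" for N
  define D where "D N \<eta> t = W \<eta> t - poly_solution f (G N) \<eta> t" for N \<eta> t
  have D: "solution (-\<xi>) \<xi> (D N) (\<lambda>\<eta> t. Wt \<eta> t - poly_solution f (pderiv (G N)) \<eta> t)" for N
    unfolding D_def[abs_def] by (rule solution_diff[OF sol solution_poly_solution])
  have D_initial: "D N 0 t = of_plus (g t - poly (G N) (of_real t))" if "t \<in> {-\<xi>..\<xi>}" for N t
    using initial[OF that] by (simp add: D_def poly_solution_initial of_plus_diff)
  obtain Q where Q: "0 \<le> Q" "\<And>s. s \<in> {0..\<xi>} \<Longrightarrow> \<bar>f' s / f s\<bar> \<le> Q" using q_bounded[OF \<xi>(1)] by metis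
  have apex: "(\<xi>, 0) \<in> tri S (-\<xi>) \<xi>" using \<xi> by (simp add: mem_tri)
  have bound: "norm (D N \<xi> 0 - of_plus (g \<xi> - poly (G N) (of_real \<xi>))) \<le> 2 * Q * exp (2 * Q * \<xi>) * r N" for N
    using plus_data_L1_bound[OF D apex Q, of N "\<lambda>\<tau>. g \<tau> - poly (G N) (of_real \<tau>)"] D_initial
    by (simp add: r_def)
  have "continuous_on {-\<xi>..\<xi>} (\<lambda>t. bc_plus (W 0 t))"
    by (intro continuous_intros solution_continuous_initial[OF sol])
  then have "continuous_on {-\<xi>..\<xi>} g" by (rule continuous_on_eq) (simp add: initial)
  from legendre_partial_sum_L1_convergence[OF \<xi>(2) this] have r_lim: "r \<longlonglongrightarrow> 0"
    by (simp add: r_def[abs_def] G_def)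
  have "(\<lambda>N. D N \<xi> 0 - of_plus (g \<xi> - poly (G N) (of_real \<xi>))) \<longlonglongrightarrow> 0"
    by (rule Lim_null_comparison[OF always_eventually[OF allI[OF bound]] tendsto_mult_right_zero[OF r_lim]])
  from tendsto_diff[OF tendsto_const[of "W \<xi> 0 - of_plus (g \<xi>)"] this]
  have "(\<lambda>N. poly_solution f (G N) \<xi> 0 - of_plus (poly (G N) (of_real \<xi>))) \<longlonglongrightarrow> W \<xi> 0 - of_plus (g \<xi>)"
    by (simp add: D_def of_plus_diff algebra_simps)
  from tendsto_scaleR[OF tendsto_const[of "2 * \<xi>"] this]
  show ?thesis
    using \<xi>(2) unfolding G_def poly_solution_legendre_partial_sum[OF \<xi>(2)] by (simp add: sums_def)
qed

lemma solution_split: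
  assumes sol: "solution \<alpha> \<beta> W Wt" and W0: "\<And>s. s \<in> {\<alpha>..\<beta>} \<Longrightarrow> W 0 s = W0 s" and C1: "C1_on {\<alpha>..\<beta>} W0"
    and \<xi>: "(\<xi>, t) \<in> tri S \<alpha> \<beta>"
  obtains V Vt U Ut where "solution (-\<xi>) \<xi> V Vt" "\<And>s. s \<in> {-\<xi>..\<xi>} \<Longrightarrow> V 0 s = of_plus (bc_plus (W0 (t + s)))"
    "solution (-\<xi>) \<xi> U Ut" "\<And>s. s \<in> {-\<xi>..\<xi>} \<Longrightarrow> U 0 s = of_plus (bc_minus (W0 (t - s)))"
    "W \<xi> t = V \<xi> 0 + bc_conj (U \<xi> 0)"
proof -
  have \<xi>S: "\<xi> \<in> S" "0 \<le> \<xi>" "\<alpha> \<le> t - \<xi>" "t + \<xi> \<le> \<beta>" using \<xi> by (auto simp: mem_tri)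
  have "C1_on {-\<xi>..\<xi>} (\<lambda>s. bc_plus (W0 (t + 1 * s)))"
    by (rule C1_on_affine[OF C1_on_bounded_linear[OF bounded_linear_bc_plus C1]]) (use \<xi>S in auto)
  then obtain V Vt where V: "solution (-\<xi>) \<xi> V Vt" "\<And>s. s \<in> {-\<xi>..\<xi>} \<Longrightarrow> V 0 s = of_plus (bc_plus (W0 (t + s)))"
    using solution_exists_plus_data[of "-\<xi>" \<xi> "\<lambda>s. bc_plus (W0 (t + s))"] by auto
  have "C1_on {-\<xi>..\<xi>} (\<lambda>s. bc_minus (W0 (t + - 1 * s)))"
    by (rule C1_on_affine[OF C1_on_bounded_linear[OF bounded_linear_bc_minus C1]]) (use \<xi>S in auto)
  then obtain U Ut where U: "solution (-\<xi>) \<xi> U Ut" "\<And>s. s \<in> {-\<xi>..\<xi>} \<Longrightarrow> U 0 s = of_plus (bc_minus (W0 (t - s)))"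
    using solution_exists_plus_data[of "-\<xi>" \<xi> "\<lambda>s. bc_minus (W0 (t - s))"] by auto
  have shifted: "solution (-\<xi>) \<xi> (\<lambda>\<eta> s. W \<eta> (t + s)) (\<lambda>\<eta> s. Wt \<eta> (t + s))"
    by (rule solution_subinterval[OF solution_shift[OF sol, of t]]) (use \<xi>S in auto)
  have "solution (-\<xi>) \<xi> (reflection 0 U) (\<lambda>\<eta> s. - reflection 0 Ut \<eta> s)"
    using solution_reflection[OF U(1), of 0] by simp
  note split = solution_add[OF V(1) this]
  have "W \<xi> (t + 0) = V \<xi> 0 + reflection 0 U \<xi> 0"
  proof (rule solution_unique[OF shifted split])
    show "W 0 (t + s) = V 0 s + reflection 0 U 0 s" if "s \<in> {-\<xi>..\<xi>}" for s
      using W0[of "t + s"] V(2)[OF that] U(2)[of "- s"] that \<xi>S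
      by (simp add: reflection_def of_plus_decomposition)
  qed (use \<xi>S in \<open>simp add: mem_tri\<close>)
  then show ?thesis using that[OF V U] by (simp add: reflection_def)
qed

theorem solution_formula:
  assumes sol: "solution \<alpha> \<beta> W Wt" and W0: "\<And>s. s \<in> {\<alpha>..\<beta>} \<Longrightarrow> W 0 s = W0 s" and C1: "C1_on {\<alpha>..\<beta>} W0"
    and pt: "(\<xi>, t) \<in> tri S \<alpha> \<beta>" "0 < \<xi>"
  shows "summable (termA1 f W0 \<xi> t) \<and> summable (termB1 f W0 \<xi> t) \<and>
         summable (termA2 f W0 \<xi> t) \<and> summable (termB2 f W0 \<xi> t) \<and>
         W \<xi> t = vekua_formula1 f W0 \<xi> t \<and> W \<xi> t = vekua_formula2 f W0 \<xi> t"
proof -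
  have \<xi>: "\<xi> \<in> S" "\<alpha> \<le> t - \<xi>" "t + \<xi> \<le> \<beta>" using pt by (auto simp: mem_tri)
  obtain V Vt U Ut where V: "solution (-\<xi>) \<xi> V Vt" "\<And>s. s \<in> {-\<xi>..\<xi>} \<Longrightarrow> V 0 s = of_plus (bc_plus (W0 (t + s)))"
    and U: "solution (-\<xi>) \<xi> U Ut" "\<And>s. s \<in> {-\<xi>..\<xi>} \<Longrightarrow> U 0 s = of_plus (bc_minus (W0 (t - s)))"
    and W: "W \<xi> t = V \<xi> 0 + bc_conj (U \<xi> 0)"
    using solution_split[OF sol W0 C1 pt(1)] by blast
  have sums_A2: "termA2 f W0 \<xi> t sums ((2 * \<xi>) *\<^sub>R (V \<xi> 0 - of_plus (bc_plus (W0 (t + \<xi>)))))"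
    unfolding termA2_eq[abs_def] by (rule plus_data_expansion[OF \<xi>(1) pt(2) V])
  have sums_B2: "termB2 f W0 \<xi> t sums bc_conj ((2 * \<xi>) *\<^sub>R (U \<xi> 0 - of_plus (bc_minus (W0 (t - \<xi>)))))"
    unfolding termB2_eq[abs_def]
    by (rule bounded_linear.sums[OF bounded_linear_bc_conj plus_data_expansion[OF \<xi>(1) pt(2) U]])
  have "vekua_formula2 f W0 \<xi> t = W \<xi> t"
    unfolding vekua_formula2_def bc_Pm_mult of_plus_def[symmetric]
      sums_unique[OF sums_A2, symmetric] sums_unique[OF sums_B2, symmetric] W
    using pt(2) by (simp add: bc_conj_def prod_eq_iff scaleR_conv_of_real)
  moreover have "continuous_on {t - \<xi>..t + \<xi>} W0"
    using \<xi> by (intro continuous_on_subset[OF continuous_on_eq[OF solution_continuous_initial[OF sol] W0]]) auto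
  ultimately show ?thesis
    using vekua_formulas_agree[OF pt(2), of t W0 f] sums_A2 sums_B2 by (simp add: sums_iff)
qed

end

lemma (in vekua_system) vekua_rhs_continuous:
  assumes "continuous_on D (\<lambda>(\<xi>, t). W \<xi> t)" "continuous_on D (\<lambda>(\<xi>, t). Wt \<xi> t)" "D \<subseteq> S \<times> UNIV"
  shows "continuous_on D (\<lambda>(\<xi>, t). vekua_rhs q \<xi> (W \<xi> t) (Wt \<xi> t))"
proof -
  have "continuous_on D (\<lambda>z. q (fst z))"
    by (rule continuous_on_compose2[OF cont_q]) (use assms(3) in \<open>auto intro!: continuous_intros\<close>)
  then show ?thesis
    using assms(1,2) unfolding vekua_rhs_def case_prod_beta
    by (intro continuous_intros)
qed

lemma (in vekua_coefficient) vekua_equation_iff: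
  assumes "\<xi> \<in> S" "0 < \<xi>"
  shows "(1 / 2) *\<^sub>R (W\<xi> - bc_mult bc_j Wt) = (deriv f \<xi> / (2 * f \<xi>)) *\<^sub>R bc_conj w \<longleftrightarrow>
     W\<xi> = vekua_rhs (\<lambda>\<xi>. f' \<xi> / f \<xi>) \<xi> w Wt"
proof -
  have "deriv f \<xi> = f' \<xi>" using deriv_f[OF assms] by (rule DERIV_imp_deriv)
  then have "(deriv f \<xi> / (2 * f \<xi>)) *\<^sub>R bc_conj w = (1 / 2) *\<^sub>R ((f' \<xi> / f \<xi>) *\<^sub>R bc_conj w)" by simp
  then show ?thesis by (simp only: scaleR_cancel_left) (auto simp: vekua_rhs_def algebra_simps)
qed

lemma (in vekua_coefficient) vekua_solution_iff:
  assumes S: "S = {0..}"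
  shows "vekua_solution f \<alpha> \<beta> W0 W \<longleftrightarrow> (\<exists>Wt. solution \<alpha> \<beta> W Wt) \<and> (\<forall>t\<in>{\<alpha>..\<beta>}. W 0 t = W0 t)"
proof -
  let ?D = "char_triangle_int \<alpha> \<beta>" and ?rhs = "vekua_rhs (\<lambda>\<xi>. f' \<xi> / f \<xi>)"
  have tri: "tri S \<alpha> \<beta> = char_triangle \<alpha> \<beta>" "tri_int S \<alpha> \<beta> = ?D"
    by (auto simp: S tri_def tri_int_def char_triangle_def char_triangle_int_def)
  have rhs: "(1 / 2) *\<^sub>R (W\<xi> - bc_mult bc_j Wt) = (deriv f \<xi> / (2 * f \<xi>)) *\<^sub>R bc_conj w \<longleftrightarrow> W\<xi> = ?rhs \<xi> w Wt"
    if "(\<xi>, t) \<in> ?D" for \<xi> t W\<xi> Wt w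
    using that by (intro vekua_equation_iff) (auto simp: S char_triangle_int_def)
  show ?thesis
  proof
    assume sol: "vekua_solution f \<alpha> \<beta> W0 W"
    then obtain W\<xi> Wt where Wt: "continuous_on ?D (\<lambda>(\<xi>, t). Wt \<xi> t)"
      and eqs: "\<forall>\<xi> t. (\<xi>, t) \<in> ?D \<longrightarrow> ((\<lambda>s. W s t) has_vector_derivative W\<xi> \<xi> t) (at \<xi>) \<and>
        (W \<xi> has_vector_derivative Wt \<xi> t) (at t) \<and> W\<xi> \<xi> t = ?rhs \<xi> (W \<xi> t) (Wt \<xi> t)"
      unfolding vekua_solution_def by (elim conjE exE) (simp add: rhs)
    have "solution \<alpha> \<beta> W Wt"
    proof (rule classical_solutionI)
      show "continuous_on (tri S \<alpha> \<beta>) (\<lambda>(\<xi>, t). W \<xi> t)" using sol by (simp add: tri vekua_solution_def)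
      show "((\<lambda>s. W s t) has_vector_derivative ?rhs \<xi> (W \<xi> t) (Wt \<xi> t)) (at \<xi>)"
        if "(\<xi>, t) \<in> tri_int S \<alpha> \<beta>" for \<xi> t
        using eqs that unfolding tri by metis
    qed (use Wt eqs in \<open>auto simp: tri\<close>)
    with sol show "(\<exists>Wt. solution \<alpha> \<beta> W Wt) \<and> (\<forall>t\<in>{\<alpha>..\<beta>}. W 0 t = W0 t)"
      by (auto simp: vekua_solution_def)
  next
    assume "(\<exists>Wt. solution \<alpha> \<beta> W Wt) \<and> (\<forall>t\<in>{\<alpha>..\<beta>}. W 0 t = W0 t)"
    then obtain Wt where sol: "solution \<alpha> \<beta> W Wt" and initial: "\<forall>t\<in>{\<alpha>..\<beta>}. W 0 t = W0 t" by blast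
    note solD = classical_solutionD[OF sol, unfolded tri]
    have "continuous_on ?D (\<lambda>(\<xi>, t). ?rhs \<xi> (W \<xi> t) (Wt \<xi> t))"
    proof (rule vekua_rhs_continuous[OF _ solD(2)])
      show "continuous_on ?D (\<lambda>(\<xi>, t). W \<xi> t)"
        using continuous_on_subset[OF solD(1)] tri tri_int_subset by metis
      show "?D \<subseteq> S \<times> UNIV" by (auto simp: S char_triangle_int_def)
    qed
    then show "vekua_solution f \<alpha> \<beta> W0 W"
      unfolding vekua_solution_def
      by (intro conjI initial solD(1) exI[of _ "\<lambda>\<xi> t. ?rhs \<xi> (W \<xi> t) (Wt \<xi> t)"] exI[of _ Wt])
         (simp_all add: rhs solD(2-4))
  qed
qed

lemma vekua_coefficient_of_C1:
  assumes "C1_on {0..} f" "\<forall>\<xi>\<ge>0. f \<xi> \<noteq> 0" "f 0 = 1"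
  obtains f' where "vekua_coefficient {0..} f f'"
proof -
  interpret half_open_interval "{0..}" by (rule half_open_interval_nonneg)
  obtain f' where f': "continuous_on {0..} f'" "\<And>x. 0 \<le> x \<Longrightarrow> (f has_real_derivative f' x) (at x within {0..})"
    using assms(1) unfolding C1_on_def by (auto simp: has_real_derivative_iff_has_vector_derivative)
  have "continuous_on {0..} f" using f'(2) by (intro DERIV_continuous_on) auto
  then have "vekua_coefficient {0..} f f'"
    using assms(2,3) f' by unfold_locales (auto intro: DERIV_at_of_within_S)
  then show ?thesis by (rule that)
qed

theorem vekua_solution_exists:
  assumes "C1_on {0..} f" "\<forall>\<xi>\<ge>0. f \<xi> \<noteq> 0" "f 0 = 1" and W0: "C1_on {\<alpha>..\<beta>} W0"
  shows "\<exists>W. vekua_solution f \<alpha> \<beta> W0 W"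
proof -
  obtain f' where "vekua_coefficient {0..} f f'" using vekua_coefficient_of_C1[OF assms(1-3)] .
  then interpret vekua_coefficient "{0..}" f f' .
  show ?thesis unfolding vekua_solution_iff[OF refl] using solution_exists[OF W0] by blast
qed

theorem vekua_solution_formula:
  assumes "C1_on {0..} f" "\<forall>\<xi>\<ge>0. f \<xi> \<noteq> 0" "f 0 = 1" and W0: "C1_on {\<alpha>..\<beta>} W0"
    and sol: "vekua_solution f \<alpha> \<beta> W0 W" and pt: "0 < \<xi>" "\<alpha> \<le> t - \<xi>" "t + \<xi> \<le> \<beta>"
  shows "summable (termA1 f W0 \<xi> t) \<and> summable (termB1 f W0 \<xi> t) \<and>
         summable (termA2 f W0 \<xi> t) \<and> summable (termB2 f W0 \<xi> t) \<and>
         W \<xi> t = vekua_formula1 f W0 \<xi> t \<and> W \<xi> t = vekua_formula2 f W0 \<xi> t"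
proof -
  obtain f' where "vekua_coefficient {0..} f f'" using vekua_coefficient_of_C1[OF assms(1-3)] .
  then interpret vekua_coefficient "{0..}" f f' .
  obtain Wt where "solution \<alpha> \<beta> W Wt" "\<And>s. s \<in> {\<alpha>..\<beta>} \<Longrightarrow> W 0 s = W0 s"
    using sol unfolding vekua_solution_iff[OF refl] by blast
  moreover have "(\<xi>, t) \<in> tri {0..} \<alpha> \<beta>" using pt by (simp add: mem_tri)
  ultimately show ?thesis using solution_formula[OF _ _ W0 _ pt(1)] by blast
qed

section \<open>The Maxwell system\<close>

definition maxwell_rhs :: "(real \<Rightarrow> real) \<Rightarrow> real \<Rightarrow> real \<Rightarrow> bicomplex \<Rightarrow> bicomplex \<Rightarrow> bicomplex" where
  "maxwell_rhs \<epsilon> \<mu> x w wt = (\<mu> *\<^sub>R snd wt, \<epsilon> x *\<^sub>R fst wt)"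

lemma maxwell_equations_iff:
  "complex_of_real e * E\<^sub>t = \<i> * H\<^sub>x \<and> \<i> * E\<^sub>x = - complex_of_real \<mu> * H\<^sub>t \<longleftrightarrow>
   (E\<^sub>x, \<i> * H\<^sub>x) = (\<mu> *\<^sub>R (\<i> * H\<^sub>t), e *\<^sub>R E\<^sub>t)"
proof -
  have "\<i> * E\<^sub>x = - complex_of_real \<mu> * H\<^sub>t \<longleftrightarrow> E\<^sub>x = complex_of_real \<mu> * (\<i> * H\<^sub>t)"
  proof
    assume "\<i> * E\<^sub>x = - complex_of_real \<mu> * H\<^sub>t"
    then have "- \<i> * (\<i> * E\<^sub>x) = - \<i> * (- complex_of_real \<mu> * H\<^sub>t)" by simp
    then show "E\<^sub>x = complex_of_real \<mu> * (\<i> * H\<^sub>t)" by (simp add: mult_ac)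
  qed (simp add: mult_ac)
  then show ?thesis by (auto simp: scaleR_conv_of_real)
qed

lemma maxwell_solution_imp_classical:
  assumes "maxwell_solution \<epsilon> \<mu> \<alpha> \<beta> E0 H0 E H"
  shows "\<exists>Ft. classical_solution (maxwell_domain \<epsilon> \<mu> \<alpha> \<beta>) (maxwell_domain_int \<epsilon> \<mu> \<alpha> \<beta>) (maxwell_rhs \<epsilon> \<mu>)
    (\<lambda>x t. (E x t, \<i> * H x t)) Ft"
proof -
  let ?D = "maxwell_domain \<epsilon> \<mu> \<alpha> \<beta>" and ?DI = "maxwell_domain_int \<epsilon> \<mu> \<alpha> \<beta>"
  obtain E\<^sub>x E\<^sub>t H\<^sub>x H\<^sub>t where
    cont: "continuous_on ?DI (\<lambda>(x, t). E\<^sub>t x t)" "continuous_on ?DI (\<lambda>(x, t). H\<^sub>t x t)"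
    and eqs: "\<forall>x t. (x, t) \<in> ?DI \<longrightarrow>
           ((\<lambda>s. E s t) has_vector_derivative E\<^sub>x x t) (at x) \<and>
           ((\<lambda>s. E x s) has_vector_derivative E\<^sub>t x t) (at t) \<and>
           ((\<lambda>s. H s t) has_vector_derivative H\<^sub>x x t) (at x) \<and>
           ((\<lambda>s. H x s) has_vector_derivative H\<^sub>t x t) (at t) \<and>
           complex_of_real (\<epsilon> x) * E\<^sub>t x t = \<i> * H\<^sub>x x t \<and>
           \<i> * E\<^sub>x x t = - complex_of_real \<mu> * H\<^sub>t x t"
    using assms unfolding maxwell_solution_def by (elim conjE exE) simp
  have "classical_solution ?D ?DI (maxwell_rhs \<epsilon> \<mu>) (\<lambda>x t. (E x t, \<i> * H x t)) (\<lambda>x t. (E\<^sub>t x t, \<i> * H\<^sub>t x t))"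
  proof (rule classical_solutionI)
    show "continuous_on ?D (\<lambda>(x, t). (E x t, \<i> * H x t))" "continuous_on ?DI (\<lambda>(x, t). (E\<^sub>t x t, \<i> * H\<^sub>t x t))"
      using assms cont unfolding maxwell_solution_def case_prod_beta by (auto intro!: continuous_intros)
    fix x t assume xt: "(x, t) \<in> ?DI"
    have "maxwell_rhs \<epsilon> \<mu> x (E x t, \<i> * H x t) (E\<^sub>t x t, \<i> * H\<^sub>t x t) = (E\<^sub>x x t, \<i> * H\<^sub>x x t)"
      using eqs[rule_format, OF xt] maxwell_equations_iff[of "\<epsilon> x" "E\<^sub>t x t" "H\<^sub>x x t" "E\<^sub>x x t" \<mu> "H\<^sub>t x t"]
      by (simp add: maxwell_rhs_def)
    then show "((\<lambda>s. (E s t, \<i> * H s t)) has_vector_derivative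
        maxwell_rhs \<epsilon> \<mu> x (E x t, \<i> * H x t) (E\<^sub>t x t, \<i> * H\<^sub>t x t)) (at x)"
      using eqs[rule_format, OF xt]
      by (auto intro!: has_vector_derivative_Pair has_vector_derivative_mult_right)
    show "((\<lambda>t. (E x t, \<i> * H x t)) has_vector_derivative (E\<^sub>t x t, \<i> * H\<^sub>t x t)) (at t)"
      using eqs[rule_format, OF xt]
      by (auto intro!: has_vector_derivative_Pair has_vector_derivative_mult_right)
  qed
  then show ?thesis by blast
qed

lemma classical_imp_maxwell_solution:
  assumes sol: "classical_solution (maxwell_domain \<epsilon> \<mu> \<alpha> \<beta>) (maxwell_domain_int \<epsilon> \<mu> \<alpha> \<beta>) (maxwell_rhs \<epsilon> \<mu>) F Ft"
    and initial: "\<And>t. t \<in> {\<alpha>..\<beta>} \<Longrightarrow> F 0 t = (E0 t, \<i> * H0 t)" and \<epsilon>: "continuous_on {0..} \<epsilon>"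
  shows "maxwell_solution \<epsilon> \<mu> \<alpha> \<beta> E0 H0 (\<lambda>x t. fst (F x t)) (\<lambda>x t. - \<i> * snd (F x t))"
proof -
  let ?DI = "maxwell_domain_int \<epsilon> \<mu> \<alpha> \<beta>"
  note solD = classical_solutionD[OF sol]
  define E\<^sub>x E\<^sub>t H\<^sub>x H\<^sub>t where "E\<^sub>x x t = \<mu> *\<^sub>R snd (Ft x t)" and "E\<^sub>t x t = fst (Ft x t)"
    and "H\<^sub>x x t = - \<i> * (\<epsilon> x *\<^sub>R fst (Ft x t))" and "H\<^sub>t x t = - \<i> * snd (Ft x t)" for x t
  have "fst ` ?DI \<subseteq> {0..}" by (auto simp: maxwell_domain_int_def)
  then have "continuous_on ?DI (\<lambda>z. \<epsilon> (fst z))"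
    by (rule continuous_on_compose2[OF \<epsilon> continuous_on_fst[OF continuous_on_id]])
  then have cont: "continuous_on ?DI (\<lambda>(x, t). E\<^sub>x x t)" "continuous_on ?DI (\<lambda>(x, t). E\<^sub>t x t)"
    "continuous_on ?DI (\<lambda>(x, t). H\<^sub>x x t)" "continuous_on ?DI (\<lambda>(x, t). H\<^sub>t x t)"
    using solD(2) unfolding E\<^sub>x_def E\<^sub>t_def H\<^sub>x_def H\<^sub>t_def case_prod_beta by (auto intro!: continuous_intros)
  have eqs: "((\<lambda>s. fst (F s t)) has_vector_derivative E\<^sub>x x t) (at x) \<and>
      ((\<lambda>s. fst (F x s)) has_vector_derivative E\<^sub>t x t) (at t) \<and>
      ((\<lambda>s. - \<i> * snd (F s t)) has_vector_derivative H\<^sub>x x t) (at x) \<and>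
      ((\<lambda>s. - \<i> * snd (F x s)) has_vector_derivative H\<^sub>t x t) (at t) \<and>
      complex_of_real (\<epsilon> x) * E\<^sub>t x t = \<i> * H\<^sub>x x t \<and> \<i> * E\<^sub>x x t = - complex_of_real \<mu> * H\<^sub>t x t"
    if xt: "(x, t) \<in> ?DI" for x t
    using bounded_linear.has_vector_derivative[OF bounded_linear_fst solD(3)[OF xt]]
      bounded_linear.has_vector_derivative[OF bounded_linear_snd solD(3)[OF xt]]
      bounded_linear.has_vector_derivative[OF bounded_linear_fst solD(4)[OF xt]]
      bounded_linear.has_vector_derivative[OF bounded_linear_snd solD(4)[OF xt]]
    unfolding maxwell_equations_iff E\<^sub>x_def E\<^sub>t_def H\<^sub>x_def H\<^sub>t_def maxwell_rhs_def
    by (intro conjI has_vector_derivative_mult_right) simp_all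
  show ?thesis
    unfolding maxwell_solution_def
  proof (intro conjI)
    show "continuous_on (maxwell_domain \<epsilon> \<mu> \<alpha> \<beta>) (\<lambda>(x, t). fst (F x t))"
      "continuous_on (maxwell_domain \<epsilon> \<mu> \<alpha> \<beta>) (\<lambda>(x, t). - \<i> * snd (F x t))"
      using solD(1) unfolding case_prod_beta by (auto intro!: continuous_intros)
    show "\<forall>t\<in>{\<alpha>..\<beta>}. fst (F 0 t) = E0 t \<and> - \<i> * snd (F 0 t) = H0 t" by (simp add: initial)
  qed (rule exI[of _ E\<^sub>x], rule exI[of _ E\<^sub>t], rule exI[of _ H\<^sub>x], rule exI[of _ H\<^sub>t], use cont eqs in blast)
qed

locale maxwell_medium =
  fixes \<epsilon> \<epsilon>' :: "real \<Rightarrow> real" and \<mu> :: real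
  assumes cont_\<epsilon>': "continuous_on {0..} \<epsilon>'"
    and deriv_\<epsilon>: "0 \<le> x \<Longrightarrow> (\<epsilon> has_real_derivative \<epsilon>' x) (at x within {0..})"
    and \<epsilon>_pos: "0 \<le> x \<Longrightarrow> 0 < \<epsilon> x" and \<mu>_pos: "0 < \<mu>"
begin

interpretation nonneg: half_open_interval "{0..}"
  by (rule half_open_interval_nonneg)

abbreviation xi :: "real \<Rightarrow> real" where "xi \<equiv> xi_of \<epsilon> \<mu>"
abbreviation x_inv :: "real \<Rightarrow> real" where "x_inv \<equiv> x_of \<epsilon> \<mu>"
abbreviation c :: "real \<Rightarrow> real" where "c \<equiv> c_of \<epsilon> \<mu>"
abbreviation \<Xi> :: "real set" where "\<Xi> \<equiv> xi ` {0..}"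

lemma cont_\<epsilon>: "continuous_on {0..} \<epsilon>"
  using deriv_\<epsilon> by (intro DERIV_continuous_on) auto

lemma c_pos: "0 \<le> x \<Longrightarrow> 0 < c x"
  using \<epsilon>_pos \<mu>_pos by (simp add: c_of_def)

lemma cont_c: "continuous_on {0..} c"
proof -
  have "sqrt (\<epsilon> x * \<mu>) \<noteq> 0" if "0 \<le> x" for x
    using \<epsilon>_pos[OF that] \<mu>_pos by simp
  then show ?thesis
    unfolding c_of_def[abs_def] by (intro continuous_intros cont_\<epsilon>) auto
qed

lemma xi_0: "xi 0 = 0"
  by (simp add: xi_of_def)

lemma cont_xi: "continuous_on {0..} xi"
  unfolding xi_of_def[abs_def]
  by (intro continuous_intros nonneg.continuous_on_indefinite_integral cont_\<epsilon>)

lemma deriv_xi: assumes "0 < x" shows "(xi has_real_derivative 1 / c x) (at x)"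
proof -
  have "continuous_on {0..} (\<lambda>s. sqrt (\<epsilon> s))" by (intro continuous_intros cont_\<epsilon>)
  from DERIV_cmult[OF nonneg.DERIV_indefinite_integral[OF this, of x], of "sqrt \<mu>"] assms
  show ?thesis
    by (simp add: xi_of_def[abs_def] c_of_def real_sqrt_mult mult.commute)
qed

lemma xi_strict_mono: assumes "0 \<le> x" "x < y" shows "xi x < xi y"
proof (rule DERIV_pos_imp_increasing_open[OF assms(2)])
  show "\<exists>d. (xi has_real_derivative d) (at z) \<and> 0 < d" if "x < z" "z < y" for z
    using deriv_xi[of z] c_pos[of z] assms that by (intro exI[of _ "1 / c z"]) auto
  show "continuous_on {x..y} xi"
    by (rule continuous_on_subset[OF cont_xi]) (use assms in auto)
qed

lemma xi_pos: "0 < x \<Longrightarrow> 0 < xi x"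
  using xi_strict_mono[of 0 x] xi_0 by auto

lemma xi_nonneg: "0 \<le> x \<Longrightarrow> 0 \<le> xi x"
  using xi_pos[of x] xi_0 by (cases "x = 0") auto

lemma x_inv_xi: "0 \<le> x \<Longrightarrow> x_inv (xi x) = x"
  unfolding x_of_def
  by (rule the_equality) (auto, metis linorder_neqE less_irrefl xi_strict_mono)

lemma xi_x_inv: "s \<in> \<Xi> \<Longrightarrow> xi (x_inv s) = s \<and> 0 \<le> x_inv s"
  using x_inv_xi by auto

lemma x_inv_pos: "s \<in> \<Xi> \<Longrightarrow> 0 < s \<Longrightarrow> 0 < x_inv s"
  using xi_x_inv[of s] xi_0 by (cases "x_inv s = 0") auto

lemma xi_image_Icc: assumes "0 \<le> x" shows "xi ` {0..x} = {0..xi x}"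
proof
  show "xi ` {0..x} \<subseteq> {0..xi x}"
    using xi_nonneg xi_strict_mono by (force simp: order_le_less)
  show "{0..xi x} \<subseteq> xi ` {0..x}"
  proof
    fix s assume "s \<in> {0..xi x}"
    then have "\<exists>y\<ge>0. y \<le> x \<and> xi y = s"
      using IVT'[of xi 0 s x] continuous_on_subset[OF cont_xi, of "{0..x}"] assms xi_0 by auto
    then show "s \<in> xi ` {0..x}" by auto
  qed
qed

sublocale half_open_interval \<Xi>
proof
  show "0 \<in> \<Xi>" using xi_0 by force
  show "0 \<le> s" if "s \<in> \<Xi>" for s using that xi_nonneg by auto
  show "r \<in> \<Xi>" if "s \<in> \<Xi>" "0 \<le> r" "r \<le> s" for s r
  proof -
    from that(1) obtain x where "s = xi x" "x \<in> {0..}" by (rule imageE)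
    then have "r \<in> xi ` {0..x}" using xi_image_Icc[of x] that by auto
    then show ?thesis by auto
  qed
  show "\<exists>r\<in>\<Xi>. s < r" if "s \<in> \<Xi>" for s
  proof -
    from that obtain x where "s = xi x" "x \<in> {0..}" by (rule imageE)
    then show ?thesis using xi_strict_mono[of x "x + 1"] by (intro bexI[of _ "xi (x + 1)"]) auto
  qed
qed

lemma cont_x_inv: "continuous_on \<Xi> x_inv"
  unfolding continuous_on_eq_continuous_within
proof
  fix s assume s: "s \<in> \<Xi>"
  then obtain \<eta> where \<eta>: "\<eta> \<in> \<Xi>" "s < \<eta>" using S_open by blast
  then obtain x where x: "0 \<le> x" "\<eta> = xi x" by auto
  have "continuous_on (xi ` {0..x}) x_inv"
    by (rule continuous_on_inv) (use x_inv_xi continuous_on_subset[OF cont_xi] in auto)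
  then show "continuous (at s within \<Xi>) x_inv"
    unfolding at_within_S[OF \<eta>(1) s \<eta>(2)] using xi_image_Icc[OF x(1)] x \<eta>(2) S_nonneg[OF s]
    by (simp add: continuous_on_eq_continuous_within)
qed

lemma deriv_x_inv:
  assumes s: "s \<in> \<Xi>" "0 < s"
  shows "(x_inv has_real_derivative c (x_inv s)) (at s)"
proof -
  obtain \<eta> where \<eta>: "\<eta> \<in> \<Xi>" "s < \<eta>" using S_open[OF s(1)] by blast
  have "(x_inv has_real_derivative inverse (1 / c (x_inv s))) (at s)"
  proof (rule DERIV_inverse_function[where f = xi and a = 0 and b = \<eta>])
    show "(xi has_real_derivative 1 / c (x_inv s)) (at (x_inv s))"
      by (rule deriv_xi[OF x_inv_pos[OF s]])
    show "1 / c (x_inv s) \<noteq> 0" using c_pos[of "x_inv s"] xi_x_inv[OF s(1)] by simp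
    show "xi (x_inv y) = y" if "0 < y" "y < \<eta>" for y
      using xi_x_inv S_down[OF \<eta>(1), of y] that by simp
    have "continuous_on (\<Xi> \<inter> {0<..}) x_inv" by (rule continuous_on_subset[OF cont_x_inv]) auto
    then show "isCont x_inv s" using continuous_on_eq_continuous_at[OF open_S_pos] s by auto
  qed (use s \<eta> in auto)
  then show ?thesis by simp
qed

text \<open>The square root of the wave admittance \<open>sqrt (\<epsilon> / \<mu>)\<close>. It equals \<open>sqrt (c \<epsilon>)\<close> and \<open>1 / sqrt (c \<mu>)\<close>,
  so that \<open>W\<close> is obtained from \<open>(E, i H)\<close> by one squeeze mapping.\<close>

definition root_admittance :: "real \<Rightarrow> real" where
  "root_admittance x = sqrt (sqrt (\<epsilon> x / \<mu>))"

definition root_admittance' :: "real \<Rightarrow> real" where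
  "root_admittance' x = root_admittance x * \<epsilon>' x / (4 * \<epsilon> x)"

lemma root_admittance_pos: "0 \<le> x \<Longrightarrow> 0 < root_admittance x"
  using \<epsilon>_pos \<mu>_pos by (simp add: root_admittance_def)

lemma cont_root_admittance: "continuous_on {0..} root_admittance"
  unfolding root_admittance_def[abs_def] using \<mu>_pos by (auto intro!: continuous_intros cont_\<epsilon>)

lemma cont_root_admittance': "continuous_on {0..} root_admittance'"
proof -
  have "\<epsilon> x \<noteq> 0" if "0 \<le> x" for x using \<epsilon>_pos[OF that] by simp
  then show ?thesis
    unfolding root_admittance'_def[abs_def]
    by (auto intro!: continuous_intros cont_root_admittance cont_\<epsilon> cont_\<epsilon>')
qed

lemma deriv_root_admittance:
  assumes "0 < x"
  shows "(root_admittance has_real_derivative root_admittance' x) (at x)"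
proof -
  have \<epsilon>: "0 < \<epsilon> x" "(\<epsilon> has_real_derivative \<epsilon>' x) (at x)"
    using \<epsilon>_pos nonneg.DERIV_at_of_within_S[OF deriv_\<epsilon>] assms by auto
  define r where "r = sqrt (\<epsilon> x / \<mu>)"
  have r: "0 < r" "\<epsilon> x = \<mu> * r\<^sup>2" using \<epsilon>(1) \<mu>_pos by (simp_all add: r_def)
  have inner: "((\<lambda>x. sqrt (\<epsilon> x / \<mu>)) has_real_derivative inverse r / 2 * (\<epsilon>' x / \<mu>)) (at x)"
    unfolding r_def using \<epsilon> \<mu>_pos by (intro DERIV_chain2[OF DERIV_real_sqrt] DERIV_cdivide) auto
  have outer: "(sqrt has_real_derivative inverse (sqrt r) / 2) (at (sqrt (\<epsilon> x / \<mu>)))"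
    using DERIV_real_sqrt[OF r(1)] by (simp only: r_def)
  from DERIV_chain2[where f = sqrt and g = "\<lambda>x. sqrt (\<epsilon> x / \<mu>)", OF outer inner]
  have "(root_admittance has_real_derivative inverse (sqrt r) / 2 * (inverse r / 2 * (\<epsilon>' x / \<mu>))) (at x)"
    unfolding root_admittance_def[abs_def] .
  moreover have "inverse (sqrt r) / 2 * (inverse r / 2 * (\<epsilon>' x / \<mu>)) = root_admittance' x"
  proof -
    have "inverse (sqrt r) = sqrt r / r" using r(1) by (simp add: field_simps)
    then show ?thesis
      using r \<mu>_pos
      by (simp add: root_admittance'_def root_admittance_def r_def[symmetric] power2_eq_square field_simps)
  qed
  ultimately show ?thesis by simp
qed

lemma c_\<epsilon>: "0 \<le> x \<Longrightarrow> c x * \<epsilon> x = (root_admittance x)\<^sup>2"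
  and c_\<mu>: "0 \<le> x \<Longrightarrow> c x * \<mu> = 1 / (root_admittance x)\<^sup>2"
proof -
  assume "0 \<le> x"
  then have "0 < \<epsilon> x" by (rule \<epsilon>_pos)
  then show "c x * \<epsilon> x = (root_admittance x)\<^sup>2" "c x * \<mu> = 1 / (root_admittance x)\<^sup>2"
    using \<mu>_pos real_sqrt_pow2[of "\<epsilon> x"] real_sqrt_pow2[of \<mu>]
    by (simp_all add: c_of_def root_admittance_def real_sqrt_mult real_sqrt_divide field_simps power2_eq_square)
qed

lemma sqrt_c_\<epsilon>: "0 \<le> x \<Longrightarrow> sqrt (c x * \<epsilon> x) = root_admittance x"
  using root_admittance_pos[of x] by (simp add: c_\<epsilon>)

lemma sqrt_c_\<mu>: "0 \<le> x \<Longrightarrow> sqrt (c x * \<mu>) = 1 / root_admittance x"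
  using root_admittance_pos[of x] by (simp add: c_\<mu> real_sqrt_divide)

lemma sqrt_c: "0 \<le> x \<Longrightarrow> sqrt (c x) = 1 / (root_admittance x * sqrt \<mu>)"
  using sqrt_c_\<mu>[of x] root_admittance_pos[of x] \<mu>_pos by (simp add: real_sqrt_mult field_simps)

abbreviation f\<^sub>\<xi> :: "real \<Rightarrow> real" where "f\<^sub>\<xi> \<equiv> f_of \<epsilon> \<mu>"

abbreviation f\<^sub>\<xi>' :: "real \<Rightarrow> real" where
  "f\<^sub>\<xi>' \<equiv> \<lambda>s. root_admittance' (x_inv s) * c (x_inv s) / root_admittance 0"

lemma f_of_eq: assumes "s \<in> \<Xi>" shows "f\<^sub>\<xi> s = root_admittance (x_inv s) / root_admittance 0"
proof -
  have "0 \<le> x_inv s" using xi_x_inv[OF assms] by simp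
  then show ?thesis using \<mu>_pos by (simp add: f_of_def sqrt_c)
qed

sublocale vekua_coefficient \<Xi> f\<^sub>\<xi> f\<^sub>\<xi>'
proof
  note [simp] = root_admittance_pos[THEN less_imp_neq, symmetric]
  have img: "x_inv ` \<Xi> \<subseteq> {0..}" using xi_x_inv by auto
  have "continuous_on \<Xi> (\<lambda>s. root_admittance (x_inv s) / root_admittance 0)"
    by (intro continuous_intros continuous_on_compose2[OF cont_root_admittance cont_x_inv img]) simp
  then show "continuous_on \<Xi> f\<^sub>\<xi>" by (rule continuous_on_eq) (simp add: f_of_eq)
  show "continuous_on \<Xi> f\<^sub>\<xi>'"
    by (intro continuous_intros continuous_on_compose2[OF cont_root_admittance' cont_x_inv img]
        continuous_on_compose2[OF cont_c cont_x_inv img]) simp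
  show "(f\<^sub>\<xi> has_real_derivative f\<^sub>\<xi>' s) (at s)" if s: "s \<in> \<Xi>" "0 < s" for s
  proof -
    have "((\<lambda>s. root_admittance (x_inv s) / root_admittance 0) has_real_derivative f\<^sub>\<xi>' s) (at s)"
      by (rule DERIV_cdivide[OF DERIV_chain2[OF deriv_root_admittance[OF x_inv_pos[OF s]] deriv_x_inv[OF s]]])
    then show ?thesis
      by (rule has_field_derivative_transform_within_open[OF _ open_S_pos]) (use s in \<open>auto simp: f_of_eq\<close>)
  qed
  show "f\<^sub>\<xi> s \<noteq> 0" if "s \<in> \<Xi>" for s using xi_x_inv[OF that] by (simp add: f_of_eq[OF that])
  show "f\<^sub>\<xi> 0 = 1" using f_of_eq[OF zero_S] x_inv_xi[of 0] by (simp add: xi_0)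
qed

lemma log_derivative_f_of:
  assumes "s \<in> \<Xi>"
  shows "f\<^sub>\<xi>' s / f\<^sub>\<xi> s = root_admittance' (x_inv s) * c (x_inv s) / root_admittance (x_inv s)"
  using root_admittance_pos[of 0] by (simp add: f_of_eq[OF assms])

lemma mem_maxwell_domain: "(x, t) \<in> maxwell_domain \<epsilon> \<mu> \<alpha> \<beta> \<longleftrightarrow> 0 \<le> x \<and> (xi x, t) \<in> tri \<Xi> \<alpha> \<beta>"
  using xi_nonneg by (auto simp: maxwell_domain_def mem_tri)

lemma mem_maxwell_domain_int: "(x, t) \<in> maxwell_domain_int \<epsilon> \<mu> \<alpha> \<beta> \<longleftrightarrow> 0 < x \<and> (xi x, t) \<in> tri_int \<Xi> \<alpha> \<beta>"
  using xi_pos by (auto simp: maxwell_domain_int_def mem_tri_int)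

lemma maxwell_rhs_squeeze:
  assumes "0 \<le> x"
  shows "c x *\<^sub>R bc_squeeze (root_admittance x) (maxwell_rhs \<epsilon> \<mu> x w wt) =
    bc_mult bc_j (bc_squeeze (root_admittance x) wt)"
proof -
  have "c x * (root_admittance x * \<mu>) = 1 / root_admittance x"
    "c x * (\<epsilon> x / root_admittance x) = root_admittance x"
    using c_\<mu>[OF assms] c_\<epsilon>[OF assms] root_admittance_pos[OF assms]
    by (simp_all add: field_simps power2_eq_square)
  then show ?thesis
    by (simp add: bc_squeeze_def maxwell_rhs_def bc_simps)
qed

lemma solution_of_maxwell:
  assumes "classical_solution (maxwell_domain \<epsilon> \<mu> \<alpha> \<beta>) (maxwell_domain_int \<epsilon> \<mu> \<alpha> \<beta>) (maxwell_rhs \<epsilon> \<mu>) F Ft"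
  shows "solution \<alpha> \<beta> (\<lambda>s t. bc_squeeze (root_admittance (x_inv s)) (F (x_inv s) t))
    (\<lambda>s t. bc_squeeze (root_admittance (x_inv s)) (Ft (x_inv s) t))"
proof (rule classical_solution_squeeze_change[OF assms cont_x_inv, where h' = "\<lambda>s. c (x_inv s)"
      and r' = "\<lambda>s. root_admittance' (x_inv s) * c (x_inv s)"])
  show "tri \<Xi> \<alpha> \<beta> \<subseteq> \<Xi> \<times> UNIV" "tri_int \<Xi> \<alpha> \<beta> \<subseteq> tri \<Xi> \<alpha> \<beta>"
    using tri_int_subset by (auto simp: tri_def)
  show "(x_inv s, t) \<in> maxwell_domain \<epsilon> \<mu> \<alpha> \<beta>" if "(s, t) \<in> tri \<Xi> \<alpha> \<beta>" for s t
    using that xi_x_inv[of s] by (auto simp: mem_maxwell_domain mem_tri)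
  show "continuous_on \<Xi> (\<lambda>s. root_admittance (x_inv s))"
    using xi_x_inv by (intro continuous_on_compose2[OF cont_root_admittance cont_x_inv]) auto
  show "root_admittance (x_inv s) \<noteq> 0" if "s \<in> \<Xi>" for s
    using root_admittance_pos[of "x_inv s"] xi_x_inv[OF that] by simp
  fix s t assume "(s, t) \<in> tri_int \<Xi> \<alpha> \<beta>"
  then have s: "s \<in> \<Xi>" "0 < s" by (auto simp: mem_tri_int)
  show "(x_inv s, t) \<in> maxwell_domain_int \<epsilon> \<mu> \<alpha> \<beta>"
    using \<open>(s, t) \<in> tri_int \<Xi> \<alpha> \<beta>\<close> xi_x_inv[OF s(1)] x_inv_pos[OF s] by (simp add: mem_maxwell_domain_int)
  show "(x_inv has_real_derivative c (x_inv s)) (at s)" by (rule deriv_x_inv[OF s])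
  show "((\<lambda>s. root_admittance (x_inv s)) has_real_derivative root_admittance' (x_inv s) * c (x_inv s)) (at s)"
    by (rule DERIV_chain2[OF deriv_root_admittance[OF x_inv_pos[OF s]] deriv_x_inv[OF s]])
  show "vekua_rhs (\<lambda>s. f\<^sub>\<xi>' s / f\<^sub>\<xi> s) s
        (bc_squeeze (root_admittance (x_inv s)) w) (bc_squeeze (root_admittance (x_inv s)) wt) =
      c (x_inv s) *\<^sub>R bc_squeeze (root_admittance (x_inv s)) (maxwell_rhs \<epsilon> \<mu> (x_inv s) w wt) +
      (root_admittance' (x_inv s) * c (x_inv s) / root_admittance (x_inv s)) *\<^sub>R
        bc_conj (bc_squeeze (root_admittance (x_inv s)) w)" for w wt
    unfolding vekua_rhs_def log_derivative_f_of[OF s(1)]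
    using xi_x_inv[OF s(1)] by (simp add: maxwell_rhs_squeeze)
qed

lemma maxwell_rhs_unsqueeze:
  fixes w wt :: bicomplex
  assumes "0 \<le> x"
  defines "v \<equiv> bc_squeeze (1 / root_admittance x) w" and "vt \<equiv> bc_squeeze (1 / root_admittance x) wt"
  shows "(1 / c x) *\<^sub>R bc_squeeze (1 / root_admittance x) (vekua_rhs (\<lambda>s. f\<^sub>\<xi>' s / f\<^sub>\<xi> s) (xi x) w wt) =
    maxwell_rhs \<epsilon> \<mu> x v vt + (root_admittance' x / root_admittance x) *\<^sub>R bc_conj v"
proof -
  note linear_squeeze = bounded_linear.linear[OF bounded_linear_bc_squeeze]
  have nonzero: "root_admittance x \<noteq> 0" using root_admittance_pos[OF assms(1)] by simp
  have wt_eq: "wt = bc_squeeze (root_admittance x) vt"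
    using nonzero by (simp add: vt_def bc_squeeze_def)
  have "bc_squeeze (1 / root_admittance x) (bc_mult bc_j wt) = c x *\<^sub>R maxwell_rhs \<epsilon> \<mu> x v vt"
    unfolding wt_eq maxwell_rhs_squeeze[OF assms(1), symmetric, of vt v]
    using nonzero by (simp add: bc_squeeze_def prod_eq_iff)
  moreover have "f\<^sub>\<xi>' (xi x) / f\<^sub>\<xi> (xi x) = root_admittance' x * c x / root_admittance x"
    using log_derivative_f_of[of "xi x"] assms(1) by (simp add: x_inv_xi)
  ultimately have "bc_squeeze (1 / root_admittance x) (vekua_rhs (\<lambda>s. f\<^sub>\<xi>' s / f\<^sub>\<xi> s) (xi x) w wt) =
      c x *\<^sub>R (maxwell_rhs \<epsilon> \<mu> x v vt + (root_admittance' x / root_admittance x) *\<^sub>R bc_conj v)"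
    unfolding vekua_rhs_def
    by (simp only: linear_add[OF linear_squeeze] linear_cmul[OF linear_squeeze] bc_squeeze_conj v_def)
       (simp add: scaleR_add_right mult.commute)
  then show ?thesis using c_pos[OF assms(1)] by simp
qed

lemma maxwell_of_solution:
  assumes "solution \<alpha> \<beta> W Wt"
  shows "classical_solution (maxwell_domain \<epsilon> \<mu> \<alpha> \<beta>) (maxwell_domain_int \<epsilon> \<mu> \<alpha> \<beta>) (maxwell_rhs \<epsilon> \<mu>)
    (\<lambda>x t. bc_squeeze (1 / root_admittance x) (W (xi x) t))
    (\<lambda>x t. bc_squeeze (1 / root_admittance x) (Wt (xi x) t))"
proof (rule classical_solution_squeeze_change[OF assms cont_xi, where h' = "\<lambda>x. 1 / c x"
      and r' = "\<lambda>x. - root_admittance' x / (root_admittance x)\<^sup>2"])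
  show "maxwell_domain \<epsilon> \<mu> \<alpha> \<beta> \<subseteq> {0..} \<times> UNIV" "maxwell_domain_int \<epsilon> \<mu> \<alpha> \<beta> \<subseteq> maxwell_domain \<epsilon> \<mu> \<alpha> \<beta>"
    by (auto simp: maxwell_domain_def maxwell_domain_int_def)
  show "(xi x, t) \<in> tri \<Xi> \<alpha> \<beta>" if "(x, t) \<in> maxwell_domain \<epsilon> \<mu> \<alpha> \<beta>" for x t
    using that by (simp add: mem_maxwell_domain)
  have nonzero: "root_admittance x \<noteq> 0" if "0 \<le> x" for x using root_admittance_pos[OF that] by simp
  then show "1 / root_admittance x \<noteq> 0" if "x \<in> {0..}" for x using that by simp
  show "continuous_on {0..} (\<lambda>x. 1 / root_admittance x)"
    using nonzero by (intro continuous_intros cont_root_admittance) auto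
  fix x t assume xt: "(x, t) \<in> maxwell_domain_int \<epsilon> \<mu> \<alpha> \<beta>"
  then show "(xi x, t) \<in> tri_int \<Xi> \<alpha> \<beta>" by (simp add: mem_maxwell_domain_int)
  have x: "0 < x" "0 \<le> x" using xt by (auto simp: mem_maxwell_domain_int)
  then show "(xi has_real_derivative 1 / c x) (at x)" by (intro deriv_xi)
  show "((\<lambda>x. 1 / root_admittance x) has_real_derivative - root_admittance' x / (root_admittance x)\<^sup>2) (at x)"
    using deriv_root_admittance[OF x(1)] nonzero[OF x(2)]
    by (auto intro!: derivative_eq_intros simp: power2_eq_square)
  show "maxwell_rhs \<epsilon> \<mu> x (bc_squeeze (1 / root_admittance x) w) (bc_squeeze (1 / root_admittance x) wt) =
      (1 / c x) *\<^sub>R bc_squeeze (1 / root_admittance x) (vekua_rhs (\<lambda>s. f\<^sub>\<xi>' s / f\<^sub>\<xi> s) (xi x) w wt) +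
      (- root_admittance' x / (root_admittance x)\<^sup>2 / (1 / root_admittance x)) *\<^sub>R
        bc_conj (bc_squeeze (1 / root_admittance x) w)" for w wt
    unfolding maxwell_rhs_unsqueeze[OF x(2)] by (simp add: power2_eq_square)
qed

lemma W0_of_eq: "W0_of \<epsilon> \<mu> E0 H0 t = bc_squeeze (root_admittance 0) (E0 t, \<i> * H0 t)"
  by (simp add: W0_of_def sqrt_c_\<epsilon> sqrt_c_\<mu> bc_squeeze_def bc_simps scaleR_conv_of_real)

lemma C1_on_W0_of:
  assumes "C1_on T E0" "C1_on T H0"
  shows "C1_on T (W0_of \<epsilon> \<mu> E0 H0)"
  unfolding W0_of_eq[abs_def]
  by (intro C1_on_bounded_linear[OF bounded_linear_bc_squeeze] C1_on_Pair
      C1_on_bounded_linear[OF bounded_linear_mult_right] assms)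

theorem maxwell_solution_exists:
  assumes "C1_on {\<alpha>..\<beta>} E0" "C1_on {\<alpha>..\<beta>} H0"
  shows "\<exists>E H. maxwell_solution \<epsilon> \<mu> \<alpha> \<beta> E0 H0 E H"
proof -
  obtain W Wt where sol: "solution \<alpha> \<beta> W Wt" and initial: "\<forall>t\<in>{\<alpha>..\<beta>}. W 0 t = W0_of \<epsilon> \<mu> E0 H0 t"
    using solution_exists[OF C1_on_W0_of[OF assms]] by blast
  have "bc_squeeze (1 / root_admittance 0) (W (xi 0) t) = (E0 t, \<i> * H0 t)" if "t \<in> {\<alpha>..\<beta>}" for t
    using initial that root_admittance_pos[of 0] by (simp add: xi_0 W0_of_eq bc_squeeze_inverse)
  from classical_imp_maxwell_solution[OF maxwell_of_solution[OF sol] this cont_\<epsilon>]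
  show ?thesis by blast
qed

theorem maxwell_solution_formula:
  assumes C1: "C1_on {\<alpha>..\<beta>} E0" "C1_on {\<alpha>..\<beta>} H0"
    and sol: "maxwell_solution \<epsilon> \<mu> \<alpha> \<beta> E0 H0 E H"
    and xt: "(x, t) \<in> maxwell_domain \<epsilon> \<mu> \<alpha> \<beta>" "0 < x"
  defines "W \<equiv> vekua_formula1 f\<^sub>\<xi> (W0_of \<epsilon> \<mu> E0 H0) (xi x) t"
  shows "E x t = complex_of_real (1 / sqrt (c x * \<epsilon> x)) * bc_R W"
    and "H x t = - (\<i> / complex_of_real (sqrt (c x * \<mu>))) * bc_I W"
proof -
  have x: "0 \<le> x" "(xi x, t) \<in> tri \<Xi> \<alpha> \<beta>" using xt by (auto simp: mem_maxwell_domain)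
  obtain Ft where "classical_solution (maxwell_domain \<epsilon> \<mu> \<alpha> \<beta>) (maxwell_domain_int \<epsilon> \<mu> \<alpha> \<beta>) (maxwell_rhs \<epsilon> \<mu>)
      (\<lambda>x t. (E x t, \<i> * H x t)) Ft"
    using maxwell_solution_imp_classical[OF sol] by blast
  note sol\<^sub>\<xi> = solution_of_maxwell[OF this]
  have "bc_squeeze (root_admittance (x_inv 0)) (E (x_inv 0) s, \<i> * H (x_inv 0) s) = W0_of \<epsilon> \<mu> E0 H0 s"
    if "s \<in> {\<alpha>..\<beta>}" for s
    using sol that x_inv_xi[of 0] by (simp add: xi_0 W0_of_eq maxwell_solution_def)
  from solution_formula[OF sol\<^sub>\<xi> this C1_on_W0_of[OF C1] x(2) xi_pos[OF xt(2)]]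
  have "W = bc_squeeze (root_admittance x) (E x t, \<i> * H x t)"
    by (simp add: W_def x_inv_xi[OF x(1)])
  then show "E x t = complex_of_real (1 / sqrt (c x * \<epsilon> x)) * bc_R W"
    "H x t = - (\<i> / complex_of_real (sqrt (c x * \<mu>))) * bc_I W"
    using root_admittance_pos[OF x(1)]
    by (simp_all add: sqrt_c_\<epsilon>[OF x(1)] sqrt_c_\<mu>[OF x(1)] bc_squeeze_def bc_simps scaleR_conv_of_real)
qed

end

lemma maxwell_medium_of_C1:
  assumes "C1_on {0..} \<epsilon>" "\<forall>x\<ge>0. 0 < \<epsilon> x" "0 < \<mu>"
  obtains \<epsilon>' where "maxwell_medium \<epsilon> \<epsilon>' \<mu>"
proof -
  obtain \<epsilon>' where "continuous_on {0..} \<epsilon>'" "\<forall>x\<in>{0..}. (\<epsilon> has_vector_derivative \<epsilon>' x) (at x within {0..})"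
    using assms(1) unfolding C1_on_def by blast
  then have "maxwell_medium \<epsilon> \<epsilon>' \<mu>"
    using assms(2,3) by unfold_locales (auto simp: has_real_derivative_iff_has_vector_derivative)
  then show ?thesis by (rule that)
qed

theorem theorem1:
  shows
  "(\<forall>(f :: real \<Rightarrow> real) (W0 :: real \<Rightarrow> bicomplex) (\<alpha> :: real) (\<beta> :: real).
      C1_on {0..} f \<and> (\<forall>\<xi>\<ge>0. f \<xi> \<noteq> 0) \<and> f 0 = 1 \<and> \<alpha> < \<beta> \<and> C1_on {\<alpha>..\<beta>} W0 \<longrightarrow>
        (\<exists>W. vekua_solution f \<alpha> \<beta> W0 W) \<and>
        (\<forall>W. vekua_solution f \<alpha> \<beta> W0 W \<longrightarrow>
           (\<forall>\<xi> t. 0 < \<xi> \<and> \<alpha> \<le> t - \<xi> \<and> t + \<xi> \<le> \<beta> \<longrightarrow>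
              summable (termA1 f W0 \<xi> t) \<and> summable (termB1 f W0 \<xi> t) \<and>
              summable (termA2 f W0 \<xi> t) \<and> summable (termB2 f W0 \<xi> t) \<and>
              W \<xi> t = vekua_formula1 f W0 \<xi> t \<and>
              W \<xi> t = vekua_formula2 f W0 \<xi> t)))
   \<and>
   (\<forall>(\<epsilon> :: real \<Rightarrow> real) (\<mu> :: real) (E0 :: real \<Rightarrow> complex) (H0 :: real \<Rightarrow> complex) (\<alpha> :: real) (\<beta> :: real).
      C1_on {0..} \<epsilon> \<and> (\<forall>x\<ge>0. \<epsilon> x > 0) \<and> \<mu> > 0 \<and> \<alpha> < \<beta> \<and>
      C1_on {\<alpha>..\<beta>} E0 \<and> C1_on {\<alpha>..\<beta>} H0 \<longrightarrow>
        (\<exists>E H. maxwell_solution \<epsilon> \<mu> \<alpha> \<beta> E0 H0 E H) \<and>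
        (\<forall>E H. maxwell_solution \<epsilon> \<mu> \<alpha> \<beta> E0 H0 E H \<longrightarrow>
           (\<forall>x t. (x, t) \<in> maxwell_domain \<epsilon> \<mu> \<alpha> \<beta> \<and> 0 < x \<longrightarrow>
              E x t = complex_of_real (1 / sqrt (c_of \<epsilon> \<mu> x * \<epsilon> x)) *
                        bc_R (vekua_formula1 (f_of \<epsilon> \<mu>) (W0_of \<epsilon> \<mu> E0 H0) (xi_of \<epsilon> \<mu> x) t) \<and>
              H x t = - (\<i> / complex_of_real (sqrt (c_of \<epsilon> \<mu> x * \<mu>))) *
                        bc_I (vekua_formula1 (f_of \<epsilon> \<mu>) (W0_of \<epsilon> \<mu> E0 H0) (xi_of \<epsilon> \<mu> x) t))))"
proof (intro conjI allI impI; elim conjE)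
  fix \<epsilon> :: "real \<Rightarrow> real" and \<mu> :: real and E0 H0 :: "real \<Rightarrow> complex" and \<alpha> \<beta> :: real
  assume medium: "C1_on {0..} \<epsilon>" "\<forall>x\<ge>0. \<epsilon> x > 0" "\<mu> > 0"
    and data: "C1_on {\<alpha>..\<beta>} E0" "C1_on {\<alpha>..\<beta>} H0"
  obtain \<epsilon>' where "maxwell_medium \<epsilon> \<epsilon>' \<mu>" using maxwell_medium_of_C1[OF medium] .
  then interpret maxwell_medium \<epsilon> \<epsilon>' \<mu> .
  show "\<exists>E H. maxwell_solution \<epsilon> \<mu> \<alpha> \<beta> E0 H0 E H" by (rule maxwell_solution_exists[OF data])
  fix E H x t
  assume "maxwell_solution \<epsilon> \<mu> \<alpha> \<beta> E0 H0 E H" "(x, t) \<in> maxwell_domain \<epsilon> \<mu> \<alpha> \<beta>" "0 < x"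
  from maxwell_solution_formula[OF data this]
  show "E x t = complex_of_real (1 / sqrt (c_of \<epsilon> \<mu> x * \<epsilon> x)) *
      bc_R (vekua_formula1 (f_of \<epsilon> \<mu>) (W0_of \<epsilon> \<mu> E0 H0) (xi_of \<epsilon> \<mu> x) t)"
    "H x t = - (\<i> / complex_of_real (sqrt (c_of \<epsilon> \<mu> x * \<mu>))) *
      bc_I (vekua_formula1 (f_of \<epsilon> \<mu>) (W0_of \<epsilon> \<mu> E0 H0) (xi_of \<epsilon> \<mu> x) t)" .
qed (use vekua_solution_exists vekua_solution_formula in blast)+

end
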